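(* Let $w_1,w_2,\xi_1,\xi_2\in\mathbb{C}$ have modulus less than $1$, and put $\nu_1=w_1\overline{\xi}_1$, $\nu_2=w_2\overline{\xi}_2$, $x'=\left(\frac{\nu_1-\nu_2}{2-\nu_1-\nu_2}\right)^2$. For an integer $n\ge1$ write $K_n:=K_{D_n^{2,2}}\big((0,w_1,w_2),(0,\xi_1,\xi_2)\big)$, where $0\in\mathbb{C}^n$. Then: (i) For every integer $n\ge 1$, $$K_n=\frac{\Gamma(3+n)}{2\pi^{n+2}}\sum_{i=0}^n\sum_{k=0}^{n-i}\binom{n}{i}\binom{n-i}{k}\frac{(2)_i(2)_k\,\nu_1^i\,\nu_2^k}{(3)_{i+k}(1-\nu_1)^{2+i}(1-\nu_2)^{2+k}}.$$ (ii) For every integer $m\ge 0$, $$K_{2m+1}=\frac{C_m(2+m)(2-\nu_1-\nu_2)\,P_m^{(\frac32,\frac12)}\!\left(\frac{x'+1}{1-x'}\right)}{\pi^{2m+3}(1-\nu_1-\nu_2+\nu_1\nu_2)^{m+3}}-\frac{C_m(2m+1)\,P_m^{(\frac32,-\frac12)}\!\left(\frac{x'+1}{1-x'}\right)}{\pi^{2m+3}(1-\nu_1-\nu_2+\nu_1\nu_2)^{m+2}},$$ where $C_m=\frac{\Gamma(4+2m)\,m!}{6\,(\frac52)_m}$. (iii) For every integer $m\ge1$, $$K_{2m}=\Gamma(3+2m)\,m!\;\frac{2P_m^{(\frac32,-\frac12)}\!\left(\frac{x'+1}{1-x'}\right)-(2-\nu_1-\nu_2)\,P_{m-1}^{(\frac32,\frac12)}\!\left(\frac{x'+1}{1-x'}\right)}{6\,\pi^{2m+2}\,(\frac52)_{m-1}\,(1-\nu_1-\nu_2+\nu_1\nu_2)^{m+2}}.$$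 (iv) If $w_1\overline{\xi}_1=w_2\overline{\xi}_2$, then for every integer $n\ge1$, $$K_n=\frac{\Gamma(3+n)\,(3+n\,w_1\overline{\xi}_1)}{6\,\pi^{n+2}\,(1-w_1\overline{\xi}_1)^{4+n}}.$$
   Context: For an integer $n\ge1$, $D_n^{2,2}=\{(z,w_1,w_2)\in\mathbb{C}^{n}\times\mathbb{C}\times\mathbb{C} : |z_1|^2+\cdots+|z_n|^2+|w_1|^2<1,\ |z_1|^2+\cdots+|z_n|^2+|w_2|^2<1\}$. For a bounded domain $D\subset\mathbb{C}^N$, $K_D$ denotes its Bergman kernel, $K_D(z,w)=\sum_j\Phi_j(z)\overline{\Phi_j(w)}$ for any complete orthonormal basis $\{\Phi_j\}$ of the space $L^2_a(D)$ of holomorphic functions on $D$ square integrable with respect to Lebesgue measure. $(c)_d=c(c+1)\cdots(c+d-1)$ (with $(c)_0=1$) is the Pochhammer symbol. For $k,l>-1$ and an integer $d\ge0$, $P_d^{(k,l)}$ is the Jacobi polynomial $P_d^{(k,l)}(z)=\frac{(k+1)_d}{d!}\,{}_2F_1\!\left(-d,1+k+l+d;k+1;\frac{1-z}{2}\right)$, where ${}_2F_1(a,b;c;z)=\sum_{j\ge0}\frac{(a)_j(b)_j}{j!\,(c)_j}z^j$ (a terminating sum here, so a polynomial in $z$ of degree at most $d$, evaluated at any complex $z$). *)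

theory Defs
  imports "HOL-Analysis.Analysis"
begin

text \<open>
  \<open>\<complex>\<^sup>n \<times> \<complex> \<times> \<complex>\<close> is the product type below with \<open>n = CARD('n)\<close>. The measure \<^term>\<open>lborel\<close> on it
  is Lebesgue measure on \<open>\<real>\<^sup>2\<^sup>n\<^sup>+\<^sup>4\<close>.
\<close>

type_synonym 'n cspace = "(complex ^ 'n) \<times> complex \<times> complex"

definition cscale :: "complex \<Rightarrow> 'n cspace \<Rightarrow> 'n::finite cspace" where
  "cscale c p = (case p of (z, w1, w2) \<Rightarrow> (c *s z, c * w1, c * w2))"

text \<open>
  Holomorphy in several variables: complex differentiability, that is, a Frechet derivative that
  is complex linear. (The library's \<open>holomorphic_on\<close> covers one variable only.)
\<close>

definition holomorphic_sv :: "('n::finite cspace \<Rightarrow> complex) \<Rightarrow> 'n cspace set \<Rightarrow> bool" where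
  "holomorphic_sv f D \<longleftrightarrow>
     (\<forall>p\<in>D. \<exists>f'. (f has_derivative f') (at p within D) \<and> (\<forall>c v. f' (cscale c v) = c * f' v))"

text \<open>
  Elements of \<open>L\<^sup>2\<^sub>a(D)\<close> are represented by total functions; only their values on \<open>D\<close> matter.
\<close>

definition L2a :: "'n::finite cspace set \<Rightarrow> ('n cspace \<Rightarrow> complex) set" where
  "L2a D = {f. holomorphic_sv f D \<and> set_integrable lborel D (\<lambda>p. (norm (f p))\<^sup>2)}"

definition L2_inner ::
    "'n::finite cspace set \<Rightarrow> ('n cspace \<Rightarrow> complex) \<Rightarrow> ('n cspace \<Rightarrow> complex) \<Rightarrow> complex" where
  "L2_inner D f g = set_lebesgue_integral lborel D (\<lambda>p. f p * cnj (g p))"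

definition L2_norm :: "'n::finite cspace set \<Rightarrow> ('n cspace \<Rightarrow> complex) \<Rightarrow> real" where
  "L2_norm D f = sqrt (set_lebesgue_integral lborel D (\<lambda>p. (norm (f p))\<^sup>2))"

text \<open>
  An orthonormal sequence whose finite linear combinations are dense in \<open>L\<^sup>2\<^sub>a(D)\<close>. Indexing by the
  natural numbers is no restriction: for a bounded domain \<open>D\<close> the space \<open>L\<^sup>2\<^sub>a(D)\<close> is separable and
  infinite-dimensional.
\<close>

definition complete_orthonormal_basis ::
    "'n::finite cspace set \<Rightarrow> (nat \<Rightarrow> 'n cspace \<Rightarrow> complex) \<Rightarrow> bool" where
  "complete_orthonormal_basis D \<Phi> \<longleftrightarrow>
     (\<forall>j. \<Phi> j \<in> L2a D) \<and>
     (\<forall>i j. L2_inner D (\<Phi> i) (\<Phi> j) = (if i = j then 1 else 0)) \<and>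
     (\<forall>f\<in>L2a D. \<forall>\<epsilon>>0. \<exists>N c. L2_norm D (\<lambda>p. f p - (\<Sum>j<N. c j * \<Phi> j p)) < \<epsilon>)"

text \<open>
  The value is the common sum of \<open>\<Sum>\<^sub>j \<Phi>\<^sub>j(p) \<Phi>\<^sub>j(q)\<^sup>*\<close> over all complete orthonormal bases, so computing it
  requires both the existence of a basis and the independence of the sum from the basis.
\<close>

definition bergman_kernel ::
    "'n::finite cspace set \<Rightarrow> 'n cspace \<Rightarrow> 'n cspace \<Rightarrow> complex" where
  "bergman_kernel D p q =
     (THE k. \<forall>\<Phi>. complete_orthonormal_basis D \<Phi> \<longrightarrow> (\<lambda>j. \<Phi> j p * cnj (\<Phi> j q)) sums k)"

definition D22 :: "'n::finite cspace set" where
  "D22 = {(z, w1, w2). (\<Sum>i\<in>UNIV. (cmod (z $ i))\<^sup>2) + (cmod w1)\<^sup>2 < 1 \<and>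
                       (\<Sum>i\<in>UNIV. (cmod (z $ i))\<^sup>2) + (cmod w2)\<^sup>2 < 1}"

definition hyp2F1 :: "complex \<Rightarrow> complex \<Rightarrow> complex \<Rightarrow> complex \<Rightarrow> complex" where
  "hyp2F1 a b c z = (\<Sum>j. pochhammer a j * pochhammer b j / (fact j * pochhammer c j) * z ^ j)"

definition jacobi_P :: "nat \<Rightarrow> real \<Rightarrow> real \<Rightarrow> complex \<Rightarrow> complex" where
  "jacobi_P d k l z =
     of_real (pochhammer (k + 1) d / fact d) *
     hyp2F1 (- of_nat d) (of_real (1 + k + l + of_nat d)) (of_real (k + 1)) ((1 - z) / 2)"

end

theory Submission
  imports Defs "HOL-Complex_Analysis.Complex_Analysis"
begin

text \<open>
  At points with vanishing first component the Bergman kernel is found from its reproducing property. For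
  \<open>\<bar>\<xi>1\<bar>, \<bar>\<xi>2\<bar> < 1\<close> there is an explicit rational function \<open>kernel_section \<xi>1 \<xi>2\<close> in \<open>L2a D22\<close> whose inner
  product with every \<open>f\<close> is \<open>f (0, \<xi>1, \<xi>2)\<close> (\<open>kernel_section_reproducing\<close>). Parseval's identity
  (\<open>parseval_sums\<close>) then sums \<open>\<Phi>\<^sub>j(p) \<Phi>\<^sub>j(q)\<^sup>*\<close> to the value of that function for every complete orthonormal
  basis \<open>\<Phi>\<close>. Such a basis exists because \<open>L2a D22\<close> is separable and of infinite dimension
  (\<open>complete_orthonormal_basis_exists\<close>), so the definite description in \<open>bergman_kernel\<close> denotes this value
  (\<open>bergman_kernel_D22\<close>).

  For the reproducing property, invariance of the domain under \<open>z \<mapsto> e\<^bsup>i\<theta>\<^esup> z\<close> and the mean value property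
  replace \<open>f\<close> by \<open>F w = f (0, w)\<close> (\<open>D22_integral_mean\<close>). The fibre over \<open>z\<close> is a bidisc with
  \<open>r\<^sup>2 = 1 - \<bar>z\<bar>\<^sup>2\<close>, where pairing \<open>F\<close> with the part \<open>h\<^sub>N\<close> of degree \<open>N\<close> of
  \<open>\<Sum> (a + 1) (b + 1) \<nu>1\<^sup>a \<nu>2\<^sup>b\<close> extracts \<open>\<pi>\<^sup>2 r\<^bsup>2N+4\<^esup>\<close> times the part of degree \<open>N\<close> of \<open>F\<close>
  (\<open>bidisc_coefficient\<close>). Integration over the ball turns the power of \<open>r\<close> into a Beta integral
  (\<open>D22_coefficient\<close>), and therefore
  \<open>K = \<pi>\<^bsup>-(n+2)\<^esup> \<Sum>\<^sub>N (N + 3)\<^sub>n h\<^sub>N(\<nu>1, \<nu>2)\<close>, where \<open>(N + 3)\<^sub>n\<close> is a Pochhammer symbol.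

  Put \<open>x = 1 - \<nu>1\<close>, \<open>y = 1 - \<nu>2\<close> and let \<open>g\<^sub>n\<close> be the coefficient of \<open>t\<^sup>n\<close> in \<open>((x - t) (y - t))\<^bsup>-2\<^esup>\<close>
  (\<open>gegen\<close>). Expanding in \<open>\<nu>1\<close> and \<open>\<nu>2\<close> gives \<open>K = n! (g\<^sub>n - g\<^sub>n\<^sub>-\<^sub>1) / \<pi>\<^bsup>n+2\<^esup>\<close>. The double sum has the same
  power series, by two Vandermonde convolutions (\<open>double_sum_eq_gegen\<close>); the case \<open>\<nu>1 = \<nu>2\<close> is immediate
  since then \<open>x = y\<close> (\<open>gegen_diagonal\<close>). Finally \<open>g\<^sub>n\<close> is, up to scaling, the Gegenbauer polynomial of
  degree \<open>n\<close> with parameter \<open>2\<close>, and its expression by Jacobi polynomials (\<open>gegen_quadratic\<close>) is a quadratic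
  transformation whose form depends on the parity of \<open>n\<close>. It is proved by matching the three-term recurrence
  of \<open>g\<^sub>n\<close> with two contiguous relations.
\<close>

section \<open>Orthonormal sequences in a semi-inner product space\<close>

text \<open>
  A function that vanishes on the domain has norm zero without being the zero function, so the form is only
  semidefinite; no quotient is taken.
\<close>

locale semi_inner_space =
  fixes V :: "('a \<Rightarrow> complex) set"
    and ip :: "('a \<Rightarrow> complex) \<Rightarrow> ('a \<Rightarrow> complex) \<Rightarrow> complex"
  assumes zero_mem: "(\<lambda>_. 0) \<in> V"
    and add_mem: "\<And>f g. f \<in> V \<Longrightarrow> g \<in> V \<Longrightarrow> (\<lambda>p. f p + g p) \<in> V"
    and scale_mem: "\<And>c f. f \<in> V \<Longrightarrow> (\<lambda>p. c * f p) \<in> V"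
    and ip_add_left: "\<And>f g h. f \<in> V \<Longrightarrow> g \<in> V \<Longrightarrow> h \<in> V \<Longrightarrow>
          ip (\<lambda>p. f p + g p) h = ip f h + ip g h"
    and ip_scale_left: "\<And>c f h. f \<in> V \<Longrightarrow> h \<in> V \<Longrightarrow> ip (\<lambda>p. c * f p) h = c * ip f h"
    and ip_cnj: "\<And>f g. f \<in> V \<Longrightarrow> g \<in> V \<Longrightarrow> ip g f = cnj (ip f g)"
    and ip_nonneg: "\<And>f. f \<in> V \<Longrightarrow> 0 \<le> Re (ip f f)"
begin

definition nrm :: "('a \<Rightarrow> complex) \<Rightarrow> real" where
  "nrm f = sqrt (Re (ip f f))"

lemma nrm_nonneg: "f \<in> V \<Longrightarrow> 0 \<le> nrm f"
  by (simp add: nrm_def ip_nonneg)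

lemma nrm_square: "f \<in> V \<Longrightarrow> (nrm f)\<^sup>2 = Re (ip f f)"
  by (simp add: nrm_def ip_nonneg)

lemma ip_self: "f \<in> V \<Longrightarrow> ip f f = of_real ((nrm f)\<^sup>2)"
  using ip_cnj[of f f] by (simp add: nrm_square complex_eq_iff)

lemma diff_mem: "f \<in> V \<Longrightarrow> g \<in> V \<Longrightarrow> (\<lambda>p. f p - g p) \<in> V"
  using add_mem[OF _ scale_mem[of g "-1"], of f] by simp

lemma ip_diff_left:
  "f \<in> V \<Longrightarrow> g \<in> V \<Longrightarrow> h \<in> V \<Longrightarrow> ip (\<lambda>p. f p - g p) h = ip f h - ip g h"
  using ip_add_left[OF _ scale_mem[of g "-1"], of f h] ip_scale_left[of g h "-1"] by simp

lemma ip_diff_right: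
  assumes "f \<in> V" "g \<in> V" "h \<in> V"
  shows "ip h (\<lambda>p. f p - g p) = ip h f - ip h g"
  using ip_diff_left[OF assms] ip_cnj[OF diff_mem[OF assms(1,2)] assms(3)]
    ip_cnj[OF assms(1,3)] ip_cnj[OF assms(2,3)] by simp

lemma ip_scale_right:
  assumes "f \<in> V" "h \<in> V"
  shows "ip h (\<lambda>p. c * f p) = cnj c * ip h f"
  using ip_scale_left[OF assms, of c] ip_cnj[OF scale_mem[OF assms(1)] assms(2)]
    ip_cnj[OF assms] by simp

lemma sum_mem:
  assumes "\<And>j. j \<in> I \<Longrightarrow> e j \<in> V"
  shows "(\<lambda>p. \<Sum>j\<in>I. c j * e j p) \<in> V"
  using assms
proof (induction I rule: infinite_finite_induct)
  case (insert x F)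
  then show ?case using add_mem[OF scale_mem[of "e x" "c x"]] by simp
qed (auto simp: zero_mem)

lemma ip_sum_left:
  assumes "\<And>j. j \<in> I \<Longrightarrow> e j \<in> V" "h \<in> V"
  shows "ip (\<lambda>p. \<Sum>j\<in>I. c j * e j p) h = (\<Sum>j\<in>I. c j * ip (e j) h)"
proof -
  have z: "ip (\<lambda>_. 0) h = 0"
    using ip_scale_left[OF zero_mem assms(2), of 0] by simp
  show ?thesis using assms(1)
  proof (induction I rule: infinite_finite_induct)
    case (insert x F)
    then show ?case
      using ip_add_left[OF scale_mem[of "e x" "c x"] sum_mem[of F e c] assms(2)]
        ip_scale_left[of "e x" h "c x"] assms(2) by simp
  qed (auto simp: z)
qed

lemma ip_diff_scale_self:
  assumes f: "f \<in> V" and g: "g \<in> V"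
  shows "ip (\<lambda>p. f p - c * g p) (\<lambda>p. f p - c * g p)
       = ip f f - cnj c * ip f g - c * cnj (ip f g) + c * cnj c * ip g g"
proof -
  have cg: "(\<lambda>p. c * g p) \<in> V" using g by (rule scale_mem)
  show ?thesis
    by (simp only: ip_diff_left[OF f cg diff_mem[OF f cg]] ip_diff_right[OF f cg f]
        ip_diff_right[OF f cg cg] ip_scale_left[OF g f] ip_scale_left[OF g cg]
        ip_scale_right[OF g f] ip_scale_right[OF g g] ip_cnj[OF f g])
      (simp add: algebra_simps)
qed

lemma nrm_diff_scale_square:
  assumes "f \<in> V" "e \<in> V" "nrm e = 1"
  shows "(nrm (\<lambda>p. f p - c * e p))\<^sup>2 = (nrm f)\<^sup>2 + (cmod (c - ip f e))\<^sup>2 - (cmod (ip f e))\<^sup>2"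
proof -
  have "ip (\<lambda>p. f p - c * e p) (\<lambda>p. f p - c * e p)
      = ip f f - cnj c * ip f e - c * cnj (ip f e) + c * cnj c"
    using ip_diff_scale_self[OF assms(1,2), of c] ip_self[OF assms(2)] assms(3) by simp
  then show ?thesis
    using assms by (simp add: nrm_square diff_mem scale_mem cmod_power2)
      (simp add: power2_eq_square algebra_simps)
qed

text \<open>
  Completing the square: the deviation from the best coefficients \<open>ip f (e j)\<close> enters as a sum of
  squares. Bessel's inequality and the best approximation property are the special cases used below.
\<close>

lemma nrm_diff_orthonormal_sum:
  assumes "finite I" "f \<in> V" "\<And>j. j \<in> I \<Longrightarrow> e j \<in> V"
    and "\<And>i j. i \<in> I \<Longrightarrow> j \<in> I \<Longrightarrow> ip (e i) (e j) = (if i = j then 1 else 0)"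
  shows "(nrm (\<lambda>p. f p - (\<Sum>j\<in>I. c j * e j p)))\<^sup>2
       = (nrm f)\<^sup>2 + (\<Sum>j\<in>I. (cmod (c j - ip f (e j)))\<^sup>2) - (\<Sum>j\<in>I. (cmod (ip f (e j)))\<^sup>2)"
  using assms(1,3,4)
proof (induction I rule: finite_induct)
  case (insert x F)
  let ?s = "\<lambda>p. \<Sum>j\<in>F. c j * e j p"
  have s: "?s \<in> V" using insert by (intro sum_mem) auto
  have x: "e x \<in> V" using insert by auto
  have one: "nrm (e x) = 1" using insert.prems(2)[of x x] by (simp add: nrm_def)
  have "ip ?s (e x) = (\<Sum>j\<in>F. c j * ip (e j) (e x))"
    using insert by (intro ip_sum_left) auto
  also have "\<dots> = 0" using insert by (intro sum.neutral) auto
  finally have "ip (\<lambda>p. f p - ?s p) (e x) = ip f (e x)"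
    using ip_diff_left[OF assms(2) s x] by simp
  moreover have "(\<lambda>p. f p - (\<Sum>j\<in>insert x F. c j * e j p)) = (\<lambda>p. (f p - ?s p) - c x * e x p)"
    using insert.hyps by (auto simp: algebra_simps)
  moreover have "(nrm (\<lambda>p. f p - ?s p))\<^sup>2
       = (nrm f)\<^sup>2 + (\<Sum>j\<in>F. (cmod (c j - ip f (e j)))\<^sup>2) - (\<Sum>j\<in>F. (cmod (ip f (e j)))\<^sup>2)"
    using insert by (intro insert.IH) auto
  ultimately show ?case
    using nrm_diff_scale_square[OF diff_mem[OF assms(2) s] x one, of "c x"] insert.hyps by simp
qed simp

lemma bessel_inequality:
  assumes "finite I" "f \<in> V" "\<And>j. j \<in> I \<Longrightarrow> e j \<in> V"
    and "\<And>i j. i \<in> I \<Longrightarrow> j \<in> I \<Longrightarrow> ip (e i) (e j) = (if i = j then 1 else 0)"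
  shows "(\<Sum>j\<in>I. (cmod (ip f (e j)))\<^sup>2) \<le> (nrm f)\<^sup>2"
  using nrm_diff_orthonormal_sum[OF assms, of "\<lambda>j. ip f (e j)"]
    zero_le_power2[of "nrm (\<lambda>p. f p - (\<Sum>j\<in>I. ip f (e j) * e j p))"] by simp

lemma cauchy_schwarz:
  assumes f: "f \<in> V" and g: "g \<in> V"
  shows "cmod (ip f g) \<le> nrm f * nrm g"
proof (cases "nrm g = 0")
  case True
  \<comment> \<open>Expand the square norm of \<open>f - t (ip f g) g\<close>; a large \<open>t\<close> forces \<open>ip f g = 0\<close>.\<close>
  have *: "2 * t * (cmod (ip f g))\<^sup>2 \<le> (nrm f)\<^sup>2" for t :: real
  proof -
    let ?c = "of_real t * ip f g"
    have "ip (\<lambda>p. f p - ?c * g p) (\<lambda>p. f p - ?c * g p)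
        = ip f f - cnj ?c * ip f g - ?c * cnj (ip f g)"
      using ip_diff_scale_self[OF f g, of ?c] ip_self[OF g] True by simp
    then have "Re (ip (\<lambda>p. f p - ?c * g p) (\<lambda>p. f p - ?c * g p))
        = (nrm f)\<^sup>2 - 2 * t * (cmod (ip f g))\<^sup>2"
      using f by (simp add: nrm_square cmod_power2) (simp add: power2_eq_square algebra_simps)
    then show ?thesis
      using ip_nonneg[OF diff_mem[OF f scale_mem[OF g, of ?c]]] by simp
  qed
  have "(cmod (ip f g))\<^sup>2 = 0"
  proof (rule ccontr)
    assume "(cmod (ip f g))\<^sup>2 \<noteq> 0"
    then show False
      using *[of "((nrm f)\<^sup>2 + 1) / (2 * (cmod (ip f g))\<^sup>2)"] by (simp add: field_simps)
  qed
  then show ?thesis using True by simp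
next
  case False
  then have pos: "0 < nrm g" using nrm_nonneg[OF g] by simp
  define e where "e = (\<lambda>p. of_real (1 / nrm g) * g p)"
  have e: "e \<in> V" unfolding e_def using g by (rule scale_mem)
  have one: "ip e e = 1"
  proof -
    have "ip e e = of_real (1 / nrm g) * ip g e"
      by (subst (1) e_def) (rule ip_scale_left[OF g e])
    also have "\<dots> = of_real (1 / nrm g) * (cnj (of_real (1 / nrm g)) * ip g g)"
      using ip_scale_right[OF g g, of "of_real (1 / nrm g)"] by (simp only: e_def)
    also have "\<dots> = of_real (1 / nrm g * (1 / nrm g * (nrm g)\<^sup>2))"
      by (simp only: ip_self[OF g] of_real_mult complex_cnj_complex_of_real)
    also have "\<dots> = 1" using pos by (simp add: power2_eq_square)
    finally show ?thesis .
  qed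
  have "(\<Sum>j\<in>{()}. (cmod (ip f e))\<^sup>2) \<le> (nrm f)\<^sup>2"
    by (rule bessel_inequality[OF _ f]) (auto simp: e one)
  then have "cmod (ip f e) \<le> nrm f"
    using nrm_nonneg[OF f] by (simp add: abs_le_square_iff[symmetric])
  moreover have "cmod (ip f e) = cmod (ip f g) / nrm g"
    using pos by (simp add: e_def ip_scale_right[OF g f] norm_mult norm_divide del: of_real_divide)
  ultimately show ?thesis using pos by (simp add: field_simps)
qed

lemma nrm_triangle:
  assumes f: "f \<in> V" and g: "g \<in> V"
  shows "nrm (\<lambda>p. f p + g p) \<le> nrm f + nrm g"
proof (rule power2_le_imp_le)
  have a: "ip (\<lambda>p. f p + g p) h = ip f h + ip g h" if "h \<in> V" for h
    using ip_add_left[OF f g that] .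
  have "ip (\<lambda>p. f p + g p) (\<lambda>p. f p + g p)
      = cnj (ip f f + ip g f) + cnj (ip f g + ip g g)"
    using a[OF add_mem[OF f g]] ip_cnj[OF add_mem[OF f g] f] ip_cnj[OF add_mem[OF f g] g]
      a[OF f] a[OF g] by simp
  then have "(nrm (\<lambda>p. f p + g p))\<^sup>2 = (nrm f)\<^sup>2 + (nrm g)\<^sup>2 + 2 * Re (ip f g)"
    using ip_cnj[OF f g] by (simp add: nrm_square f g add_mem)
  also have "\<dots> \<le> (nrm f)\<^sup>2 + (nrm g)\<^sup>2 + 2 * (nrm f * nrm g)"
    using cauchy_schwarz[OF f g] complex_Re_le_cmod[of "ip f g"] by simp
  finally show "(nrm (\<lambda>p. f p + g p))\<^sup>2 \<le> (nrm f + nrm g)\<^sup>2"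
    by (simp add: power2_eq_square algebra_simps)
qed (simp add: nrm_nonneg f g)

definition orthonormal :: "('i \<Rightarrow> 'a \<Rightarrow> complex) \<Rightarrow> 'i set \<Rightarrow> bool" where
  "orthonormal e I \<longleftrightarrow> (\<forall>j\<in>I. e j \<in> V) \<and>
     (\<forall>i\<in>I. \<forall>j\<in>I. ip (e i) (e j) = (if i = j then 1 else 0))"

definition complete_seq :: "(nat \<Rightarrow> 'a \<Rightarrow> complex) \<Rightarrow> bool" where
  "complete_seq e \<longleftrightarrow> (\<forall>f\<in>V. \<forall>\<epsilon>>0. \<exists>N c. nrm (\<lambda>p. f p - (\<Sum>j<N. c j * e j p)) < \<epsilon>)"

text \<open>
  The partial sums are \<open>ip (P\<^sub>N u) v\<close> for the orthogonal projections \<open>P\<^sub>N\<close>, and \<open>u - P\<^sub>N u\<close> is no longer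
  than any approximation error with at most \<open>N\<close> terms.
\<close>

lemma parseval_sums:
  assumes on: "orthonormal e UNIV" and co: "complete_seq e" and u: "u \<in> V" and v: "v \<in> V"
  shows "(\<lambda>j. ip u (e j) * ip (e j) v) sums ip u v"
  unfolding sums_def
proof (rule LIMSEQ_I)
  fix \<epsilon> :: real assume "\<epsilon> > 0"
  define d where "d = \<epsilon> / (nrm v + 1)"
  have nv: "0 \<le> nrm v" using nrm_nonneg[OF v] .
  have d: "d > 0" using \<open>\<epsilon> > 0\<close> nv by (simp add: d_def)
  have mem: "e j \<in> V" for j using on by (simp add: orthonormal_def)
  have oe: "ip (e i) (e j) = (if i = j then 1 else 0)" for i j
    using on by (simp add: orthonormal_def)
  obtain N c where N: "nrm (\<lambda>p. u p - (\<Sum>j<N. c j * e j p)) < d"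
    using co u d unfolding complete_seq_def by blast
  show "\<exists>M. \<forall>n\<ge>M. norm ((\<Sum>j<n. ip u (e j) * ip (e j) v) - ip u v) < \<epsilon>"
  proof (intro exI allI impI)
    fix n assume n: "N \<le> n"
    let ?P = "\<lambda>p. \<Sum>j<n. ip u (e j) * e j p"
    have P: "?P \<in> V" by (intro sum_mem mem)
    define c' where "c' j = (if j < N then c j else 0)" for j
    have c': "(\<Sum>j<n. c' j * e j p) = (\<Sum>j<N. c j * e j p)" for p
      unfolding c'_def using n by (intro sum.mono_neutral_cong_right) auto
    have "(nrm (\<lambda>p. u p - ?P p))\<^sup>2 \<le> (nrm (\<lambda>p. u p - (\<Sum>j<n. c' j * e j p)))\<^sup>2"
      using nrm_diff_orthonormal_sum[of "{..<n}" u e "\<lambda>j. ip u (e j)"]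
        nrm_diff_orthonormal_sum[of "{..<n}" u e c'] mem oe u by (simp add: sum_nonneg)
    then have "nrm (\<lambda>p. u p - ?P p) \<le> nrm (\<lambda>p. u p - (\<Sum>j<n. c' j * e j p))"
      using nrm_nonneg[OF diff_mem[OF u sum_mem[of "{..<n}" e c']]] mem
      by (meson power2_le_imp_le)
    then have *: "nrm (\<lambda>p. u p - ?P p) < d" using N by (simp add: c')
    have "ip ?P v = (\<Sum>j<n. ip u (e j) * ip (e j) v)"
      by (intro ip_sum_left mem v)
    then have "norm ((\<Sum>j<n. ip u (e j) * ip (e j) v) - ip u v) = cmod (ip (\<lambda>p. u p - ?P p) v)"
      by (simp add: ip_diff_left[OF u P v] norm_minus_commute)
    also have "\<dots> \<le> nrm (\<lambda>p. u p - ?P p) * nrm v"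
      by (intro cauchy_schwarz diff_mem u P v)
    also have "\<dots> \<le> d * nrm v" using * nv by (intro mult_right_mono) auto
    also have "\<dots> < \<epsilon>" using \<open>\<epsilon> > 0\<close> nv by (simp add: d_def field_simps)
    finally show "norm ((\<Sum>j<n. ip u (e j) * ip (e j) v) - ip u v) < \<epsilon>" .
  qed
qed

text \<open>
  A residual of length zero yields the zero function, because division by zero gives zero: linearly
  dependent terms are marked this way and skipped later.
\<close>

fun gram_schmidt :: "(nat \<Rightarrow> 'a \<Rightarrow> complex) \<Rightarrow> nat \<Rightarrow> 'a \<Rightarrow> complex" where
  "gram_schmidt g k =
     (let r = (\<lambda>p. g k p - (\<Sum>j<k. ip (g k) (gram_schmidt g j) * gram_schmidt g j p))
      in (\<lambda>p. of_real (1 / nrm r) * r p))"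

declare gram_schmidt.simps [simp del]


lemma gram_schmidt_rec:
  fixes g defines "r \<equiv> \<lambda>k p. g k p - (\<Sum>j<k. ip (g k) (gram_schmidt g j) * gram_schmidt g j p)"
  shows "gram_schmidt g k = (\<lambda>p. of_real (1 / nrm (r k)) * r k p)"
  unfolding r_def by (subst gram_schmidt.simps) (simp add: Let_def)

text \<open>
  The double sum of \<open>\<bar>ip (u i) (e j)\<bar>\<^sup>2\<close> is \<open>card A\<close> by the spanning hypothesis and at most \<open>card B\<close> by Bessel's
  inequality for \<open>u\<close>.
\<close>

lemma orthonormal_card_le:
  assumes u: "orthonormal u A" "finite A" and e: "orthonormal e B" "finite B"
    and span: "\<And>i. i \<in> A \<Longrightarrow> (nrm (u i))\<^sup>2 = (\<Sum>j\<in>B. (cmod (ip (u i) (e j)))\<^sup>2)"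
  shows "card A \<le> card B"
proof -
  have uV: "u i \<in> V" if "i \<in> A" for i using u that by (simp add: orthonormal_def)
  have eV: "e i \<in> V" if "i \<in> B" for i using e that by (simp add: orthonormal_def)
  have "(\<Sum>i\<in>A. 1) = (\<Sum>i\<in>A. (nrm (u i))\<^sup>2)"
    using u by (intro sum.cong) (auto simp: orthonormal_def nrm_def)
  also have "\<dots> = (\<Sum>i\<in>A. \<Sum>j\<in>B. (cmod (ip (u i) (e j)))\<^sup>2)"
    using span by (intro sum.cong) auto
  also have "\<dots> = (\<Sum>j\<in>B. \<Sum>i\<in>A. (cmod (ip (e j) (u i)))\<^sup>2)"
    by (subst sum.swap, intro sum.cong refl) (metis complex_mod_cnj eV ip_cnj uV)
  also have "\<dots> \<le> (\<Sum>j\<in>B. (nrm (e j))\<^sup>2)"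
    using u e by (intro sum_mono bessel_inequality) (auto simp: orthonormal_def)
  also have "\<dots> = (\<Sum>j\<in>B. 1)"
    using e by (intro sum.cong) (auto simp: orthonormal_def nrm_def)
  finally show ?thesis by simp
qed

text \<open>
  Gram--Schmidt is applied to a dense sequence and the terms of norm zero are dropped. Infinitely many terms
  survive, since otherwise the whole space would be spanned, up to norm zero, by finitely many
  orthonormal vectors, against \<open>orthonormal_card_le\<close>; so they can be enumerated.
\<close>

theorem complete_orthonormal_seq_exists:
  assumes gV: "\<And>k. g k \<in> V"
    and dense: "\<And>f \<epsilon>. f \<in> V \<Longrightarrow> \<epsilon> > 0 \<Longrightarrow> \<exists>k::nat. nrm (\<lambda>p. f p - g k p) < \<epsilon>"
    and u: "orthonormal u (UNIV :: nat set)"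
  shows "\<exists>e. orthonormal e UNIV \<and> complete_seq e"
proof -
  define E where "E = gram_schmidt g"
  define r where "r k = (\<lambda>p. g k p - (\<Sum>j<k. ip (g k) (E j) * E j p))" for k
  define J where "J = {k. nrm (r k) \<noteq> 0}"
  have E: "E k = (\<lambda>p. of_real (1 / nrm (r k)) * r k p)" for k
    unfolding E_def r_def by (rule gram_schmidt_rec)
  have EV: "E k \<in> V" for k
  proof (induction k rule: less_induct)
    case (less k)
    have "r k \<in> V" unfolding r_def by (intro diff_mem gV sum_mem less) auto
    then show ?case unfolding E by (rule scale_mem)
  qed
  have rV: "r k \<in> V" for k unfolding r_def by (intro diff_mem gV sum_mem EV)
  have E0: "E k = (\<lambda>_. 0)" if "k \<notin> J" for k
    using that unfolding E J_def by auto
  have r: "r k p = of_real (nrm (r k)) * E k p" if "k \<in> J" for k p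
    using that unfolding E J_def by simp
  have normE: "ip (E k) (E k) = 1" if "k \<in> J" for k
  proof -
    have "ip (E k) (E k) = of_real (1 / nrm (r k)) * (cnj (of_real (1 / nrm (r k))) * ip (r k) (r k))"
      using EV[of k] unfolding E by (simp only: ip_scale_left rV ip_scale_right)
    also have "\<dots> = of_real (1 / nrm (r k) * (1 / nrm (r k) * (nrm (r k))\<^sup>2))"
      by (simp only: ip_self[OF rV] of_real_mult complex_cnj_complex_of_real)
    also have "\<dots> = 1" using that by (simp add: J_def power2_eq_square)
    finally show ?thesis .
  qed
  have orth: "ip (E k) (E i) = 0" if "i < k" for i k
    using that
  proof (induction k arbitrary: i rule: less_induct)
    case (less k)
    have sym: "ip (E j) (E i) = 0" if "j < k" "j \<noteq> i" for j
    proof (cases "i < j")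
      case True then show ?thesis using less.IH that by blast
    next
      case False
      then have "ip (E i) (E j) = 0" using less.IH[OF less.prems] that by auto
      then show ?thesis using ip_cnj[OF EV EV, of i j] by simp
    qed
    have "ip (r k) (E i) = ip (g k) (E i) - (\<Sum>j<k. ip (g k) (E j) * ip (E j) (E i))"
      unfolding r_def
      by (subst ip_diff_left[OF gV sum_mem EV], rule EV, subst ip_sum_left[OF EV EV]) simp
    also have "(\<Sum>j<k. ip (g k) (E j) * ip (E j) (E i)) = (\<Sum>j\<in>{i}. ip (g k) (E j) * ip (E j) (E i))"
      using less.prems sym by (intro sum.mono_neutral_right) auto
    also have "\<dots> = ip (g k) (E i)"
    proof (cases "i \<in> J")
      case False
      have "ip (g k) (\<lambda>_. 0) = 0" using ip_scale_right[OF zero_mem gV, of k 0] by simp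
      then show ?thesis using E0[OF False] by simp
    qed (simp add: normE)
    finally show ?case using ip_scale_left[OF rV EV, of "of_real (1 / nrm (r k))" k i] E[of k] by simp
  qed
  have onJ: "orthonormal E J"
    unfolding orthonormal_def
  proof (intro conjI ballI)
    fix i j assume "i \<in> J" "j \<in> J"
    then show "ip (E i) (E j) = (if i = j then 1 else 0)"
      using orth[of i j] orth[of j i] normE ip_cnj[OF EV EV, of j i]
      by (cases i j rule: linorder_cases) auto
  qed (rule EV)
  have onJ': "orthonormal E (J \<inter> A)" for A
    using onJ by (auto simp: orthonormal_def)
  \<comment> \<open>Coefficients of \<open>g k\<close>; the last one is the norm of the residual.\<close>
  define d where "d k j = (if j = k then of_real (nrm (r k)) else ip (g k) (E j))" for k j
  have gE: "nrm (\<lambda>p. g k p - (\<Sum>j\<in>J \<inter> {..k}. d k j * E j p)) = 0" for k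
  proof -
    have s: "(\<Sum>j\<in>J \<inter> {..k}. d k j * E j p) = (\<Sum>j<k. ip (g k) (E j) * E j p) + d k k * E k p" for p
    proof -
      have "(\<Sum>j\<in>J \<inter> {..k}. d k j * E j p) = (\<Sum>j\<le>k. d k j * E j p)"
      proof (rule sum.mono_neutral_left)
        show "\<forall>j\<in>{..k} - J \<inter> {..k}. d k j * E j p = 0"
        proof
          fix j assume "j \<in> {..k} - J \<inter> {..k}"
          then have "j \<notin> J" by auto
          then show "d k j * E j p = 0" by (simp add: E0)
        qed
      qed auto
      also have "\<dots> = (\<Sum>j<k. d k j * E j p) + d k k * E k p"
        by (simp add: lessThan_Suc_atMost[symmetric])
      finally show ?thesis by (simp add: d_def)
    qed
    show ?thesis
    proof (cases "k \<in> J")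
      case True
      have "ip (\<lambda>_. 0) (\<lambda>_. 0) = 0" using ip_scale_right[OF zero_mem zero_mem, of 0] by simp
      moreover have "(\<lambda>p. g k p - (\<Sum>j\<in>J \<inter> {..k}. d k j * E j p)) = (\<lambda>_. 0)"
      proof
        fix p
        have "g k p - (\<Sum>j<k. ip (g k) (E j) * E j p) = d k k * E k p"
          using r[OF True, of p] fun_cong[OF r_def[of k], of p] by (simp only: d_def if_True refl)
        then show "g k p - (\<Sum>j\<in>J \<inter> {..k}. d k j * E j p) = 0"
          by (simp only: s) (simp add: algebra_simps)
      qed
      ultimately show ?thesis by (simp add: nrm_def)
    next
      case False
      then have "(\<lambda>p. g k p - (\<Sum>j\<in>J \<inter> {..k}. d k j * E j p)) = r k"
        by (auto simp: s r_def E0)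
      then show ?thesis using False by (simp add: J_def)
    qed
  qed
  have approx: "\<exists>k. nrm (\<lambda>p. f p - (\<Sum>j\<in>J \<inter> {..k}. d k j * E j p)) < \<epsilon>"
    if f: "f \<in> V" and eps: "\<epsilon> > 0" for f \<epsilon>
  proof -
    obtain k where k: "nrm (\<lambda>p. f p - g k p) < \<epsilon>" using dense[OF f eps] by blast
    let ?s = "\<lambda>p. \<Sum>j\<in>J \<inter> {..k}. d k j * E j p"
    have s: "?s \<in> V" by (intro sum_mem EV)
    have "nrm (\<lambda>p. f p - ?s p) \<le> nrm (\<lambda>p. f p - g k p) + nrm (\<lambda>p. g k p - ?s p)"
      using nrm_triangle[OF diff_mem[OF f gV[of k]] diff_mem[OF gV[of k] s]] by simp
    then have "nrm (\<lambda>p. f p - ?s p) < \<epsilon>" using k gE[of k] by linarith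
    then show ?thesis by blast
  qed
  have inf: "infinite J"
  proof
    assume fin: "finite J"
    have "(nrm f)\<^sup>2 = (\<Sum>j\<in>J. (cmod (ip f (E j)))\<^sup>2)" if f: "f \<in> V" for f
    proof (rule antisym)
      show "(\<Sum>j\<in>J. (cmod (ip f (E j)))\<^sup>2) \<le> (nrm f)\<^sup>2"
        using onJ f fin by (intro bessel_inequality) (auto simp: orthonormal_def)
      show "(nrm f)\<^sup>2 \<le> (\<Sum>j\<in>J. (cmod (ip f (E j)))\<^sup>2)"
      proof (rule field_le_epsilon)
        fix \<epsilon> :: real assume "\<epsilon> > 0"
        then obtain k where k: "nrm (\<lambda>p. f p - (\<Sum>j\<in>J \<inter> {..k}. d k j * E j p)) < sqrt \<epsilon>"
          using approx[OF f, of "sqrt \<epsilon>"] by auto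
        let ?s = "\<lambda>p. \<Sum>j\<in>J \<inter> {..k}. d k j * E j p"
        have "(nrm (\<lambda>p. f p - ?s p))\<^sup>2 \<le> (sqrt \<epsilon>)\<^sup>2"
          using k nrm_nonneg[OF diff_mem[OF f sum_mem[of "J \<inter> {..k}" E "d k"]]] EV
          by (intro power_mono) auto
        moreover have "(nrm (\<lambda>p. f p - ?s p))\<^sup>2
            \<ge> (nrm f)\<^sup>2 - (\<Sum>j\<in>J \<inter> {..k}. (cmod (ip f (E j)))\<^sup>2)"
          using nrm_diff_orthonormal_sum[of "J \<inter> {..k}" f E "d k"] onJ'[of "{..k}"] f
          by (auto simp: orthonormal_def intro!: sum_nonneg)
        moreover have "(\<Sum>j\<in>J \<inter> {..k}. (cmod (ip f (E j)))\<^sup>2) \<le> (\<Sum>j\<in>J. (cmod (ip f (E j)))\<^sup>2)"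
          by (intro sum_mono2 fin) auto
        ultimately show "(nrm f)\<^sup>2 \<le> (\<Sum>j\<in>J. (cmod (ip f (E j)))\<^sup>2) + \<epsilon>"
          using \<open>\<epsilon> > 0\<close> by simp
      qed
    qed
    then have "card {..card J} \<le> card J"
      using u fin by (intro orthonormal_card_le[of u _ E J] onJ) (auto simp: orthonormal_def)
    then show False by simp
  qed
  define e where "e n = E (enumerate J n)" for n
  have "orthonormal e UNIV"
    using onJ enumerate_in_set[OF inf] strict_mono_enumerate[OF inf]
    by (auto simp: orthonormal_def e_def strict_mono_eq)
  moreover have "complete_seq e"
    unfolding complete_seq_def
  proof (intro ballI allI impI)
    fix f and \<epsilon> :: real assume "f \<in> V" "\<epsilon> > 0"
    then obtain k where k: "nrm (\<lambda>p. f p - (\<Sum>j\<in>J \<inter> {..k}. d k j * E j p)) < \<epsilon>"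
      using approx by blast
    define c where "c n = (if enumerate J n \<le> k then d k (enumerate J n) else 0)" for n
    \<comment> \<open>The first \<open>k + 1\<close> terms of the enumeration contain all of \<open>J \<inter> {..k}\<close>, as \<open>n \<le> enumerate J n\<close>.\<close>
    have "(\<Sum>n<Suc k. c n * e n p) = (\<Sum>j\<in>J \<inter> {..k}. d k j * E j p)" for p
    proof -
      have "(\<Sum>n<Suc k. c n * e n p)
          = (\<Sum>n\<in>{n. n < Suc k \<and> enumerate J n \<le> k}. d k (enumerate J n) * E (enumerate J n) p)"
        by (rule sum.mono_neutral_cong_right) (auto simp: c_def e_def)
      also have "\<dots> = (\<Sum>j\<in>J \<inter> {..k}. d k j * E j p)"
      proof (rule sum.reindex_bij_betw)
        show "bij_betw (enumerate J) {n. n < Suc k \<and> enumerate J n \<le> k} (J \<inter> {..k})"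
          unfolding bij_betw_def
        proof
          show "inj_on (enumerate J) {n. n < Suc k \<and> enumerate J n \<le> k}"
            using strict_mono_enumerate[OF inf] strict_mono_imp_inj_on by blast
          show "enumerate J ` {n. n < Suc k \<and> enumerate J n \<le> k} = J \<inter> {..k}"
          proof (intro equalityI subsetI)
            fix j assume j: "j \<in> J \<inter> {..k}"
            then obtain n where n: "enumerate J n = j"
              using enumerate_Ex[of J j] inf j by auto
            then have "n \<le> k" using le_enumerate[OF inf, of n] j by auto
            then show "j \<in> enumerate J ` {n. n < Suc k \<and> enumerate J n \<le> k}"
              using n j by force
          qed (use enumerate_in_set[OF inf] in auto)
        qed
      qed
      finally show ?thesis .
    qed
    then have "(\<lambda>p. f p - (\<Sum>n<Suc k. c n * e n p)) = (\<lambda>p. f p - (\<Sum>j\<in>J \<inter> {..k}. d k j * E j p))"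
      by simp
    then show "\<exists>N c. nrm (\<lambda>p. f p - (\<Sum>j<N. c j * e j p)) < \<epsilon>" using k by metis
  qed
  ultimately show ?thesis by blast
qed

end

section \<open>Square integrable holomorphic functions\<close>

lemma cscale_simp [simp]: "cscale c (z, w1, w2) = (c *s z, c * w1, c * w2)"
  by (simp add: cscale_def)

lemma holomorphic_sv_continuous:
  assumes "holomorphic_sv f D"
  shows "continuous_on D f"
  using assms unfolding holomorphic_sv_def continuous_on_eq_continuous_within
  by (blast intro: has_derivative_continuous)

lemma holomorphic_sv_const: "holomorphic_sv (\<lambda>_. c) D"
  unfolding holomorphic_sv_def by (auto intro!: exI[of _ "\<lambda>_. 0"])

lemma holomorphic_sv_w1: "holomorphic_sv (\<lambda>p. fst (snd p)) D"
  unfolding holomorphic_sv_def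
  by (auto intro!: exI[of _ "\<lambda>p. fst (snd p)"] derivative_eq_intros)

lemma holomorphic_sv_w2: "holomorphic_sv (\<lambda>p. snd (snd p)) D"
  unfolding holomorphic_sv_def
  by (auto intro!: exI[of _ "\<lambda>p. snd (snd p)"] derivative_eq_intros)

lemma holomorphic_sv_add:
  assumes "holomorphic_sv f D" "holomorphic_sv g D"
  shows "holomorphic_sv (\<lambda>p. f p + g p) D"
  unfolding holomorphic_sv_def
proof
  fix p assume "p \<in> D"
  then obtain f' g' where "(f has_derivative f') (at p within D)" "\<forall>c v. f' (cscale c v) = c * f' v"
    "(g has_derivative g') (at p within D)" "\<forall>c v. g' (cscale c v) = c * g' v"
    using assms unfolding holomorphic_sv_def by blast
  then show "\<exists>h. ((\<lambda>p. f p + g p) has_derivative h) (at p within D) \<and> (\<forall>c v. h (cscale c v) = c * h v)"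
    by (intro exI[of _ "\<lambda>v. f' v + g' v"]) (auto intro!: derivative_eq_intros simp: algebra_simps)
qed

lemma holomorphic_sv_mult:
  assumes "holomorphic_sv f D" "holomorphic_sv g D"
  shows "holomorphic_sv (\<lambda>p. f p * g p) D"
  unfolding holomorphic_sv_def
proof
  fix p assume "p \<in> D"
  then obtain f' g' where "(f has_derivative f') (at p within D)" "\<forall>c v. f' (cscale c v) = c * f' v"
    "(g has_derivative g') (at p within D)" "\<forall>c v. g' (cscale c v) = c * g' v"
    using assms unfolding holomorphic_sv_def by blast
  then show "\<exists>h. ((\<lambda>p. f p * g p) has_derivative h) (at p within D) \<and> (\<forall>c v. h (cscale c v) = c * h v)"
    by (intro exI[of _ "\<lambda>v. f p * g' v + f' v * g p"]) (auto intro!: derivative_eq_intros simp: algebra_simps)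
qed

lemma holomorphic_sv_inverse:
  assumes "holomorphic_sv f D" "\<And>p. p \<in> D \<Longrightarrow> f p \<noteq> 0"
  shows "holomorphic_sv (\<lambda>p. inverse (f p)) D"
  unfolding holomorphic_sv_def
proof
  fix p assume p: "p \<in> D"
  then obtain f' where "(f has_derivative f') (at p within D)" "\<forall>c v. f' (cscale c v) = c * f' v"
    using assms unfolding holomorphic_sv_def by blast
  then show "\<exists>h. ((\<lambda>p. inverse (f p)) has_derivative h) (at p within D) \<and> (\<forall>c v. h (cscale c v) = c * h v)"
    using assms(2)[OF p]
    by (intro exI[of _ "\<lambda>v. - (inverse (f p) * f' v * inverse (f p))"])
      (auto intro!: derivative_eq_intros simp: algebra_simps)
qed

lemma holomorphic_sv_power:
  assumes "holomorphic_sv f D"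
  shows "holomorphic_sv (\<lambda>p. f p ^ k) D"
  by (induction k) (simp_all add: holomorphic_sv_const holomorphic_sv_mult assms)

lemma holomorphic_sv_sum:
  assumes "\<And>i. i \<in> I \<Longrightarrow> holomorphic_sv (f i) D"
  shows "holomorphic_sv (\<lambda>p. \<Sum>i\<in>I. f i p) D"
  using assms by (induction I rule: infinite_finite_induct)
    (simp_all add: holomorphic_sv_const holomorphic_sv_add)

lemma vector_scale_add: "(a + b) *s (v :: 'a::semiring_1 ^ 'n) = a *s v + b *s v"
  by (simp add: vec_eq_iff distrib_right)

lemma bounded_linear_cscale_left: "bounded_linear (\<lambda>c. cscale c (v :: 'n::finite cspace))"
proof (cases v)
  case (fields z w1 w2)
  have "linear (\<lambda>c. cscale c v)"
    unfolding fields
    by (intro linearI) (simp_all add: vector_scale_add distrib_right vec_eq_iff)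
  then show ?thesis by (rule linear_conv_bounded_linear[THEN iffD1])
qed

text \<open>
  Restriction to complex lines is how the one-variable theory enters.
\<close>

lemma holomorphic_sv_slice:
  fixes p v :: "'n::finite cspace"
  assumes f: "holomorphic_sv f D"
  shows "(\<lambda>c. f (p + cscale c v)) holomorphic_on {c. p + cscale c v \<in> D}"
  unfolding holomorphic_on_def
proof
  let ?S = "{c. p + cscale c v \<in> D}"
  fix c assume c: "c \<in> ?S"
  then obtain f' where f': "(f has_derivative f') (at (p + cscale c v) within D)"
    and lin: "\<forall>c v. f' (cscale c v) = c * f' v"
    using f unfolding holomorphic_sv_def by blast
  have "((\<lambda>c. p + cscale c v) has_derivative (\<lambda>h. cscale h v)) (at c within ?S)"
    using has_derivative_add[OF has_derivative_const[of p]
        bounded_linear_imp_has_derivative[OF bounded_linear_cscale_left[of v]]] by simp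
  moreover have "(f has_derivative f') (at (p + cscale c v) within (\<lambda>c. p + cscale c v) ` ?S)"
    by (rule has_derivative_subset[OF f']) auto
  ultimately have "((\<lambda>c. f (p + cscale c v)) has_derivative (\<lambda>h. f' (cscale h v))) (at c within ?S)"
    using diff_chain_within[of "\<lambda>c. p + cscale c v" "\<lambda>h. cscale h v" c ?S f f'] by (simp add: o_def)
  moreover have "(\<lambda>h. f' (cscale h v)) = (*) (f' v)"
    using spec[OF spec[OF lin], of _ v] by (auto simp: fun_eq_iff mult.commute[of _ "f' v"] simp del: cscale_simp)
  ultimately show "(\<lambda>c. f (p + cscale c v)) field_differentiable at c within ?S"
    unfolding field_differentiable_def has_field_derivative_def by auto
qed

lemma L2a_bounded:
  fixes D :: "'n::finite cspace set"
  assumes D: "open D" "emeasure lborel D < \<infinity>" and f: "holomorphic_sv f D"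
    and b: "\<And>p. p \<in> D \<Longrightarrow> norm (f p) \<le> B"
  shows "f \<in> L2a D"
proof -
  have "set_integrable lborel D (\<lambda>p. (norm (f p))\<^sup>2)"
    unfolding set_integrable_def
  proof (rule Bochner_Integration.integrable_bound)
    show "integrable lborel (\<lambda>p. indicator D p * B\<^sup>2)"
      using D by (intro integrable_mult_left integrable_real_indicator) auto
    have "(\<lambda>p. indicator D p *\<^sub>R (norm (f p))\<^sup>2) \<in> borel_measurable borel"
      using D(1) by (intro borel_measurable_continuous_on_indicator continuous_intros
          holomorphic_sv_continuous[OF f]) auto
    then show "(\<lambda>p. indicator D p *\<^sub>R (norm (f p))\<^sup>2) \<in> borel_measurable lborel" by simp
    show "AE p in lborel. norm (indicator D p *\<^sub>R (norm (f p))\<^sup>2) \<le> norm (indicator D p * B\<^sup>2)"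
      using b by (intro AE_I2) (auto simp: indicator_def intro!: power_mono)
  qed
  then show ?thesis using f by (simp add: L2a_def)
qed

lemma L2a_product_integrable:
  fixes D :: "'n::finite cspace set"
  assumes D: "open D" and f: "f \<in> L2a D" and g: "g \<in> L2a D"
  shows "set_integrable lborel D (\<lambda>p. f p * cnj (g p))"
  unfolding set_integrable_def
proof (rule Bochner_Integration.integrable_bound)
  show "integrable lborel (\<lambda>p. indicator D p *\<^sub>R (norm (f p))\<^sup>2 + indicator D p *\<^sub>R (norm (g p))\<^sup>2)"
    using f g by (auto simp: L2a_def set_integrable_def)
  have "(\<lambda>p. indicator D p *\<^sub>R (f p * cnj (g p))) \<in> borel_measurable borel"
    using D f g by (intro borel_measurable_continuous_on_indicator continuous_intros)
      (auto simp: L2a_def intro: holomorphic_sv_continuous)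
  then show "(\<lambda>p. indicator D p *\<^sub>R (f p * cnj (g p))) \<in> borel_measurable lborel" by simp
  have "a * b \<le> a\<^sup>2 + b\<^sup>2" if "a \<ge> 0" "b \<ge> 0" for a b :: real
    using sum_squares_bound[of a b] that mult_nonneg_nonneg[of a b] by linarith
  then show "AE p in lborel. norm (indicator D p *\<^sub>R (f p * cnj (g p)))
      \<le> norm (indicator D p *\<^sub>R (norm (f p))\<^sup>2 + indicator D p *\<^sub>R (norm (g p))\<^sup>2)"
    by (intro AE_I2) (auto simp: indicator_def norm_mult)
qed

lemma norm_add_square_le: "(norm (x + y))\<^sup>2 \<le> 2 * (norm x)\<^sup>2 + 2 * (norm y)\<^sup>2"
proof -
  have "(norm (x + y))\<^sup>2 \<le> (norm x + norm y)\<^sup>2"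
    by (intro power_mono norm_triangle_ineq) auto
  also have "\<dots> \<le> 2 * (norm x)\<^sup>2 + 2 * (norm y)\<^sup>2"
    using sum_squares_bound[of "norm x" "norm y"] by (simp add: power2_sum)
  finally show ?thesis .
qed

lemma L2_inner_self:
  "L2_inner D f f = of_real (set_lebesgue_integral lborel D (\<lambda>p. (norm (f p))\<^sup>2))"
  unfolding L2_inner_def set_lebesgue_integral_def
  by (subst integral_complex_of_real[symmetric])
    (intro Bochner_Integration.integral_cong refl,
      simp add: complex_norm_square[symmetric] scaleR_conv_of_real)

lemma L2a_add:
  fixes D :: "'n::finite cspace set"
  assumes D: "open D" and f: "f \<in> L2a D" and g: "g \<in> L2a D"
  shows "(\<lambda>p. f p + g p) \<in> L2a D"
proof -
  have hol: "holomorphic_sv (\<lambda>p. f p + g p) D"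
    using f g by (simp add: L2a_def holomorphic_sv_add)
  have "set_integrable lborel D (\<lambda>p. (norm (f p + g p))\<^sup>2)"
    unfolding set_integrable_def
  proof (rule Bochner_Integration.integrable_bound)
    show "integrable lborel (\<lambda>p. 2 * (indicator D p *\<^sub>R (norm (f p))\<^sup>2) + 2 * (indicator D p *\<^sub>R (norm (g p))\<^sup>2))"
      using f g by (auto simp: L2a_def set_integrable_def)
    have "(\<lambda>p. indicator D p *\<^sub>R (norm (f p + g p))\<^sup>2) \<in> borel_measurable borel"
      using D by (intro borel_measurable_continuous_on_indicator continuous_intros
          holomorphic_sv_continuous[OF hol]) auto
    then show "(\<lambda>p. indicator D p *\<^sub>R (norm (f p + g p))\<^sup>2) \<in> borel_measurable lborel" by simp
    show "AE p in lborel. norm (indicator D p *\<^sub>R (norm (f p + g p))\<^sup>2)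
        \<le> norm (2 * (indicator D p *\<^sub>R (norm (f p))\<^sup>2) + 2 * (indicator D p *\<^sub>R (norm (g p))\<^sup>2))"
      using norm_add_square_le by (intro AE_I2) (auto simp: indicator_def)
  qed
  then show ?thesis using hol by (simp add: L2a_def)
qed

lemma L2a_semi_inner_space:
  fixes D :: "'n::finite cspace set"
  assumes D: "open D"
  shows "semi_inner_space (L2a D) (L2_inner D)"
proof
  show "(\<lambda>_. 0) \<in> L2a D"
    by (simp add: L2a_def holomorphic_sv_const set_integrable_def)
  show "(\<lambda>p. f p + g p) \<in> L2a D" if "f \<in> L2a D" "g \<in> L2a D" for f g
    using L2a_add[OF D that] .
  show "(\<lambda>p. c * f p) \<in> L2a D" if "f \<in> L2a D" for c f
    using that unfolding L2a_def
    by (auto simp: norm_mult power_mult_distrib intro!: holomorphic_sv_mult holomorphic_sv_const)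
  show "L2_inner D (\<lambda>p. f p + g p) h = L2_inner D f h + L2_inner D g h"
    if "f \<in> L2a D" "g \<in> L2a D" "h \<in> L2a D" for f g h
    unfolding L2_inner_def distrib_right
    using L2a_product_integrable[OF D] that by (intro set_integral_add) auto
  show "L2_inner D (\<lambda>p. c * f p) h = c * L2_inner D f h" for c f h
    unfolding L2_inner_def mult.assoc by (rule set_integral_mult_right)
  show "L2_inner D g f = cnj (L2_inner D f g)" for f g
  proof -
    have "cnj (L2_inner D f g) = (\<integral>p. cnj (indicator D p *\<^sub>R (f p * cnj (g p))) \<partial>lborel)"
      unfolding L2_inner_def set_lebesgue_integral_def by (rule Bochner_Integration.integral_cnj[symmetric])
    then show ?thesis
      unfolding L2_inner_def set_lebesgue_integral_def by (simp add: mult.commute)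
  qed
  show "0 \<le> Re (L2_inner D f f)" for f
    by (simp add: L2_inner_self set_lebesgue_integral_def integral_nonneg)
qed

lemma L2_norm_eq_nrm:
  fixes D :: "'n::finite cspace set"
  assumes D: "open D"
  shows "L2_norm D f = semi_inner_space.nrm (L2_inner D) f"
  by (simp add: L2_norm_def L2_inner_self semi_inner_space.nrm_def[OF L2a_semi_inner_space[OF D]])

lemma complete_orthonormal_basis_iff:
  fixes D :: "'n::finite cspace set"
  assumes D: "open D"
  shows "complete_orthonormal_basis D \<Phi> \<longleftrightarrow>
     semi_inner_space.orthonormal (L2a D) (L2_inner D) \<Phi> UNIV \<and>
     semi_inner_space.complete_seq (L2a D) (L2_inner D) \<Phi>"
proof -
  interpret semi_inner_space "L2a D" "L2_inner D" by (rule L2a_semi_inner_space[OF D])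
  show ?thesis
    unfolding complete_orthonormal_basis_def orthonormal_def complete_seq_def L2_norm_eq_nrm[OF D]
    by auto
qed

section \<open>Isometries and radial integrals\<close>

text \<open>
  By Vitali's theorem an open set is a disjoint union of balls up to a null set, and the measure of a ball
  depends only on its radius.
\<close>

lemma emeasure_orthogonal_image_ge:
  fixes T :: "'a::euclidean_space \<Rightarrow> 'a"
  assumes T: "orthogonal_transformation T" and U: "open U"
  shows "emeasure lborel U \<le> emeasure lborel (T ` U)"
proof -
  let ?K = "{i :: 'a \<times> real. ball (fst i) (snd i) \<subseteq> U}"
  let ?B = "\<lambda>i :: 'a \<times> real. ball (fst i) (snd i)"
  have "\<exists>i. i \<in> ?K \<and> x \<in> ?B i \<and> snd i < d" if x: "x \<in> U" "0 < d" for x d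
  proof -
    obtain e where e: "e > 0" "ball x e \<subseteq> U" using U x openE by blast
    then show ?thesis using x by (intro exI[of _ "(x, min e (d / 2))"]) auto
  qed
  then obtain C where C: "countable C" "C \<subseteq> ?K"
    and disj: "pairwise (\<lambda>i j. disjnt (?B i) (?B j)) C"
    and neg: "negligible (U - (\<Union>i\<in>C. ?B i))"
    using Vitali_covering_theorem_balls[of U ?K fst snd] by blast
  have inj: "inj T" using T by (rule orthogonal_transformation_inj)
  have bijT: "bij T"
    using inj orthogonal_transformation_surj[OF T] by (rule bijI)
  have Tball: "T ` ?B i = ball (T (fst i)) (snd i)" for i
    by (rule image_orthogonal_transformation_ball[OF T])
  have df: "disjoint_family_on ?B C"
    using disj by (auto simp: disjoint_family_on_def pairwise_def disjnt_def)
  have dfT: "disjoint_family_on (\<lambda>i. T ` ?B i) C"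
    using df inj by (auto simp: disjoint_family_on_def image_Int[symmetric])
  have opT: "open (T ` U)"
  proof -
    have "inv T -` U = T ` U"
      using bij_vimage_eq_inv_image[OF bij_imp_bij_inv[OF bijT]] by (simp only: inv_inv_eq[OF bijT])
    moreover have "continuous_on UNIV (inv T)"
      using orthogonal_transformation_inv[OF T]
      by (simp add: linear_continuous_on linear_linear orthogonal_transformation)
    ultimately show ?thesis using open_vimage[OF U, of "inv T"] by simp
  qed
  have ball: "emeasure lborel (?B i) = emeasure lborel (T ` ?B i)" for i
  proof (cases "snd i \<ge> 0")
    case True then show ?thesis unfolding Tball by (simp add: emeasure_ball)
  qed (simp add: ball_empty)
  have N: "U - (\<Union>i\<in>C. ?B i) \<in> null_sets lborel"
  proof -
    have "U - (\<Union>i\<in>C. ?B i) \<in> sets lborel" using U by (intro sets.Diff) (auto intro!: borel_open)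
    then show ?thesis using neg by (simp add: negligible_iff_null_sets null_sets_completion_iff)
  qed
  have "emeasure lborel U = emeasure lborel ((\<Union>i\<in>C. ?B i) \<union> (U - (\<Union>i\<in>C. ?B i)))"
    using C(2) by (intro arg_cong[where f = "emeasure lborel"]) auto
  also have "\<dots> = emeasure lborel (\<Union>i\<in>C. ?B i)"
    by (intro emeasure_Un_null_set N) (auto intro!: borel_open)
  also have "\<dots> = (\<integral>\<^sup>+i. emeasure lborel (?B i) \<partial>count_space C)"
    by (intro emeasure_UN_countable C df) auto
  also have "\<dots> = (\<integral>\<^sup>+i. emeasure lborel (T ` ?B i) \<partial>count_space C)"
    by (simp only: ball)
  also have "\<dots> = emeasure lborel (\<Union>i\<in>C. T ` ?B i)"
    by (intro emeasure_UN_countable[symmetric] C dfT) (auto simp: Tball)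
  also have "\<dots> \<le> emeasure lborel (T ` U)"
    using C(2) opT by (intro emeasure_mono) (auto intro!: borel_open)
  finally show ?thesis .
qed

text \<open>
  Both a linear isometry and its inverse do not decrease the measure of open sets, hence they preserve it.
\<close>

theorem lborel_distr_orthogonal:
  fixes T :: "'a::euclidean_space \<Rightarrow> 'a"
  assumes T: "orthogonal_transformation T"
  shows "distr lborel borel T = lborel"
proof (rule lborel_eqI[symmetric])
  have "continuous_on UNIV T"
    using T by (simp add: linear_continuous_on linear_linear orthogonal_transformation)
  then have meas: "T \<in> borel_measurable borel" by (rule borel_measurable_continuous_onI)
  fix l u :: 'a assume le: "\<And>b. b \<in> Basis \<Longrightarrow> l \<bullet> b \<le> u \<bullet> b"
  have inv: "orthogonal_transformation (inv T)" by (rule orthogonal_transformation_inv[OF T])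
  have TT: "T ` (T -` X) = X" for X
    using orthogonal_transformation_surj[OF T] by (rule surj_image_vimage_eq)
  have iT: "inv T ` X = T -` X" for X
    using orthogonal_transformation_inj[OF T] orthogonal_transformation_surj[OF T]
    by (metis bijI bij_vimage_eq_inv_image)
  have op: "open (T -` box l u)"
    using open_vimage[OF open_box \<open>continuous_on UNIV T\<close>] .
  have "emeasure lborel (T -` box l u) = emeasure lborel (box l u)"
    using emeasure_orthogonal_image_ge[OF T op] emeasure_orthogonal_image_ge[OF inv open_box, of l u]
    unfolding TT iT by (rule antisym)
  then show "emeasure (distr lborel borel T) (box l u) = (\<Prod>b\<in>Basis. (u - l) \<bullet> b)"
    using meas le by (simp add: emeasure_distr)
qed simp

lemma integral_orthogonal:
  fixes T :: "'a::euclidean_space \<Rightarrow> 'a" and f :: "'a \<Rightarrow> complex"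
  assumes T: "orthogonal_transformation T" and f: "f \<in> borel_measurable borel"
  shows "(\<integral>x. f (T x) \<partial>lborel) = (\<integral>x. f x \<partial>lborel)"
    and "integrable lborel (\<lambda>x. f (T x)) \<longleftrightarrow> integrable lborel f"
proof -
  have "continuous_on UNIV T"
    using T by (simp add: linear_continuous_on linear_linear orthogonal_transformation)
  then have meas: "T \<in> measurable lborel borel" by (simp add: borel_measurable_continuous_onI)
  show "(\<integral>x. f (T x) \<partial>lborel) = (\<integral>x. f x \<partial>lborel)"
    using integral_distr[OF meas f] by (simp add: lborel_distr_orthogonal[OF T])
  show "integrable lborel (\<lambda>x. f (T x)) \<longleftrightarrow> integrable lborel f"
    using integrable_distr_eq[OF meas f] by (simp add: lborel_distr_orthogonal[OF T])
qed

text \<open>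
  The volume of a ball of radius \<open>r\<close> in real dimension \<open>2 n + 2\<close> is \<open>\<pi>\<^bsup>n+1\<^esup> (r\<^sup>2)\<^bsup>n+1\<^esup> / (n + 1)!\<close>. The density of
  the distribution of \<open>\<bar>z\<bar>\<^sup>2\<close> is its derivative in \<open>r\<^sup>2\<close>.
\<close>

theorem distr_norm_square_ball:
  fixes R :: real
  assumes dim: "DIM('a::euclidean_space) = 2 * Suc n" and R: "R > 0"
  shows "distr (density lborel (indicator (ball (0::'a) R))) borel (\<lambda>z. (norm z)\<^sup>2)
       = density lborel (\<lambda>t. ennreal (indicator {0..R\<^sup>2} t * (pi ^ Suc n / fact n * t ^ n)))"
    (is "?M = ?N")
proof (rule measure_eqI_lessThan)
  define c where "c = pi ^ Suc n / fact (Suc n)"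
  have c: "c \<ge> 0" by (simp add: c_def)
  have vol: "unit_ball_vol (real DIM('a)) = c"
    unfolding dim c_def by (rule unit_ball_vol_even)
  have pow: "r ^ DIM('a) = (r\<^sup>2) ^ Suc n" for r :: real
    unfolding dim by (rule power_mult)
  have cb: "emeasure lborel (cball (0::'a) r) = ennreal (c * (r\<^sup>2) ^ Suc n)" if "r \<ge> 0" for r
    using that by (simp only: emeasure_cball vol pow)
  have b: "emeasure lborel (ball (0::'a) r) = ennreal (c * (r\<^sup>2) ^ Suc n)" if "r \<ge> 0" for r
    using that by (simp only: emeasure_ball vol pow)
  have M: "emeasure ?M {x<..} = ennreal (c * ((R\<^sup>2) ^ Suc n - (min (max x 0) (R\<^sup>2)) ^ Suc n))" for x
  proof -
    let ?S = "{z :: 'a. x < (norm z)\<^sup>2}"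
    have S: "?S \<in> sets lborel" by measurable
    have "emeasure ?M {x<..} = emeasure (density lborel (indicator (ball (0::'a) R))) ?S"
      by (subst emeasure_distr) (auto simp: vimage_def)
    also have "\<dots> = (\<integral>\<^sup>+z. indicator (ball (0::'a) R) z * indicator ?S z \<partial>lborel)"
      using S by (intro emeasure_density) (auto intro!: borel_measurable_indicator)
    also have "\<dots> = (\<integral>\<^sup>+z. indicator (ball (0::'a) R \<inter> ?S) z \<partial>lborel)"
      by (simp add: indicator_inter_arith)
    also have "\<dots> = emeasure lborel (ball (0::'a) R \<inter> ?S)"
      using S by (intro nn_integral_indicator) auto
    also have "\<dots> = ennreal (c * ((R\<^sup>2) ^ Suc n - (min (max x 0) (R\<^sup>2)) ^ Suc n))"
    proof (cases "x < 0")
      case True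
      then have "ball (0::'a) R \<inter> {z. x < (norm z)\<^sup>2} = ball 0 R"
        using less_le_trans[OF True zero_le_power2] by blast
      moreover have "min (max x 0) (R\<^sup>2) = 0" using True by (simp add: max_def)
      ultimately show ?thesis using R by (simp add: b)
    next
      case False
      show ?thesis
      proof (cases "x < R\<^sup>2")
        case x: True
        have "ball (0::'a) R \<inter> {z. x < (norm z)\<^sup>2} = ball 0 R - cball 0 (sqrt x)"
        proof -
          have *: "x < (norm z)\<^sup>2 \<longleftrightarrow> sqrt x < norm z" for z :: 'a
            by (metis abs_norm_cancel real_sqrt_abs real_sqrt_less_iff)
          show ?thesis
            unfolding set_eq_iff Int_iff Diff_iff mem_Collect_eq * mem_ball_0 mem_cball_0 not_le by (rule allI) (rule refl)
        qed
        moreover have "cball (0::'a) (sqrt x) \<subseteq> ball 0 R"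
        proof -
          have "sqrt x < R" using real_sqrt_less_mono[OF x] R by simp
          then show ?thesis by auto
        qed
        moreover have "emeasure lborel (ball 0 R - cball (0::'a) (sqrt x))
            = emeasure lborel (ball (0::'a) R) - emeasure lborel (cball (0::'a) (sqrt x))"
          using calculation(2) emeasure_lborel_cball_finite[of "0::'a" "sqrt x"]
          by (intro emeasure_Diff) auto
        moreover have "emeasure lborel (cball (0::'a) (sqrt x)) = ennreal (c * x ^ Suc n)"
          using False cb[of "sqrt x"] by (simp only: real_sqrt_pow2 not_less real_sqrt_ge_zero)
        moreover have "emeasure lborel (ball (0::'a) R) = ennreal (c * (R\<^sup>2) ^ Suc n)"
          using R by (intro b) simp
        ultimately have "emeasure lborel (ball (0::'a) R \<inter> {z. x < (norm z)\<^sup>2})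
            = ennreal (c * (R\<^sup>2) ^ Suc n) - ennreal (c * x ^ Suc n)"
          by (simp only:)
        also have "\<dots> = ennreal (c * (R\<^sup>2) ^ Suc n - c * x ^ Suc n)"
          using False c by (intro ennreal_minus mult_nonneg_nonneg zero_le_power) (simp_all only: not_less)
        also have "c * (R\<^sup>2) ^ Suc n - c * x ^ Suc n = c * ((R\<^sup>2) ^ Suc n - min (max x 0) (R\<^sup>2) ^ Suc n)"
        proof -
          have "min (max x 0) (R\<^sup>2) = x" using x False by (simp add: max_def)
          then show ?thesis by (simp only: right_diff_distrib)
        qed
        finally show ?thesis .
      next
        case x: False
        have "ball (0::'a) R \<inter> {z. x < (norm z)\<^sup>2} = {}"
        proof -
          have "(norm z)\<^sup>2 \<le> R\<^sup>2" if "norm z < R" for z :: 'a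
            using that by (intro power_mono) auto
          then have "\<not> x < (norm z)\<^sup>2" if "norm z < R" for z :: 'a
            using x that by (meson le_less_trans not_less order_trans)
          then show ?thesis by auto
        qed
        moreover have "min (max x 0) (R\<^sup>2) = R\<^sup>2" using x False by (simp add: max_def)
        ultimately show ?thesis by simp
      qed
    qed
    finally show ?thesis .
  qed
  have N: "emeasure ?N {x<..} = ennreal (c * ((R\<^sup>2) ^ Suc n - (min (max x 0) (R\<^sup>2)) ^ Suc n))" for x
  proof -
    let ?a = "min (max x 0) (R\<^sup>2)"
    have a: "0 \<le> ?a" "?a \<le> R\<^sup>2" by auto
    have "emeasure ?N {x<..} = (\<integral>\<^sup>+t. ennreal (indicator {0..R\<^sup>2} t * (pi ^ Suc n / fact n * t ^ n)) * indicator {x<..} t \<partial>lborel)"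
      by (simp add: emeasure_density)
    also have "\<dots> = (\<integral>\<^sup>+t. ennreal (pi ^ Suc n / fact n * t ^ n) * indicator {?a..R\<^sup>2} t \<partial>lborel)"
    proof (rule nn_integral_cong_AE)
      have "AE t in lborel. t \<noteq> x \<and> t \<noteq> R\<^sup>2"
        using AE_lborel_singleton[of x] AE_lborel_singleton[of "R\<^sup>2"] by eventually_elim simp
      then show "AE t in lborel. ennreal (indicator {0..R\<^sup>2} t * (pi ^ Suc n / fact n * t ^ n)) * indicator {x<..} t
          = ennreal (pi ^ Suc n / fact n * t ^ n) * indicator {?a..R\<^sup>2} t"
      proof eventually_elim
        case (elim t)
        then have "t \<in> {0..R\<^sup>2} \<and> t \<in> {x<..} \<longleftrightarrow> t \<in> {?a..R\<^sup>2}"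
          by (auto simp: min_def max_def)
        then show ?case by (auto simp: indicator_def)
      qed
    qed
    also have "\<dots> = ennreal (c * (R\<^sup>2) ^ Suc n - c * ?a ^ Suc n)"
    proof (rule nn_integral_FTC_Icc[where F = "\<lambda>t. c * t ^ Suc n"])
      fix t assume "t \<in> {?a..R\<^sup>2}"
      then have t: "0 \<le> t" using a(1) by (meson atLeastAtMost_iff order_trans)
      have "((\<lambda>t. c * t ^ Suc n) has_real_derivative c * (real (Suc n) * t ^ n)) (at t)"
        by (auto intro!: derivative_eq_intros simp del: power_Suc)
      moreover have "c * (real (Suc n) * t ^ n) = pi ^ Suc n / fact n * t ^ n"
        by (simp add: c_def)
      ultimately show "((\<lambda>t. c * t ^ Suc n) has_real_derivative pi ^ Suc n / fact n * t ^ n) (at t)"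
        by (rule DERIV_cong)
      show "0 \<le> pi ^ Suc n / fact n * t ^ n" using t by simp
    next
      show "?a \<le> R\<^sup>2" using a(2) .
    qed measurable
    finally show ?thesis unfolding right_diff_distrib .
  qed
  show "emeasure ?M {x<..} = emeasure ?N {x<..}" for x unfolding M N ..
  show "emeasure ?M {x<..} < \<infinity>" for x unfolding M by simp
qed simp_all

lemma integral_norm_square_ball:
  fixes R :: real and \<phi> :: "real \<Rightarrow> real"
  assumes dim: "DIM('a::euclidean_space) = 2 * Suc n" and R: "R > 0"
    and \<phi>: "\<phi> \<in> borel_measurable borel"
  shows "(\<integral>z. indicator (ball (0::'a) R) z * \<phi> ((norm z)\<^sup>2) \<partial>lborel)
       = (\<integral>t. indicator {0..R\<^sup>2} t * (pi ^ Suc n / fact n * t ^ n) * \<phi> t \<partial>lborel)"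
proof -
  have "(\<integral>z. indicator (ball (0::'a) R) z * \<phi> ((norm z)\<^sup>2) \<partial>lborel)
      = (\<integral>z. \<phi> ((norm z)\<^sup>2) \<partial>density lborel (\<lambda>z. ennreal (indicator (ball (0::'a) R) z)))"
    using \<phi> by (subst integral_density) (auto intro!: borel_measurable_indicator)
  also have "\<dots> = (\<integral>t. \<phi> t \<partial>distr (density lborel (indicator (ball (0::'a) R))) borel (\<lambda>z. (norm z)\<^sup>2))"
    using \<phi> by (subst integral_distr) (auto simp: ennreal_indicator)
  also have "\<dots> = (\<integral>t. indicator {0..R\<^sup>2} t * (pi ^ Suc n / fact n * t ^ n) * \<phi> t \<partial>lborel)"
    unfolding distr_norm_square_ball[OF dim R]
    using \<phi> by (subst integral_density) (auto simp: indicator_def)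
  finally show ?thesis .
qed

section \<open>The power series of the kernel\<close>

lemma geometric_convolution:
  fixes w :: "'b::field_char_0"
  shows "(\<Sum>i\<le>k. of_nat ((i + m) choose m) * w ^ i * w ^ (k - i))
     = of_nat ((k + Suc m) choose Suc m) * w ^ k"
proof -
  have "(\<Sum>i\<le>k. of_nat ((i + m) choose m) * w ^ i * w ^ (k - i))
      = (\<Sum>i\<le>k. of_nat ((i + m) choose m)) * w ^ k"
    unfolding sum_distrib_right by (intro sum.cong) (auto simp: mult.assoc power_add[symmetric])
  also have "(\<Sum>i\<le>k. (of_nat ((i + m) choose m) :: 'b)) = of_nat ((k + Suc m) choose Suc m)"
    by (induction k) (simp_all add: add.commute)
  finally show ?thesis .
qed

lemma inverse_power_sums:
  fixes z :: complex
  assumes z: "norm z < 1"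
  shows "(\<lambda>a. of_nat ((a + m) choose m) * z ^ a) sums (1 / (1 - z) ^ (m + 1))"
    and "summable (\<lambda>a. norm (of_nat ((a + m) choose m) * z ^ a))"
proof -
  have *: "(\<lambda>a. of_nat ((a + m) choose m) * z ^ a) sums (1 / (1 - z) ^ (m + 1)) \<and>
      summable (\<lambda>a. norm (of_nat ((a + m) choose m) * z ^ a))"
  proof (induction m)
    case 0
    then show ?case using geometric_sums[OF z] summable_geometric[of "norm z"] z
      by (simp add: norm_power)
  next
    case (Suc m)
    have geo: "summable (\<lambda>k. norm (z ^ k))"
      using z by (simp add: norm_power summable_geometric)
    have gsum: "(\<Sum>k. z ^ k) = 1 / (1 - z)" using geometric_sums[OF z] by (simp add: sums_iff)
    have 1: "(\<lambda>k. of_nat ((k + Suc m) choose Suc m) * z ^ k) sums (1 / (1 - z) ^ (Suc m + 1))"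
    proof -
      have "(\<Sum>k. of_nat ((k + m) choose m) * z ^ k) = 1 / (1 - z) ^ (m + 1)"
        using Suc by (simp add: sums_iff)
      then show ?thesis
        using Cauchy_product_sums[OF conjunct2[OF Suc] geo]
        by (simp add: gsum geometric_convolution mult.assoc[symmetric] del: binomial_Suc_Suc)
          (simp add: mult_ac)
    qed
    have 2: "summable (\<lambda>k. of_nat ((k + Suc m) choose Suc m) * norm z ^ k)"
    proof -
      have "summable (\<lambda>k. norm (of_nat ((k + m) choose m) * norm z ^ k))"
        using Suc by (simp add: norm_mult norm_power)
      moreover have "summable (\<lambda>k. norm (norm z ^ k))" using geo by (simp add: norm_power)
      ultimately show ?thesis
        using summable_Cauchy_product[of "\<lambda>k. of_nat ((k + m) choose m) * norm z ^ k" "\<lambda>k. norm z ^ k"]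
          geometric_convolution[where w = "norm z"] by (simp add: mult.assoc del: binomial_Suc_Suc)
    qed
    then show ?case using 1 by (simp add: norm_mult norm_power del: binomial_Suc_Suc)
  qed
  show "(\<lambda>a. of_nat ((a + m) choose m) * z ^ a) sums (1 / (1 - z) ^ (m + 1))"
    and "summable (\<lambda>a. norm (of_nat ((a + m) choose m) * z ^ a))"
    using * by auto
qed

text \<open>
  The part of degree \<open>N\<close> in the expansion of \<open>((1 - u) (1 - v))\<^bsup>-2\<^esup>\<close>.
\<close>

definition hom_part :: "nat \<Rightarrow> complex \<Rightarrow> complex \<Rightarrow> complex" where
  "hom_part N u v = (\<Sum>a\<le>N. (of_nat (a + 1) * u ^ a) * (of_nat (N - a + 1) * v ^ (N - a)))"

text \<open>
  The coefficient of \<open>t\<^sup>n\<close> in \<open>((x - t) (y - t))\<^bsup>-2\<^esup>\<close>; in terms of Gegenbauer polynomials it is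
  \<open>P\<^bsup>-2-n/2\<^esup> C\<^sub>n((x + y) / (2 P\<^bsup>1/2\<^esup>))\<close> with \<open>P = x y\<close> and parameter \<open>2\<close>.
\<close>

definition gegen :: "nat \<Rightarrow> complex \<Rightarrow> complex \<Rightarrow> complex" where
  "gegen n x y = (\<Sum>i\<le>n. of_nat (i + 1) / x ^ (i + 2) * (of_nat (n - i + 1) / y ^ (n - i + 2)))"

lemma binomial_shift:
  "(i + 1) * ((a + (i + 1)) choose (i + 1)) = (a + 1) * ((a + 1 + i) choose i)"
proof -
  have "(i + 1) * ((a + (i + 1)) choose (i + 1)) = (a + i + 1) * ((a + i) choose i)"
    using Suc_times_binomial[of i "a + i"] by simp
  moreover have "(a + 1) * ((a + 1 + i) choose (a + 1)) = (a + i + 1) * ((a + i) choose a)"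
    using Suc_times_binomial[of a "a + i"] by simp
  moreover have "((a + i) choose a) = ((a + i) choose i)"
    using binomial_symmetric[of a "a + i"] by simp
  moreover have "((a + 1 + i) choose (a + 1)) = ((a + 1 + i) choose i)"
    using binomial_symmetric[of i "a + 1 + i"] by simp
  ultimately show ?thesis by simp
qed

text \<open>
  The coefficients of \<open>t\<^sup>n\<close> in \<open>(1 - t)\<^bsup>-a-2\<^esup> (1 - t)\<^bsup>-b-2\<^esup> = (1 - t)\<^bsup>-a-b-4\<^esup>\<close>. After division by factorials this is the binomial
  theorem for Pochhammer symbols.
\<close>

lemma negative_vandermonde:
  "(\<Sum>i\<le>n. ((a + 1 + i) choose i) * ((b + 1 + (n - i)) choose (n - i))) = ((a + b + 3 + n) choose n)"
proof -
  have ch: "real ((c + 1 + i) choose i) = pochhammer (of_nat (c + 2)) i / fact i" for c i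
  proof -
    have "real ((c + 1 + i) choose i) = of_nat (c + 1 + i) gchoose i"
      by (simp add: binomial_gbinomial)
    also have "\<dots> = pochhammer (of_nat (c + 1 + i) - of_nat i + 1) i / fact i"
      by (rule gbinomial_pochhammer')
    finally show ?thesis by (simp add: algebra_simps)
  qed
  have "real ((a + b + 3 + n) choose n) = pochhammer (of_nat (a + 2) + of_nat (b + 2)) n / fact n"
    using ch[of "a + b + 2" n] by (simp add: algebra_simps numeral_eq_Suc)
  also have "\<dots> = (\<Sum>i\<le>n. of_nat (n choose i) * pochhammer (of_nat (a + 2)) i
      * pochhammer (of_nat (b + 2)) (n - i) / fact n)"
    by (subst pochhammer_binomial_sum) (simp add: sum_divide_distrib)
  also have "\<dots> = (\<Sum>i\<le>n. real ((a + 1 + i) choose i) * real ((b + 1 + (n - i)) choose (n - i)))"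
  proof (intro sum.cong refl)
    fix i assume "i \<in> {..n}"
    then have "real (n choose i) = fact n / (fact i * fact (n - i))"
      by (simp add: binomial_fact)
    then show "of_nat (n choose i) * pochhammer (of_nat (a + 2)) i
        * pochhammer (of_nat (b + 2)) (n - i) / fact n
        = real ((a + 1 + i) choose i) * real ((b + 1 + (n - i)) choose (n - i))"
      unfolding ch by simp
  qed
  finally show ?thesis by (metis (mono_tags, lifting) of_nat_eq_iff of_nat_mult of_nat_sum sum.cong)
qed

lemma cauchy_product_sums_of_sums:
  fixes u v :: "nat \<Rightarrow> 'a::{real_normed_field,banach}"
  assumes "u sums X" "v sums Y" "summable (\<lambda>k. norm (u k))" "summable (\<lambda>k. norm (v k))"
  shows "(\<lambda>k. \<Sum>i\<le>k. u i * v (k - i)) sums (X * Y)"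
  using Cauchy_product_sums[OF assms(3,4)] assms(1,2) by (simp add: sums_iff)

text \<open>
  Each summand of \<open>gegen\<close> is a product of two negative binomial series, and \<open>negative_vandermonde\<close> adds up
  their coefficients.
\<close>

lemma gegen_sums:
  assumes u: "norm u < 1" and v: "norm v < 1"
  shows "(\<lambda>N. of_nat ((N + 3 + n) choose n) * hom_part N u v) sums gegen n (1 - u) (1 - v)"
proof -
  have one: "(\<lambda>a. of_nat (a + 1) * of_nat ((a + 1 + i) choose i) * z ^ a)
        sums (of_nat (i + 1) / (1 - z) ^ (i + 2))"
    "summable (\<lambda>a. norm (of_nat (a + 1) * of_nat ((a + 1 + i) choose i) * z ^ a))"
    if z: "norm z < 1" for z :: complex and i
  proof -
    have c: "of_nat (a + 1) * of_nat ((a + 1 + i) choose i) * z ^ a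
          = of_nat (i + 1) * (of_nat ((a + (i + 1)) choose (i + 1)) * z ^ a)" for a
      using binomial_shift[of i a] by (metis mult.assoc of_nat_mult)
    show "(\<lambda>a. of_nat (a + 1) * of_nat ((a + 1 + i) choose i) * z ^ a)
        sums (of_nat (i + 1) / (1 - z) ^ (i + 2))"
      using sums_mult[OF inverse_power_sums(1)[OF z, of "i + 1"], of "of_nat (i + 1)"]
      unfolding c by simp
    show "summable (\<lambda>a. norm (of_nat (a + 1) * of_nat ((a + 1 + i) choose i) * z ^ a))"
      using summable_mult[OF inverse_power_sums(2)[OF z, of "i + 1"], of "norm (of_nat (i + 1) :: complex)"]
      unfolding c norm_mult .
  qed
  have "(\<lambda>N. \<Sum>i\<le>n. \<Sum>a\<le>N. of_nat (a + 1) * of_nat ((a + 1 + i) choose i) * u ^ a *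
          (of_nat (N - a + 1) * of_nat ((N - a + 1 + (n - i)) choose (n - i)) * v ^ (N - a)))
      sums gegen n (1 - u) (1 - v)"
    unfolding gegen_def
    by (intro sums_sum cauchy_product_sums_of_sums one u v)
  moreover have "(\<Sum>i\<le>n. \<Sum>a\<le>N. of_nat (a + 1) * of_nat ((a + 1 + i) choose i) * u ^ a *
          (of_nat (N - a + 1) * of_nat ((N - a + 1 + (n - i)) choose (n - i)) * v ^ (N - a)))
       = of_nat ((N + 3 + n) choose n) * hom_part N u v" for N
  proof -
    have "(\<Sum>i\<le>n. \<Sum>a\<le>N. of_nat (a + 1) * of_nat ((a + 1 + i) choose i) * u ^ a *
          (of_nat (N - a + 1) * of_nat ((N - a + 1 + (n - i)) choose (n - i)) * v ^ (N - a)))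
       = (\<Sum>a\<le>N. (of_nat (a + 1) * u ^ a) * (of_nat (N - a + 1) * v ^ (N - a)) *
           of_nat (\<Sum>i\<le>n. ((a + 1 + i) choose i) * ((N - a + 1 + (n - i)) choose (n - i))))"
      by (subst sum.swap) (simp add: sum_distrib_left mult_ac del: of_nat_Suc)
    also have "\<dots> = (\<Sum>a\<le>N. (of_nat (a + 1) * u ^ a) * (of_nat (N - a + 1) * v ^ (N - a)) *
           of_nat ((N + 3 + n) choose n))"
      by (intro sum.cong refl) (simp only: negative_vandermonde, simp)
    finally show ?thesis by (simp add: hom_part_def sum_distrib_left mult_ac)
  qed
  ultimately show ?thesis by simp
qed


lemma pochhammer_choose: "fact n * of_nat ((N + 2 + n) choose n) = (pochhammer (of_nat (N + 3)) n :: 'a::field_char_0)"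
proof -
  have "of_nat ((N + 2 + n) choose n) = pochhammer (of_nat (N + 2 + n) - of_nat n + 1) n / (fact n :: 'a)"
    by (simp only: binomial_gbinomial gbinomial_pochhammer')
  then show ?thesis by (simp add: algebra_simps)
qed

text \<open>
  Pascal's rule turns the difference of the two binomial coefficients into a single one, which is a Pochhammer
  symbol divided by \<open>n!\<close>.
\<close>

lemma gegen_diff_sums:
  assumes "norm u < 1" "norm v < 1" "n \<ge> 1"
  shows "(\<lambda>N. pochhammer (of_nat (N + 3)) n * hom_part N u v)
     sums (fact n * (gegen n (1 - u) (1 - v) - gegen (n - 1) (1 - u) (1 - v)))"
proof -
  have "((N + 3 + n) choose n) = ((N + 2 + n) choose n) + ((N + 3 + (n - 1)) choose (n - 1))" for N
    using assms(3) by (cases n) (simp_all add: numeral_eq_Suc)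
  then have "pochhammer (of_nat (N + 3)) n * hom_part N u v = fact n *
      (of_nat ((N + 3 + n) choose n) * hom_part N u v
       - of_nat ((N + 3 + (n - 1)) choose (n - 1)) * hom_part N u v)" for N
    by (simp only: pochhammer_choose[symmetric]) (simp add: algebra_simps)
  then show ?thesis
    using sums_mult[OF sums_diff[OF gegen_sums[OF assms(1,2), of n] gegen_sums[OF assms(1,2), of "n - 1"]],
        of "fact n"] by simp
qed

lemma shifted_inverse_power_sums:
  fixes z :: complex
  assumes z: "norm z < 1"
  shows "(\<lambda>a. of_nat ((a + 1) choose (i + 1)) * z ^ a) sums (z ^ i / (1 - z) ^ (2 + i))"
    and "summable (\<lambda>a. norm (of_nat ((a + 1) choose (i + 1)) * z ^ a))"
proof -
  let ?f = "\<lambda>a. of_nat ((a + 1) choose (i + 1)) * z ^ a"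
  have eq: "?f (a + i) = z ^ i * (of_nat ((a + (i + 1)) choose (i + 1)) * z ^ a)" for a
    by (simp add: power_add mult_ac add_ac)
  have "(\<lambda>a. ?f (a + i)) sums (z ^ i / (1 - z) ^ (2 + i))"
    unfolding eq using sums_mult[OF inverse_power_sums(1)[OF z, of "i + 1"], of "z ^ i"]
    by (simp add: add_ac)
  moreover have "(\<Sum>a<i. ?f a) = 0"
    by (intro sum.neutral) (auto simp: binomial_eq_0)
  ultimately show "?f sums (z ^ i / (1 - z) ^ (2 + i))"
    using sums_iff_shift[of ?f i "z ^ i / (1 - z) ^ (2 + i)"] by (simp only: add_0_right)
  have "summable (\<lambda>a. norm (?f (a + i)))"
    unfolding eq using summable_mult[OF inverse_power_sums(2)[OF z, of "i + 1"], of "norm (z ^ i)"]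
    by (simp add: norm_mult)
  then show "summable (\<lambda>a. norm (?f a))" using summable_iff_shift[of "\<lambda>a. norm (?f a)" i] by blast
qed

text \<open>
  Absorbing factors turns the double sum into a twofold Vandermonde convolution.
\<close>

lemma double_sum_coefficient:
  fixes n a b :: nat
  shows "(\<Sum>i\<le>n. \<Sum>k\<le>n-i. of_nat (n choose i) * of_nat ((n - i) choose k) *
        (pochhammer 2 i * pochhammer 2 k / pochhammer 3 (i + k) *
         (of_nat ((a + 1) choose (i + 1)) * of_nat ((b + 1) choose (k + 1)))))
     = (2 / fact (n + 2) :: 'a::field_char_0) *
       (of_nat (a + 1) * of_nat (b + 1) * pochhammer (of_nat (a + b + 3)) n)"
proof -
  have p2: "pochhammer 2 i = (fact (i + 1) :: 'a)" for i
    by (induction i) (simp_all add: pochhammer_Suc algebra_simps)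
  have p3: "pochhammer 3 i = (fact (i + 2) / 2 :: 'a)" for i
  proof (induction i)
    case (Suc i)
    have "pochhammer 3 (Suc i) = (fact (i + 2) / 2 :: 'a) * (3 + of_nat i)"
      by (simp only: pochhammer_Suc Suc)
    then show ?case by (simp add: algebra_simps)
  qed simp
  have absorb: "fact (i + 1) * of_nat ((c + 1) choose (i + 1)) = (of_nat (c + 1) * (fact i * of_nat (c choose i)) :: 'a)" for c i
  proof -
    have "(i + 1) * ((c + 1) choose (i + 1)) = (c + 1) * (c choose i)"
      using Suc_times_binomial[of i c] by simp
    then have "(of_nat (i + 1) * of_nat ((c + 1) choose (i + 1)) :: 'a) = of_nat (c + 1) * of_nat (c choose i)"
      by (metis of_nat_mult)
    then show ?thesis by (simp add: mult.assoc mult.left_commute)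
  qed
  have trm: "of_nat (n choose i) * of_nat ((n - i) choose k) *
        (pochhammer 2 i * pochhammer 2 k / pochhammer 3 (i + k) *
         (of_nat ((a + 1) choose (i + 1)) * of_nat ((b + 1) choose (k + 1))))
      = (2 * fact n / fact (n + 2) * (of_nat (a + 1) * of_nat (b + 1)) :: 'a) *
         of_nat (((n + 2) choose (n - (i + k))) * ((a choose i) * (b choose k)))"
    if "i + k \<le> n" for i k
  proof -
    have 1: "of_nat (n choose i) * of_nat ((n - i) choose k) = (fact n / (fact i * fact k * fact (n - (i + k))) :: 'a)"
      using that by (simp add: binomial_fact)
    have 2: "of_nat ((n + 2) choose (n - (i + k))) = (fact (n + 2) / (fact (n - (i + k)) * fact (i + k + 2)) :: 'a)"
      using that by (subst binomial_fact) auto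
    have "of_nat (n choose i) * of_nat ((n - i) choose k) *
        (pochhammer 2 i * pochhammer 2 k / pochhammer 3 (i + k) *
         (of_nat ((a + 1) choose (i + 1)) * of_nat ((b + 1) choose (k + 1))))
      = (fact n / (fact i * fact k * fact (n - (i + k))) :: 'a) * (2 / fact (i + k + 2)) *
         ((fact (i + 1) * of_nat ((a + 1) choose (i + 1))) * (fact (k + 1) * of_nat ((b + 1) choose (k + 1))))"
      unfolding 1 p2 p3 by (simp add: mult_ac)
    also have "\<dots> = (2 * fact n / fact (n + 2) * (of_nat (a + 1) * of_nat (b + 1))) *
         (fact (n + 2) / (fact (n - (i + k)) * fact (i + k + 2)) * (of_nat (a choose i) * of_nat (b choose k)))"
      unfolding absorb by (simp add: field_simps del: fact_Suc)
    finally show ?thesis unfolding of_nat_mult 2 .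
  qed
  have "(\<Sum>i\<le>n. \<Sum>k\<le>n-i. ((n + 2) choose (n - (i + k))) * ((a choose i) * (b choose k)))
      = (\<Sum>(i, k)\<in>{(i, k). i + k \<le> n}. ((n + 2) choose (n - (i + k))) * ((a choose i) * (b choose k)))"
  proof -
    have "{(i, k). i + k \<le> n} = Sigma {..n} (\<lambda>i. {..n - i})" by auto
    then show ?thesis by (simp add: sum.Sigma)
  qed
  also have "\<dots> = (\<Sum>j\<le>n. \<Sum>i\<le>j. ((n + 2) choose (n - (i + (j - i)))) * ((a choose i) * (b choose (j - i))))"
    by (rule sum.triangle_reindex_eq)
  also have "\<dots> = (\<Sum>j\<le>n. ((a + b) choose j) * ((n + 2) choose (n - j)))"
    by (intro sum.cong refl) (simp add: vandermonde[symmetric] sum_distrib_left mult.commute)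
  also have "\<dots> = ((a + b + 2 + n) choose n)"
    by (simp add: vandermonde add_ac)
  finally have S: "(\<Sum>i\<le>n. \<Sum>k\<le>n-i. ((n + 2) choose (n - (i + k))) * ((a choose i) * (b choose k)))
      = ((a + b + 2 + n) choose n)" .
  have "(\<Sum>i\<le>n. \<Sum>k\<le>n-i. of_nat (n choose i) * of_nat ((n - i) choose k) *
        (pochhammer 2 i * pochhammer 2 k / pochhammer 3 (i + k) *
         (of_nat ((a + 1) choose (i + 1)) * of_nat ((b + 1) choose (k + 1)))))
     = (\<Sum>i\<le>n. \<Sum>k\<le>n-i. (2 * fact n / fact (n + 2) * (of_nat (a + 1) * of_nat (b + 1)) :: 'a) *
         of_nat (((n + 2) choose (n - (i + k))) * ((a choose i) * (b choose k))))"
    by (intro sum.cong refl trm) auto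
  also have "\<dots> = (2 * fact n / fact (n + 2) * (of_nat (a + 1) * of_nat (b + 1)) :: 'a) *
         of_nat (\<Sum>i\<le>n. \<Sum>k\<le>n-i. ((n + 2) choose (n - (i + k))) * ((a choose i) * (b choose k)))"
    unfolding of_nat_sum sum_distrib_left ..
  finally show ?thesis
    unfolding S pochhammer_choose[of n "a + b", symmetric] by (simp add: mult_ac)
qed

lemma double_sum_eq_gegen:
  assumes u: "norm u < 1" and v: "norm v < 1" and n: "n \<ge> 1"
  shows "fact (n + 2) / 2 * (\<Sum>i=0..n. \<Sum>k=0..n-i. of_nat (n choose i) * of_nat ((n - i) choose k) *
            (pochhammer 2 i * pochhammer 2 k * u ^ i * v ^ k /
             (pochhammer 3 (i + k) * (1 - u) ^ (2 + i) * (1 - v) ^ (2 + k))))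
      = fact n * (gegen n (1 - u) (1 - v) - gegen (n - 1) (1 - u) (1 - v))"
proof -
  define w where "w i k = (of_nat (n choose i) * of_nat ((n - i) choose k) *
     (pochhammer 2 i * pochhammer 2 k / pochhammer 3 (i + k)) :: complex)" for i k
  define A where "A i a = of_nat ((a + 1) choose (i + 1)) * u ^ a" for i a
  define B where "B k b = of_nat ((b + 1) choose (k + 1)) * v ^ b" for k b
  have "(\<lambda>N. fact (n + 2) / 2 * (\<Sum>i\<le>n. \<Sum>k\<le>n-i. w i k * (\<Sum>a\<le>N. A i a * B k (N - a))))
     sums (fact (n + 2) / 2 * (\<Sum>i\<le>n. \<Sum>k\<le>n-i. w i k *
       (u ^ i / (1 - u) ^ (2 + i) * (v ^ k / (1 - v) ^ (2 + k)))))"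
    unfolding A_def B_def
    by (intro sums_mult sums_sum cauchy_product_sums_of_sums shifted_inverse_power_sums u v)
  moreover have "fact (n + 2) / 2 * (\<Sum>i\<le>n. \<Sum>k\<le>n-i. w i k * (\<Sum>a\<le>N. A i a * B k (N - a)))
      = pochhammer (of_nat (N + 3)) n * hom_part N u v" for N
  proof -
    have "(\<Sum>i\<le>n. \<Sum>k\<le>n-i. w i k * (\<Sum>a\<le>N. A i a * B k (N - a)))
        = (\<Sum>a\<le>N. \<Sum>i\<le>n. \<Sum>k\<le>n-i. w i k * (A i a * B k (N - a)))"
    proof -
      have "(\<Sum>k\<le>n-i. \<Sum>a\<le>N. w i k * (A i a * B k (N - a)))
          = (\<Sum>a\<le>N. \<Sum>k\<le>n-i. w i k * (A i a * B k (N - a)))" for i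
        by (rule sum.swap)
      then have "(\<Sum>i\<le>n. \<Sum>k\<le>n-i. w i k * (\<Sum>a\<le>N. A i a * B k (N - a)))
          = (\<Sum>i\<le>n. \<Sum>a\<le>N. \<Sum>k\<le>n-i. w i k * (A i a * B k (N - a)))"
        unfolding sum_distrib_left by (intro sum.cong[OF refl])
      also have "\<dots> = (\<Sum>a\<le>N. \<Sum>i\<le>n. \<Sum>k\<le>n-i. w i k * (A i a * B k (N - a)))"
        by (rule sum.swap)
      finally show ?thesis .
    qed
    also have "\<dots> = (\<Sum>a\<le>N. u ^ a * v ^ (N - a) *
       (\<Sum>i\<le>n. \<Sum>k\<le>n-i. of_nat (n choose i) * of_nat ((n - i) choose k) *
        (pochhammer 2 i * pochhammer 2 k / pochhammer 3 (i + k) *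
         (of_nat ((a + 1) choose (i + 1)) * of_nat ((N - a + 1) choose (k + 1))))))"
      by (simp add: sum_distrib_left w_def A_def B_def mult_ac del: binomial_Suc_Suc)
    also have "\<dots> = (\<Sum>a\<le>N. u ^ a * v ^ (N - a) * (2 / fact (n + 2) *
       (of_nat (a + 1) * of_nat (N - a + 1) * pochhammer (of_nat (N + 3)) n)))"
      by (intro sum.cong refl) (simp only: double_sum_coefficient, simp)
    finally show ?thesis
      by (simp add: hom_part_def sum_distrib_left mult_ac del: fact_Suc of_nat_Suc)
  qed
  ultimately have "(\<lambda>N. pochhammer (of_nat (N + 3)) n * hom_part N u v)
     sums (fact (n + 2) / 2 * (\<Sum>i\<le>n. \<Sum>k\<le>n-i. w i k *
       (u ^ i / (1 - u) ^ (2 + i) * (v ^ k / (1 - v) ^ (2 + k)))))" by simp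
  from sums_unique2[OF this gegen_diff_sums[OF u v n]]
  show ?thesis unfolding w_def atLeast0AtMost by (simp add: mult_ac)
qed

lemma gegen_diagonal:
  assumes "x \<noteq> 0"
  shows "gegen n x x = of_nat ((n + 3) choose 3) / x ^ (n + 4)"
proof -
  have "gegen n x x = (\<Sum>i\<le>n. of_nat ((i + 1) * (n - i + 1)) / x ^ (n + 4))"
    unfolding gegen_def
  proof (intro sum.cong refl)
    fix i assume "i \<in> {..n}"
    then have "n + 4 = (i + 2) + (n - i + 2)" by simp
    then have "x ^ (n + 4) = x ^ (i + 2) * x ^ (n - i + 2)" by (simp only: power_add)
    then show "of_nat (i + 1) / x ^ (i + 2) * (of_nat (n - i + 1) / x ^ (n - i + 2))
        = of_nat ((i + 1) * (n - i + 1)) / x ^ (n + 4)"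
      by (simp only: times_divide_times_eq of_nat_mult)
  qed
  also have "\<dots> = of_nat (\<Sum>i\<le>n. (i + 1) * (n - i + 1)) / x ^ (n + 4)"
    by (simp add: sum_divide_distrib)
  also have "(\<Sum>i\<le>n. (i + 1) * (n - i + 1)) = ((n + 3) choose 3)"
  proof -
    have ch: "((0 + 1 + i) choose i) = i + 1" for i :: nat
      using binomial_symmetric[of i "i + 1"] by simp
    have "(\<Sum>i\<le>n. (i + 1) * (n - i + 1)) = ((n + 3) choose n)"
      using negative_vandermonde[where a = 0 and b = 0 and n = n, unfolded ch] by (simp add: add.commute)
    then show ?thesis using binomial_symmetric[of 3 "n + 3"] by simp
  qed
  finally show ?thesis .
qed

section \<open>Jacobi polynomials\<close>

text \<open>
  The factor \<open>A = \<Sum> (i + 1) t\<^sup>i / x\<^bsup>i+2\<^esup>\<close>, which is \<open>(x - t)\<^bsup>-2\<^esup>\<close>, satisfies \<open>(x - t) A' = 2 A\<close>. The two equations for \<open>x\<close>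
  and \<open>y\<close> combine to a first-order differential equation for the product, and its coefficients are the
  recurrence.
\<close>

lemma gegen_recurrence:
  assumes "x \<noteq> 0" "y \<noteq> 0"
  shows "x * y * of_nat (j + 2) * gegen (j + 2) x y
       = (x + y) * of_nat (j + 3) * gegen (j + 1) x y - of_nat (j + 4) * gegen j x y"
    and "gegen 1 x y = 2 * (x + y) / (x * y) ^ 3"
proof -
  define A where "A x = Abs_fps (\<lambda>i. of_nat (i + 1) / x ^ (i + 2))" for x :: complex
  have ode: "(fps_const x - fps_X) * fps_deriv (A x) = 2 * A x" if "x \<noteq> 0" for x
  proof (rule fps_ext)
    fix n
    show "fps_nth ((fps_const x - fps_X) * fps_deriv (A x)) n = fps_nth (2 * A x) n"
      using that by (cases n) (simp_all add: A_def left_diff_distrib numeral_fps_const field_simps)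
  qed
  define G where "G = A x * A y"
  have G: "fps_nth G n = gegen n x y" for n
    by (simp add: G_def A_def gegen_def fps_mult_nth atLeast0AtMost)
  have "(fps_const x - fps_X) * (fps_const y - fps_X) * fps_deriv G
      = (fps_const y - fps_X) * A y * ((fps_const x - fps_X) * fps_deriv (A x))
      + (fps_const x - fps_X) * A x * ((fps_const y - fps_X) * fps_deriv (A y))"
    by (simp add: G_def algebra_simps del: fps_const_mult)
  also have "\<dots> = 2 * ((fps_const x - fps_X) + (fps_const y - fps_X)) * G"
    unfolding ode[OF assms(1)] ode[OF assms(2)] by (simp add: G_def algebra_simps del: fps_const_mult fps_const_add)
  finally have "(fps_const x - fps_X) * (fps_const y - fps_X) * fps_deriv G
      = 2 * ((fps_const x - fps_X) + (fps_const y - fps_X)) * G" .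
  moreover have "(fps_const x - fps_X) * (fps_const y - fps_X) * fps_deriv G
      = fps_const (x * y) * fps_deriv G - fps_const (x + y) * (fps_X * fps_deriv G)
        + fps_X * (fps_X * fps_deriv G)"
    by (simp add: algebra_simps fps_const_mult[symmetric] fps_const_add[symmetric]
        del: fps_const_mult fps_const_add)
  moreover have "2 * ((fps_const x - fps_X) + (fps_const y - fps_X)) * G
      = fps_const (2 * (x + y)) * G - fps_const 4 * (fps_X * G)"
    by (simp add: algebra_simps fps_const_mult[symmetric] fps_const_add[symmetric]
        numeral_fps_const del: fps_const_mult fps_const_add)
  ultimately have eq: "fps_const (x * y) * fps_deriv G - fps_const (x + y) * (fps_X * fps_deriv G)
        + fps_X * (fps_X * fps_deriv G) = fps_const (2 * (x + y)) * G - fps_const 4 * (fps_X * G)"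
    by simp
  show "x * y * of_nat (j + 2) * gegen (j + 2) x y
       = (x + y) * of_nat (j + 3) * gegen (j + 1) x y - of_nat (j + 4) * gegen j x y"
    using arg_cong[OF eq, of "\<lambda>F. fps_nth F (j + 1)"]
    by (cases j) (simp_all add: G algebra_simps numeral_eq_Suc)
  show "gegen 1 x y = 2 * (x + y) / (x * y) ^ 3"
    using assms by (simp add: gegen_def field_simps power_numeral_reduce)
qed

text \<open>
  The Jacobi polynomials \<open>P\<^sub>m\<close> with parameters \<open>(3/2, -1/2)\<close> here and \<open>(3/2, 1/2)\<close> below, as polynomials in
  \<open>t = (z - 1) / 2\<close> and normalised to the value \<open>1\<close> at \<open>t = 0\<close>.
\<close>

definition jacobi_even :: "nat \<Rightarrow> complex \<Rightarrow> complex" where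
  "jacobi_even m t = (\<Sum>j\<le>m. of_nat (m choose j) * (pochhammer (of_nat (m + 2)) j / pochhammer (5/2) j) * t ^ j)"

definition jacobi_odd :: "nat \<Rightarrow> complex \<Rightarrow> complex" where
  "jacobi_odd m t = (\<Sum>j\<le>m. of_nat (m choose j) * (pochhammer (of_nat (m + 3)) j / pochhammer (5/2) j) * t ^ j)"

lemma pochhammer_five_halves_nonzero: "pochhammer (5/2 :: complex) j \<noteq> 0"
proof
  assume "pochhammer (5/2 :: complex) j = 0"
  then obtain k where "(5/2 :: complex) = - of_nat k" by (auto simp: pochhammer_eq_0_iff)
  then have "Re (5/2) = Re (- of_nat k)" by (rule arg_cong)
  then show False by simp
qed

lemma hyp2F1_minus_nat:
  "hyp2F1 (- of_nat m) b (5/2) (- t)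
     = (\<Sum>j\<le>m. of_nat (m choose j) * (pochhammer b j / pochhammer (5/2) j) * t ^ j)"
proof -
  have "hyp2F1 (- of_nat m) b (5/2) (- t) = (\<Sum>j\<le>m. pochhammer (- of_nat m) j * pochhammer b j /
      (fact j * pochhammer (5/2) j) * (- t) ^ j)"
    unfolding hyp2F1_def
    by (rule suminf_finite) (auto simp: pochhammer_of_nat_eq_0_iff not_le)
  also have "\<dots> = (\<Sum>j\<le>m. of_nat (m choose j) * (pochhammer b j / pochhammer (5/2) j) * t ^ j)"
  proof (intro sum.cong refl)
    fix j
    have "(- 1) ^ j * pochhammer (- of_nat m) j = fact j * (of_nat (m choose j) :: complex)"
      by (simp add: binomial_gbinomial gbinomial_pochhammer)
    then show "pochhammer (- of_nat m) j * pochhammer b j / (fact j * pochhammer (5/2) j) * (- t) ^ j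
        = of_nat (m choose j) * (pochhammer b j / pochhammer (5/2) j) * t ^ j"
      by (simp add: power_minus[of t] mult_ac)
  qed
  finally show ?thesis .
qed

lemma jacobi_P_even:
  assumes "(1 - z) / 2 = - t"
  shows "jacobi_P m (3/2) (-1/2) z = pochhammer (5/2) m / fact m * jacobi_even m t"
proof -
  have "(of_real (pochhammer (5/2) m) :: complex) = pochhammer (5/2) m"
    by (simp add: pochhammer_of_real[symmetric])
  then show ?thesis
    unfolding jacobi_P_def assms jacobi_even_def hyp2F1_minus_nat[symmetric]
    by (simp add: add_ac)
qed

lemma jacobi_P_odd:
  assumes "(1 - z) / 2 = - t"
  shows "jacobi_P m (3/2) (1/2) z = pochhammer (5/2) m / fact m * jacobi_odd m t"
proof -
  have "(of_real (pochhammer (5/2) m) :: complex) = pochhammer (5/2) m"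
    by (simp add: pochhammer_of_real[symmetric])
  then show ?thesis
    unfolding jacobi_P_def assms jacobi_odd_def hyp2F1_minus_nat[symmetric]
    by (simp add: add_ac)
qed

text \<open>
  Both contiguous relations hold coefficient by coefficient: all terms are rational multiples of a common
  product of a binomial coefficient and a Pochhammer quotient.
\<close>

lemma jacobi_contiguous_1:
  "of_nat (m + 3) * jacobi_odd (Suc m) t
     = 2 * of_nat (m + 2) * jacobi_even (Suc m) t - of_nat (m + 1) * jacobi_odd m t"
proof -
  have ext: "jacobi_odd m t = (\<Sum>j\<le>Suc m. of_nat (m choose j) * (pochhammer (of_nat (m + 3)) j / pochhammer (5/2) j) * t ^ j)"
    by (simp add: jacobi_odd_def binomial_eq_0)
  have poch: "of_nat (m + 3) * pochhammer (of_nat (m + 4)) j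
      = (pochhammer (of_nat (m + 3)) j * of_nat (m + 3 + j) :: complex)" for j
    using pochhammer_rec[of "of_nat (m + 3) :: complex" j] pochhammer_Suc[of "of_nat (m + 3) :: complex" j]
    by (simp add: add_ac)
  have choose: "of_nat (m + 1) * of_nat (m choose j) = (of_nat (Suc m - j) * of_nat (Suc m choose j) :: complex)" for j
    using binomial_absorb_comp[of "Suc m" j] by (metis Suc_eq_plus1 diff_Suc_1 of_nat_mult)
  show ?thesis
    unfolding ext unfolding jacobi_odd_def jacobi_even_def sum_distrib_left sum_subtractf[symmetric]
  proof (intro sum.cong refl)
    fix j assume j: "j \<in> {..Suc m}"
    let ?q = "pochhammer (5/2) j :: complex" and ?p = "pochhammer (of_nat (m + 3)) j :: complex"
      and ?c = "of_nat (Suc m choose j) :: complex"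
    have "of_nat (m + 3) * (?c * (pochhammer (of_nat (Suc m + 3)) j / ?q) * t ^ j)
        = ?c * (of_nat (m + 3) * pochhammer (of_nat (m + 4)) j) / ?q * t ^ j"
      by (simp add: add_ac mult_ac)
    also have "\<dots> = ?c * ?p * of_nat (m + 3 + j) / ?q * t ^ j" unfolding poch by simp
    also have "(of_nat (m + 3 + j) :: complex) = 2 * of_nat (m + 2) - of_nat (Suc m - j)"
      using j by (simp add: of_nat_diff)
    also have "?c * ?p * (2 * of_nat (m + 2) - of_nat (Suc m - j)) / ?q * t ^ j
      = 2 * of_nat (m + 2) * (?c * (?p / ?q) * t ^ j) - (of_nat (Suc m - j) * ?c) * (?p / ?q) * t ^ j"
      by (simp add: diff_divide_distrib algebra_simps)
    also have "(of_nat (Suc m - j) * ?c) * (?p / ?q) * t ^ j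
        = of_nat (m + 1) * (of_nat (m choose j) * (?p / ?q) * t ^ j)"
      unfolding choose[symmetric] by (simp only: mult.assoc)
    finally show "of_nat (m + 3) * (?c * (pochhammer (of_nat (Suc m + 3)) j / ?q) * t ^ j)
        = 2 * of_nat (m + 2) * (?c * (pochhammer (of_nat (Suc m + 2)) j / ?q) * t ^ j)
         - of_nat (m + 1) * (of_nat (m choose j) * (?p / ?q) * t ^ j)"
      by (simp add: add_ac)
  qed
qed

lemma jacobi_contiguous_2:
  "of_nat (2 * m + 5) * jacobi_even (Suc m) t
     = 2 * of_nat (2 * m + 3) * (1 + t) * jacobi_odd m t - of_nat (2 * m + 1) * jacobi_even m t"
proof -
  define b :: "nat \<Rightarrow> complex" where "b j = of_nat (m choose j) * (pochhammer (of_nat (m + 3)) j / pochhammer (5/2) j)" for j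
  define a :: "nat \<Rightarrow> complex" where "a j = of_nat (m choose j) * (pochhammer (of_nat (m + 2)) j / pochhammer (5/2) j)" for j
  define a' :: "nat \<Rightarrow> complex" where "a' j = of_nat (Suc m choose j) * (pochhammer (of_nat (m + 3)) j / pochhammer (5/2) j)" for j
  have odd: "jacobi_odd m t = (\<Sum>j\<le>Suc m. b j * t ^ j)"
    by (simp add: jacobi_odd_def b_def binomial_eq_0)
  have even: "jacobi_even m t = (\<Sum>j\<le>Suc m. a j * t ^ j)"
    by (simp add: jacobi_even_def a_def binomial_eq_0)
  have even': "jacobi_even (Suc m) t = (\<Sum>j\<le>Suc m. a' j * t ^ j)"
    by (simp add: jacobi_even_def a'_def add_ac)
  have todd: "t * jacobi_odd m t = (\<Sum>j\<le>Suc m. (if j = 0 then 0 else b (j - 1)) * t ^ j)"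
  proof -
    have "t * jacobi_odd m t = (\<Sum>j\<le>m. b j * t ^ Suc j)"
      by (simp add: jacobi_odd_def b_def sum_distrib_left mult_ac)
    also have "\<dots> = (\<Sum>j\<le>Suc m. (if j = 0 then 0 else b (j - 1)) * t ^ j)"
      by (subst sum.atMost_Suc_shift) simp
    finally show ?thesis .
  qed
  have coeff: "of_nat (2 * m + 5) * a' j
      = 2 * of_nat (2 * m + 3) * (b j + (if j = 0 then 0 else b (j - 1))) - of_nat (2 * m + 1) * a j"
    if j: "j \<le> Suc m" for j
  proof (cases j)
    case 0
    then show ?thesis by (simp add: a_def a'_def b_def algebra_simps)
  next
    case (Suc i)
    \<comment> \<open>All coefficients are multiples of \<open>u Q\<close>, and a polynomial identity in \<open>m\<close> and \<open>i\<close> remains.\<close>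
    define u where "u = (of_nat (Suc m choose j) :: complex)"
    define Q where "Q = pochhammer (of_nat (m + 3)) i / (pochhammer (5/2) j :: complex)"
    have m1: "(of_nat (m + 1) :: complex) \<noteq> 0" by (simp del: of_nat_Suc)
    have c1: "(of_nat (m choose j) :: complex) = u * (of_nat m - of_nat i) / of_nat (m + 1)"
    proof -
      have "of_nat (m + 1) * (of_nat (m choose j) :: complex) = of_nat (Suc m - j) * u"
        using binomial_absorb_comp[of "Suc m" j] unfolding u_def by (metis Suc_eq_plus1 diff_Suc_1 of_nat_mult)
      moreover have "(of_nat (Suc m - j) :: complex) = of_nat m - of_nat i"
        using j Suc by (simp add: of_nat_diff)
      ultimately show ?thesis using m1 by (simp add: field_simps del: of_nat_Suc of_nat_add)
    qed
    have c2: "(of_nat (m choose i) :: complex) = u * of_nat (i + 1) / of_nat (m + 1)"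
    proof -
      have "of_nat (m + 1) * (of_nat (m choose i) :: complex) = of_nat (i + 1) * u"
        using Suc_times_binomial[of i m] unfolding u_def Suc by (metis Suc_eq_plus1 of_nat_mult)
      then show ?thesis using m1 by (simp add: field_simps del: of_nat_Suc of_nat_add)
    qed
    have q: "pochhammer (5/2 :: complex) j = pochhammer (5/2) i * (of_nat i + 5/2)"
      by (simp add: Suc pochhammer_Suc add_ac)
    have qi: "(of_nat i + 5/2 :: complex) \<noteq> 0"
      using pochhammer_five_halves_nonzero[of j] q by auto
    have b1: "b i = u * of_nat (i + 1) / of_nat (m + 1) * (Q * (of_nat i + 5/2))"
      using qi unfolding b_def c2 Q_def q by simp
    have p3: "pochhammer (of_nat (m + 3)) j / pochhammer (5/2) j = Q * (of_nat (m + 3) + of_nat i)"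
      by (simp add: Q_def Suc pochhammer_Suc)
    have p2: "pochhammer (of_nat (m + 2)) j / pochhammer (5/2) j = Q * of_nat (m + 2)"
      by (simp add: Q_def Suc pochhammer_rec add_ac)
    have "of_nat (2 * m + 5) * (u * (Q * (of_nat (m + 3) + of_nat i))) =
       2 * of_nat (2 * m + 3) * (u * (of_nat m - of_nat i) / of_nat (m + 1) * (Q * (of_nat (m + 3) + of_nat i))
         + u * of_nat (i + 1) / of_nat (m + 1) * (Q * (of_nat i + 5/2)))
       - of_nat (2 * m + 1) * (u * (of_nat m - of_nat i) / of_nat (m + 1) * (Q * of_nat (m + 2)))"
    proof -
      have "of_nat (m + 1) * (of_nat (2 * m + 5) * (u * (Q * (of_nat (m + 3) + of_nat i)))) =
       2 * of_nat (2 * m + 3) * (u * (of_nat m - of_nat i) * (Q * (of_nat (m + 3) + of_nat i))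
         + u * of_nat (i + 1) * (Q * (of_nat i + 5/2)))
       - of_nat (2 * m + 1) * (u * (of_nat m - of_nat i) * (Q * of_nat (m + 2)))"
        by simp algebra
      moreover have "of_nat (m + 1) * (2 * of_nat (2 * m + 3) * (u * (of_nat m - of_nat i) / of_nat (m + 1) * (Q * (of_nat (m + 3) + of_nat i))
         + u * of_nat (i + 1) / of_nat (m + 1) * (Q * (of_nat i + 5/2)))
       - of_nat (2 * m + 1) * (u * (of_nat m - of_nat i) / of_nat (m + 1) * (Q * of_nat (m + 2))))
        = 2 * of_nat (2 * m + 3) * (u * (of_nat m - of_nat i) * (Q * (of_nat (m + 3) + of_nat i))
         + u * of_nat (i + 1) * (Q * (of_nat i + 5/2)))
       - of_nat (2 * m + 1) * (u * (of_nat m - of_nat i) * (Q * of_nat (m + 2)))"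
        using m1 by (simp add: right_diff_distrib distrib_left mult.left_commute[of "of_nat (m + 1)"] del: of_nat_Suc of_nat_add)
      ultimately show ?thesis using m1 by (metis mult_left_cancel)
    qed
    moreover have "b j = u * (of_nat m - of_nat i) / of_nat (m + 1) * (Q * (of_nat (m + 3) + of_nat i))"
      unfolding b_def p3 c1 ..
    moreover have "(if j = 0 then 0 else b (j - 1)) = b i" using Suc by simp
    ultimately show ?thesis
      unfolding a'_def a_def p2 p3 c1 u_def[symmetric] by (simp only: b1)
  qed
  have "of_nat (2 * m + 5) * jacobi_even (Suc m) t = (\<Sum>j\<le>Suc m. of_nat (2 * m + 5) * a' j * t ^ j)"
    by (simp only: even' sum_distrib_left mult.assoc)
  also have "\<dots> = (\<Sum>j\<le>Suc m. (2 * of_nat (2 * m + 3) * (b j + (if j = 0 then 0 else b (j - 1))) - of_nat (2 * m + 1) * a j) * t ^ j)"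
    by (intro sum.cong refl) (simp only: coeff atMost_iff)
  also have "\<dots> = 2 * of_nat (2 * m + 3) * ((\<Sum>j\<le>Suc m. b j * t ^ j) + (\<Sum>j\<le>Suc m. (if j = 0 then 0 else b (j - 1)) * t ^ j))
       - of_nat (2 * m + 1) * (\<Sum>j\<le>Suc m. a j * t ^ j)"
    by (simp only: sum_distrib_left sum.distrib[symmetric] sum_subtractf[symmetric] distrib_left distrib_right left_diff_distrib right_diff_distrib mult.assoc)
  also have "\<dots> = 2 * of_nat (2 * m + 3) * (jacobi_odd m t + t * jacobi_odd m t) - of_nat (2 * m + 1) * jacobi_even m t"
    by (simp only: odd[symmetric] todd[symmetric] even[symmetric])
  finally show ?thesis by (simp only: distrib_right mult.assoc distrib_left mult_1_left)
qed

text \<open>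
  By induction on \<open>m\<close>: since \<open>4 P (1 + t) = (x + y)\<^sup>2\<close> for \<open>P = x y\<close>, the recurrence of \<open>gegen\<close> from even to
  odd index is the first contiguous relation, and from odd to even index the second.
\<close>

theorem gegen_quadratic:
  assumes x: "x \<noteq> 0" and y: "y \<noteq> 0"
  defines "t \<equiv> ((x - y) / 2)\<^sup>2 / (x * y)"
  shows "gegen (2 * m) x y
       = of_nat ((2 * m + 3) * (2 * m + 2) * (2 * m + 1)) / 6 * jacobi_even m t / (x * y) ^ (m + 2)"
    and "gegen (2 * m + 1) x y
       = of_nat ((2 * m + 4) * (2 * m + 3) * (2 * m + 2)) / 12 * (x + y) * jacobi_odd m t / (x * y) ^ (m + 3)"
proof -
  define S where "S = x + y"
  define P where "P = x * y"
  have P: "P \<noteq> 0" using x y by (simp add: P_def)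
  have t: "4 * P * (1 + t) = S\<^sup>2"
    using P by (simp add: t_def S_def P_def[symmetric] field_simps power2_eq_square)
  define \<alpha> where "\<alpha> m = of_nat ((2 * m + 3) * (2 * m + 2) * (2 * m + 1)) / 6 * jacobi_even m t" for m
  define \<beta> where "\<beta> m = of_nat ((2 * m + 4) * (2 * m + 3) * (2 * m + 2)) / 12 * jacobi_odd m t" for m
  have c1: "of_nat (2 * m + 3) * \<beta> (Suc m) = of_nat (2 * m + 4) * \<alpha> (Suc m) - of_nat (2 * m + 5) * \<beta> m" for m
    using jacobi_contiguous_1[of m t] unfolding \<alpha>_def \<beta>_def by simp algebra
  have c2: "of_nat (2 * m + 2) * \<alpha> (Suc m) = 4 * (1 + t) * of_nat (2 * m + 3) * \<beta> m - of_nat (2 * m + 4) * \<alpha> m" for m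
    using jacobi_contiguous_2[of m t] unfolding \<alpha>_def \<beta>_def by simp algebra
  have nz: "P * of_nat (k + 2) \<noteq> 0" "P * of_nat (k + 3) \<noteq> 0" for k
    using P of_nat_neq_0[of "k + 1", where 'a = complex] of_nat_neq_0[of "k + 2", where 'a = complex]
    by (simp_all add: numeral_eq_Suc del: of_nat_Suc)
  have "gegen (2 * m) x y = \<alpha> m / P ^ (m + 2) \<and> gegen (2 * m + 1) x y = S * \<beta> m / P ^ (m + 3)"
  proof (induction m)
    case 0
    then show ?case
      using gegen_recurrence(2)[OF x y]
      by (simp add: \<alpha>_def \<beta>_def jacobi_even_def jacobi_odd_def S_def P_def gegen_def[of 0] power2_eq_square)
  next
    case (Suc m)
    have "P * of_nat (2 * m + 2) * gegen (2 * m + 2) x y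
        = S * of_nat (2 * m + 3) * (S * \<beta> m / P ^ (m + 3)) - of_nat (2 * m + 4) * (\<alpha> m / P ^ (m + 2))"
      using gegen_recurrence(1)[OF x y, of "2 * m"] Suc unfolding S_def P_def by simp
    also have "\<dots> = P * ((4 * (1 + t) * of_nat (2 * m + 3) * \<beta> m - of_nat (2 * m + 4) * \<alpha> m) / P ^ (m + 3))"
    proof -
      have "S * of_nat (2 * m + 3) * (S * \<beta> m / P ^ (m + 3)) = S\<^sup>2 * of_nat (2 * m + 3) * \<beta> m / P ^ (m + 3)"
        by (simp add: power2_eq_square)
      also have "\<dots> = P * (4 * (1 + t) * of_nat (2 * m + 3) * \<beta> m) / P ^ (m + 3)"
        unfolding t[symmetric] by (simp only: mult_ac)
      finally have "S * of_nat (2 * m + 3) * (S * \<beta> m / P ^ (m + 3))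
          = P * (4 * (1 + t) * of_nat (2 * m + 3) * \<beta> m) / P ^ (m + 3)" .
      moreover have "of_nat (2 * m + 4) * (\<alpha> m / P ^ (m + 2)) = P * (of_nat (2 * m + 4) * \<alpha> m) / P ^ (m + 3)"
      proof -
        have "P ^ (m + 3) = P * P ^ (m + 2)" by (simp add: numeral_eq_Suc)
        then show ?thesis using P by simp
      qed
      ultimately show ?thesis
        by (simp only: diff_divide_distrib right_diff_distrib times_divide_eq_right)
    qed
    finally have "P * of_nat (2 * m + 2) * gegen (2 * m + 2) x y = P * of_nat (2 * m + 2) * (\<alpha> (Suc m) / P ^ (m + 3))"
      unfolding c2[symmetric] by simp
    then have e: "gegen (2 * m + 2) x y = \<alpha> (Suc m) / P ^ (m + 3)"
      unfolding mult_left_cancel[OF nz(1)] .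
    have "P * of_nat (2 * m + 3) * gegen (2 * m + 3) x y
        = S * of_nat (2 * m + 4) * (\<alpha> (Suc m) / P ^ (m + 3)) - of_nat (2 * m + 5) * (S * \<beta> m / P ^ (m + 3))"
      using gegen_recurrence(1)[OF x y, of "2 * m + 1"] Suc e unfolding S_def P_def
      by (simp add: numeral_eq_Suc)
    also have "\<dots> = S * (of_nat (2 * m + 4) * \<alpha> (Suc m) - of_nat (2 * m + 5) * \<beta> m) / P ^ (m + 3)"
      by (simp add: diff_divide_distrib right_diff_distrib mult_ac)
    also have "\<dots> = P * of_nat (2 * m + 3) * (S * \<beta> (Suc m) / P ^ (m + 4))"
    proof -
      have "P ^ (m + 4) = P * P ^ (m + 3)" by (simp add: numeral_eq_Suc)
      then show ?thesis unfolding c1[symmetric] using P by (simp add: mult_ac)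
    qed
    finally have "gegen (2 * m + 3) x y = S * \<beta> (Suc m) / P ^ (m + 4)"
      unfolding mult_left_cancel[OF nz(2)] .
    then show ?case using e by (simp add: numeral_eq_Suc)
  qed
  then show "gegen (2 * m) x y
       = of_nat ((2 * m + 3) * (2 * m + 2) * (2 * m + 1)) / 6 * jacobi_even m t / (x * y) ^ (m + 2)"
    and "gegen (2 * m + 1) x y
       = of_nat ((2 * m + 4) * (2 * m + 3) * (2 * m + 2)) / 12 * (x + y) * jacobi_odd m t / (x * y) ^ (m + 3)"
    unfolding \<alpha>_def \<beta>_def S_def P_def by (simp_all add: mult_ac)
qed

section \<open>Separability and existence of an orthonormal basis\<close>

lemma compact_exhaustion_tail:
  fixes D :: "'a::euclidean_space set" and h :: "'a \<Rightarrow> real"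
  assumes D: "open D" and h: "set_integrable lborel D h" and e: "\<epsilon> > 0"
    and K: "\<And>n. compact (K n)" "\<And>n. K n \<subseteq> D" "\<Union>(range K) = D" "\<And>n. K n \<subseteq> interior (K (Suc n))"
  shows "\<exists>m::nat. set_lebesgue_integral lborel (D - K m) h < \<epsilon>"
proof -
  have mono: "K m \<subseteq> K n" if "m \<le> n" for m n
  proof (rule lift_Suc_mono_le[OF _ that])
    show "K n \<subseteq> K (Suc n)" for n using K(4)[of n] interior_subset by blast
  qed
  have "(\<lambda>m. \<integral>x. indicator (D - K m) x *\<^sub>R h x \<partial>lborel) \<longlonglongrightarrow> (\<integral>x. (0::real) \<partial>(lborel :: 'a measure))"
  proof (rule integral_dominated_convergence)
    show "integrable lborel (\<lambda>x. norm (indicator D x *\<^sub>R h x))"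
      using h unfolding set_integrable_def by (rule integrable_norm)
    have h': "(\<lambda>x. indicator D x *\<^sub>R h x) \<in> borel_measurable lborel"
      using h unfolding set_integrable_def by (rule borel_measurable_integrable)
    show "(\<lambda>x. indicator (D - K m) x *\<^sub>R h x) \<in> borel_measurable lborel" for m
    proof -
      have "(\<lambda>x. indicator (- K m) x *\<^sub>R (indicator D x *\<^sub>R h x)) \<in> borel_measurable lborel"
      proof (rule borel_measurable_scaleR[OF borel_measurable_indicator h'])
        show "- K m \<in> sets lborel" using K(1)[of m] by (simp add: compact_imp_closed borel_closed)
      qed
      moreover have "(\<lambda>x. indicator (- K m) x *\<^sub>R (indicator D x *\<^sub>R h x)) = (\<lambda>x. indicator (D - K m) x *\<^sub>R h x)"
        by (auto simp: indicator_def fun_eq_iff)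
      ultimately show ?thesis by simp
    qed
    show "AE x in lborel. norm (indicator (D - K m) x *\<^sub>R h x) \<le> norm (indicator D x *\<^sub>R h x)" for m
      by (intro AE_I2) (auto simp: indicator_def)
    show "AE x in lborel. (\<lambda>m. indicator (D - K m) x *\<^sub>R h x) \<longlonglongrightarrow> 0"
    proof (intro AE_I2)
      fix x
      show "(\<lambda>m. indicator (D - K m) x *\<^sub>R h x) \<longlonglongrightarrow> 0"
      proof (cases "x \<in> D")
        case True
        then obtain m where "x \<in> K m" using K(3) by blast
        then have "\<forall>n\<ge>m. indicator (D - K n) x *\<^sub>R h x = 0"
          using mono by (auto simp: indicator_def)
        then show ?thesis
          by (intro tendsto_eventually) (auto simp: eventually_sequentially)
      next
        case False
        then have "(\<lambda>m. indicator (D - K m) x *\<^sub>R h x) = (\<lambda>_. 0)" by (auto simp: indicator_def)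
        then show ?thesis by (simp only: tendsto_const)
      qed
    qed
    show "(\<lambda>x. 0) \<in> borel_measurable lborel" by (rule borel_measurable_const)
  qed
  then have "eventually (\<lambda>m. (\<integral>x. indicator (D - K m) x *\<^sub>R h x \<partial>lborel) < \<epsilon>) sequentially"
    using e by (intro order_tendstoD) auto
  then show ?thesis
    unfolding set_lebesgue_integral_def by (auto simp: eventually_sequentially)
qed

text \<open>
  Indices of the grid square of side \<open>1 / (l + 1)\<close> that contains \<open>z\<close>.
\<close>

definition cell :: "nat \<Rightarrow> complex \<Rightarrow> int \<times> int" where
  "cell l z = (\<lfloor>Re z * real (Suc l)\<rfloor>, \<lfloor>Im z * real (Suc l)\<rfloor>)"

lemma cell_eq_imp_close:
  assumes "cell l z = cell l w"
  shows "norm (z - w) \<le> 2 / real (Suc l)"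
proof -
  have close: "\<bar>x - y\<bar> \<le> 1 / real (Suc l)" if "\<lfloor>x * real (Suc l)\<rfloor> = \<lfloor>y * real (Suc l)\<rfloor>" for x y :: real
  proof -
    have "\<bar>x * real (Suc l) - y * real (Suc l)\<bar> \<le> 1" using that by linarith
    then have "\<bar>x - y\<bar> * real (Suc l) \<le> 1"
      by (simp add: left_diff_distrib[symmetric] abs_mult del: of_nat_Suc)
    then show ?thesis by (simp add: pos_le_divide_eq del: of_nat_Suc)
  qed
  have "norm (z - w) \<le> \<bar>Re (z - w)\<bar> + \<bar>Im (z - w)\<bar>" by (rule cmod_le)
  then show ?thesis
    using close[of "Re z" "Re w"] close[of "Im z" "Im w"] assms by (simp add: cell_def)
qed

text \<open>
  Continuity is enough for separability. For each precision \<open>l\<close> a function is described by finitely many data: a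
  compact set outside which its norm is small, a mesh that controls its oscillation on this set, and the
  grid cells of its values on a finite net of this mesh. Functions with the same description are close in
  norm, and there are countably many descriptions, so it suffices to choose one function for each of them.
\<close>

theorem L2a_countable_dense:
  fixes D :: "'n::finite cspace set"
  assumes D: "open D" and fin: "emeasure lborel D < \<infinity>"
  shows "\<exists>g :: nat \<Rightarrow> 'n cspace \<Rightarrow> complex. (\<forall>k. g k \<in> L2a D) \<and>
     (\<forall>f\<in>L2a D. \<forall>\<epsilon>>0. \<exists>k. L2_norm D (\<lambda>p. f p - g k p) < \<epsilon>)"
proof -
  obtain K where K: "\<And>n::nat. compact (K n)" "\<And>n. K n \<subseteq> D" "\<And>n. K n \<subseteq> interior (K (Suc n))" "\<Union>(range K) = D"
    using open_Union_compact_subsets[OF D] by metis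
  have "\<exists>xs. set xs \<subseteq> K m \<and> K m \<subseteq> (\<Union>x\<in>set xs. ball x (1 / real (Suc k)))" for m k
  proof -
    obtain F where "finite F" "F \<subseteq> K m" "K m \<subseteq> (\<Union>x\<in>F. ball x (1 / real (Suc k)))"
      using seq_compact_imp_totally_bounded[of "K m"] K(1)[of m]
      by (metis compact_imp_seq_compact of_nat_0_less_iff zero_less_Suc zero_less_divide_1_iff)
    then show ?thesis using finite_list by metis
  qed
  then obtain net where net: "\<And>m k. set (net m k) \<subseteq> K m"
    "\<And>m k. K m \<subseteq> (\<Union>x\<in>set (net m k). ball x (1 / real (Suc k)))"
    by metis
  define P :: "nat \<times> nat \<times> nat \<times> (int \<times> int) list \<Rightarrow> ('n cspace \<Rightarrow> complex) \<Rightarrow> bool" where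
    "P = (\<lambda>(l, m, k, cs) f. f \<in> L2a D \<and>
        set_lebesgue_integral lborel (D - K m) (\<lambda>p. (norm (f p))\<^sup>2) < 1 / (real (Suc l))\<^sup>2 \<and>
        (\<forall>x\<in>K m. \<forall>y\<in>K m. dist y x < 1 / real (Suc k) \<longrightarrow> dist (f y) (f x) < 1 / real (Suc l)) \<and>
        map (\<lambda>x. cell l (f x)) (net m k) = cs)"
  define G where "G c = (if \<exists>f. P c f then SOME f. P c f else (\<lambda>_. 0))" for c
  have zero: "(\<lambda>_. 0) \<in> L2a D"
    by (simp add: L2a_def holomorphic_sv_const set_integrable_def)
  have PL: "P c f \<Longrightarrow> f \<in> L2a D" for c f by (cases c) (auto simp: P_def)
  have GP: "P c (G c)" if "P c f" for c f
    unfolding G_def using that someI_ex[of "P c"] by auto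
  have GL: "G c \<in> L2a D" for c
  proof (cases "\<exists>f. P c f")
    case True then show ?thesis using GP PL by blast
  qed (simp add: G_def zero)
  have code: "\<exists>m k cs. P (l, m, k, cs) f" if f: "f \<in> L2a D" for f l
  proof -
    have "set_integrable lborel D (\<lambda>p. (norm (f p))\<^sup>2)" using f by (simp add: L2a_def)
    then obtain m where m: "set_lebesgue_integral lborel (D - K m) (\<lambda>p. (norm (f p))\<^sup>2) < 1 / (real (Suc l))\<^sup>2"
      using compact_exhaustion_tail[OF D _ _ K(1,2,4,3), of "\<lambda>p. (norm (f p))\<^sup>2" "1 / (real (Suc l))\<^sup>2"] by auto
    have "continuous_on (K m) f"
      using f K(2)[of m] by (auto simp: L2a_def intro: continuous_on_subset holomorphic_sv_continuous)
    then have "uniformly_continuous_on (K m) f"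
      using K(1) by (rule compact_uniformly_continuous)
    then obtain d where d: "d > 0" "\<And>x y. x \<in> K m \<Longrightarrow> y \<in> K m \<Longrightarrow> dist y x < d \<Longrightarrow> dist (f y) (f x) < 1 / real (Suc l)"
      unfolding uniformly_continuous_on_def by (metis of_nat_0_less_iff zero_less_Suc zero_less_divide_1_iff)
    obtain k where k: "1 / real (Suc k) < d" using d(1) nat_approx_posE by blast
    have "P (l, m, k, map (\<lambda>x. cell l (f x)) (net m k)) f"
      unfolding P_def using f m d(2) k by (auto intro: less_trans)
    then show ?thesis by blast
  qed
  have dist: "L2_norm D (\<lambda>p. f p - g p) \<le> sqrt ((16 * measure lborel D + 4) / (real (Suc l))\<^sup>2)"
    if f: "P (l, m, k, cs) f" and g: "P (l, m, k, cs) g" for l m k cs f g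
  proof -
    define L where "L = real (Suc l)"
    have L: "L > 0" by (simp add: L_def)
    have fg: "f \<in> L2a D" "g \<in> L2a D" using f g by (auto intro: PL)
    \<comment> \<open>One unit for the oscillation of each function and two for the common cell.\<close>
    have on_K: "norm (f x - g x) \<le> 4 / L" if x: "x \<in> K m" for x
    proof -
      obtain a where a: "a \<in> set (net m k)" "dist a x < 1 / real (Suc k)"
        using net(2)[of m k] x by (auto simp: ball_def)
      have aK: "a \<in> K m" using net(1) a by blast
      have "dist (f a) (f x) < 1 / L" "dist (g a) (g x) < 1 / L"
        using f g x aK a(2) unfolding P_def L_def by blast+
      moreover have "map (\<lambda>x. cell l (f x)) (net m k) = map (\<lambda>x. cell l (g x)) (net m k)"
        using f g unfolding P_def by simp
      then have "cell l (f a) = cell l (g a)" using a(1) by simp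
      then have "norm (f a - g a) \<le> 2 / L" unfolding L_def by (rule cell_eq_imp_close)
      moreover have "norm (f x - g x) \<le> norm (f x - f a) + (norm (f a - g a) + norm (g a - g x))"
        using norm_triangle_ineq[of "f x - f a" "f a - g x"] norm_triangle_ineq[of "f a - g a" "g a - g x"] by simp
      moreover have "4 / L = 1 / L + (2 / L + 1 / L)" by (simp add: add_divide_distrib[symmetric])
      ultimately show ?thesis
        unfolding dist_norm norm_minus_commute[of "f a" "f x"] by linarith
    qed
    let ?F = "\<lambda>p. 16 / L\<^sup>2 * indicator D p + 2 * (indicator (D - K m) p *\<^sub>R (norm (f p))\<^sup>2)
         + 2 * (indicator (D - K m) p *\<^sub>R (norm (g p))\<^sup>2)"
    have DK: "D - K m \<in> sets lborel" using D K(1)[of m] by (simp add: compact_imp_closed borel_closed)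
    have int: "set_integrable lborel (D - K m) (\<lambda>p. (norm (h p))\<^sup>2)" if "h \<in> L2a D" for h
      using that DK by (auto simp: L2a_def intro: set_integrable_subset)
    have intD: "integrable lborel (indicator D :: 'n cspace \<Rightarrow> real)"
      using D fin by (intro integrable_real_indicator) auto
    have F: "integrable lborel ?F"
      using int[OF fg(1)] int[OF fg(2)] intD unfolding set_integrable_def by auto
    have "set_lebesgue_integral lborel D (\<lambda>p. (norm (f p - g p))\<^sup>2) \<le> (\<integral>p. ?F p \<partial>lborel)"
      unfolding set_lebesgue_integral_def
    proof (rule integral_mono')
      fix p
      have sq: "(norm (a - b))\<^sup>2 \<le> 2 * (norm a)\<^sup>2 + 2 * (norm b)\<^sup>2" for a b :: complex
        using norm_add_square_le[of a "- b"] by simp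
      consider "p \<notin> D" | "p \<in> K m" "p \<in> D" | "p \<in> D - K m" by blast
      then show "indicator D p *\<^sub>R (norm (f p - g p))\<^sup>2 \<le> ?F p"
      proof cases
        case 2
        have "(norm (f p - g p))\<^sup>2 \<le> (4 / L)\<^sup>2"
          using on_K[OF 2(1)] by (intro power_mono) auto
        then show ?thesis using 2 by (simp add: power_divide)
      next
        case 3
        have "(norm (f p - g p))\<^sup>2 \<le> 16 / L\<^sup>2 + (2 * (norm (f p))\<^sup>2 + 2 * (norm (g p))\<^sup>2)"
          by (rule add_increasing[OF _ sq]) simp
        then show ?thesis using 3 by simp
      qed simp
      show "0 \<le> ?F p" by simp
    qed (rule F)
    also have "\<dots> = 16 / L\<^sup>2 * measure lborel D
        + 2 * set_lebesgue_integral lborel (D - K m) (\<lambda>p. (norm (f p))\<^sup>2)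
        + 2 * set_lebesgue_integral lborel (D - K m) (\<lambda>p. (norm (g p))\<^sup>2)"
      using int[OF fg(1)] int[OF fg(2)] intD unfolding set_integrable_def set_lebesgue_integral_def
      by simp
    also have "\<dots> \<le> 16 / L\<^sup>2 * measure lborel D + 2 * (1 / L\<^sup>2) + 2 * (1 / L\<^sup>2)"
      using f g unfolding P_def L_def by (intro add_mono mult_left_mono) auto
    also have "\<dots> = (16 * measure lborel D + 4) / L\<^sup>2" by (simp add: add_divide_distrib)
    finally show ?thesis unfolding L2_norm_def L_def by (rule real_sqrt_le_mono)
  qed
  have "\<exists>c. L2_norm D (\<lambda>p. f p - G c p) < \<epsilon>" if f: "f \<in> L2a D" and e: "\<epsilon> > 0" for f \<epsilon>
  proof -
    define B where "B = sqrt (16 * measure lborel D + 4)"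
    have B: "B > 0" by (simp add: B_def add_nonneg_pos)
    obtain l where l: "1 / real (Suc l) < \<epsilon> / B" using nat_approx_posE[of "\<epsilon> / B"] e B by auto
    obtain m k cs where c: "P (l, m, k, cs) f" using code[OF f] by blast
    have "L2_norm D (\<lambda>p. f p - G (l, m, k, cs) p) \<le> sqrt ((16 * measure lborel D + 4) / (real (Suc l))\<^sup>2)"
      by (rule dist[OF c GP[OF c]])
    also have "\<dots> = B * (1 / real (Suc l))" by (simp add: B_def real_sqrt_divide)
    also have "\<dots> < B * (\<epsilon> / B)" using l B by (intro mult_strict_left_mono)
    also have "\<dots> = \<epsilon>" using B by simp
    finally show ?thesis by blast
  qed
  then have "\<forall>f\<in>L2a D. \<forall>\<epsilon>>0. \<exists>k. L2_norm D (\<lambda>p. f p - G (from_nat k) p) < \<epsilon>"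
    by (metis from_nat_to_nat)
  then show ?thesis using GL by (intro exI[of _ "\<lambda>k. G (from_nat k)"]) auto
qed

text \<open>
  The family \<open>u\<close> is only a witness of infinite dimension; the basis itself comes from a dense sequence.
\<close>

theorem complete_orthonormal_basis_exists:
  fixes D :: "'n::finite cspace set"
  assumes D: "open D" and fin: "emeasure lborel D < \<infinity>"
    and u: "\<And>k::nat. u k \<in> L2a D" "\<And>k. L2_inner D (u k) (u k) \<noteq> 0"
      "\<And>i j. i \<noteq> j \<Longrightarrow> L2_inner D (u i) (u j) = 0"
  shows "\<exists>\<Phi>. complete_orthonormal_basis D \<Phi>"
proof -
  interpret semi_inner_space "L2a D" "L2_inner D" by (rule L2a_semi_inner_space[OF D])
  obtain g :: "nat \<Rightarrow> 'n cspace \<Rightarrow> complex" where g: "\<And>k. g k \<in> L2a D"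
    "\<And>f \<epsilon>. f \<in> L2a D \<Longrightarrow> \<epsilon> > 0 \<Longrightarrow> \<exists>k. nrm (\<lambda>p. f p - g k p) < \<epsilon>"
    using L2a_countable_dense[OF D fin] unfolding L2_norm_eq_nrm[OF D] by metis
  define v where "v k = (\<lambda>p. of_real (1 / nrm (u k)) * u k p)" for k
  have vV: "v k \<in> L2a D" for k unfolding v_def by (intro scale_mem u)
  have ip: "L2_inner D (v i) (v j) = of_real (1 / nrm (u i)) * (cnj (of_real (1 / nrm (u j))) * L2_inner D (u i) (u j))" for i j
    using vV[of j] unfolding v_def by (simp only: ip_scale_left u ip_scale_right)
  have "orthonormal v UNIV"
    unfolding orthonormal_def
  proof (intro conjI ballI vV)
    fix i j
    show "L2_inner D (v i) (v j) = (if i = j then 1 else 0)"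
    proof (cases "i = j")
      case True
      have "(nrm (u j))\<^sup>2 \<noteq> 0" using u(2)[of j] ip_self[OF u(1)[of j]] by auto
      then show ?thesis
        using True unfolding ip ip_self[OF u(1)[of j]] True by (simp add: power2_eq_square)
    qed (simp add: ip u(3))
  qed
  from complete_orthonormal_seq_exists[OF g this]
  show ?thesis unfolding complete_orthonormal_basis_iff[OF D] .
qed

section \<open>Averaging over rotations of the first variable\<close>

lemma D22_iff: "(z, w1, w2) \<in> D22 \<longleftrightarrow> (norm z)\<^sup>2 + (cmod w1)\<^sup>2 < 1 \<and> (norm z)\<^sup>2 + (cmod w2)\<^sup>2 < 1"
proof -
  have "(\<Sum>i\<in>UNIV. (cmod (z $ i))\<^sup>2) = (norm z)\<^sup>2"
    by (simp add: norm_vec_def L2_set_def sum_nonneg)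
  then show ?thesis by (simp add: D22_def)
qed

lemma open_D22: "open (D22 :: 'n::finite cspace set)"
proof -
  have eq: "(D22 :: 'n cspace set) = {p. (norm (fst p))\<^sup>2 + (cmod (fst (snd p)))\<^sup>2 < 1} \<inter>
      {p. (norm (fst p))\<^sup>2 + (cmod (snd (snd p)))\<^sup>2 < 1}"
    by (auto simp: D22_iff)
  show ?thesis unfolding eq by (intro open_Int open_Collect_less continuous_intros)
qed

lemma norm_lt_one_of_sum: "a\<^sup>2 + b\<^sup>2 < 1 \<Longrightarrow> 0 \<le> a \<Longrightarrow> a < (1::real)"
  by (smt (verit) power2_less_imp_less zero_le_power2 one_power2)

lemma D22_bounds:
  assumes "(z, w1, w2) \<in> D22"
  shows "norm z < 1" "cmod w1 < 1" "cmod w2 < 1"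
  using assms norm_lt_one_of_sum[of "norm z" "cmod w1"] norm_lt_one_of_sum[of "cmod w1" "norm z"]
    norm_lt_one_of_sum[of "cmod w2" "norm z"]
  by (simp_all add: D22_iff add.commute)

lemma D22_coordinates:
  assumes "p \<in> D22"
  shows "norm (fst (snd p)) < 1" "norm (snd (snd p)) < 1"
  using assms D22_bounds[of "fst p" "fst (snd p)" "snd (snd p)"] by simp_all

lemma emeasure_D22_finite: "emeasure lborel (D22 :: 'n::finite cspace set) < \<infinity>"
proof (rule emeasure_bounded_finite)
  have "(D22 :: 'n cspace set) \<subseteq> ball 0 1 \<times> (ball 0 1 \<times> ball 0 1)"
    using D22_bounds by fastforce
  then show "bounded (D22 :: 'n cspace set)"
    by (rule bounded_subset[rotated]) (intro bounded_Times bounded_ball)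
qed

lemma D22_zero_section: "(0, w1, w2) \<in> D22 \<longleftrightarrow> cmod w1 < 1 \<and> cmod w2 < 1"
  by (simp add: D22_iff power_less_one_iff abs_square_less_1)

text \<open>
  Cauchy's integral formula at the centre, on the parameter interval \<open>[0, 1]\<close> of the circle path; this
  parametrisation has total mass \<open>1\<close>.
\<close>

lemma circle_mean:
  assumes hol: "\<phi> holomorphic_on S" and S: "cball 0 1 \<subseteq> S"
  shows "((\<lambda>t. \<phi> (exp (2 * of_real pi * \<i> * of_real t))) has_integral \<phi> 0) {0..1}"
proof -
  have "((\<lambda>u. \<phi> u / (u - 0)) has_contour_integral (2 * of_real pi * \<i> * \<phi> 0)) (circlepath 0 1)"
    by (rule Cauchy_integral_circlepath_simple) (use hol S holomorphic_on_subset in auto)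
  then have "((\<lambda>t. \<phi> (circlepath 0 1 t) / circlepath 0 1 t * vector_derivative (circlepath 0 1) (at t within {0..1}))
      has_integral (2 * of_real pi * \<i> * \<phi> 0)) {0..1}"
    by (simp add: has_contour_integral_def)
  then have "((\<lambda>t. 2 * of_real pi * \<i> * \<phi> (exp (2 * of_real pi * \<i> * of_real t)))
      has_integral (2 * of_real pi * \<i> * \<phi> 0)) {0..1}"
  proof (rule has_integral_eq[rotated])
    fix t :: real assume "t \<in> {0..1}"
    then have "vector_derivative (circlepath 0 1) (at t within {0..1})
        = 2 * of_real pi * \<i> * exp (2 * of_real pi * \<i> * of_real t)"
      using vector_derivative_circlepath01[of t 0 1] by simp
    then show "\<phi> (circlepath 0 1 t) / circlepath 0 1 t * vector_derivative (circlepath 0 1) (at t within {0..1})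
        = 2 * of_real pi * \<i> * \<phi> (exp (2 * of_real pi * \<i> * of_real t))"
      by (simp only:) (simp add: circlepath)
  qed
  from has_integral_mult_right[OF this, of "1 / (2 * of_real pi * \<i>)"]
  show ?thesis by simp
qed

definition rot :: "real \<Rightarrow> 'n::finite cspace \<Rightarrow> 'n cspace" where
  "rot t p = (exp (2 * of_real pi * \<i> * of_real t) *s fst p, snd p)"

lemma norm_exp_turn: "norm (exp (2 * of_real pi * \<i> * of_real t)) = 1"
  by (simp add: norm_exp_eq_Re)

lemma norm_vector_scale: "norm (c *s (z :: complex ^ 'n::finite)) = cmod c * norm z"
  by (simp add: norm_vec_def norm_mult L2_set_right_distrib)

lemma orthogonal_transformation_rot: "orthogonal_transformation (rot t)"
  unfolding orthogonal_transformation
proof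
  show "linear (rot t)"
    by (rule linearI) (simp_all add: rot_def vec_eq_iff distrib_left)
  show "\<forall>v. norm (rot t v) = norm v"
    by (simp add: rot_def norm_prod_def norm_vector_scale norm_exp_turn del: norm_exp_eq_Re)
qed

lemma rot_in_D22: "rot t p \<in> D22 \<longleftrightarrow> p \<in> D22"
  by (cases p) (simp add: rot_def D22_iff norm_vector_scale norm_exp_turn del: norm_exp_eq_Re)

lemma continuous_rot: "continuous_on UNIV (\<lambda>q :: real \<times> 'n::finite cspace. rot (fst q) (snd q))"
  unfolding rot_def vector_scalar_mult_def by (intro continuous_intros)

text \<open>
  Averaging the integrand over the rotations \<open>rot t\<close> does not change the integral, as each of them preserves
  Lebesgue measure and the domain. By Fubini the average may be taken pointwise, where it is the mean of a
  holomorphic function over the circle \<open>e\<^bsup>i\<theta>\<^esup> z\<close>, that is, its value at \<open>0\<close>.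
\<close>

theorem D22_integral_mean:
  fixes f :: "'n::finite cspace \<Rightarrow> complex"
  assumes f: "holomorphic_sv f D22"
    and H: "continuous_on (D22 :: 'n cspace set) (\<lambda>p. H (snd p))"
    and int: "set_integrable lborel D22 (\<lambda>p. f p * H (snd p))"
  shows "set_integrable lborel (D22 :: 'n cspace set) (\<lambda>p. f (0, snd p) * H (snd p))"
    and "set_lebesgue_integral lborel (D22 :: 'n cspace set) (\<lambda>p. f (0, snd p) * H (snd p))
       = set_lebesgue_integral lborel D22 (\<lambda>p. f p * H (snd p))"
proof -
  define g where "g p = indicator D22 p *\<^sub>R (f p * H (snd p))" for p
  have gm: "g \<in> borel_measurable borel"
    unfolding g_def
    by (intro borel_measurable_continuous_on_indicator
        continuous_on_mult[OF holomorphic_sv_continuous[OF f] H])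
      (simp add: open_D22 borel_open)
  have gi: "integrable lborel g" using int unfolding set_integrable_def g_def .
  have gr: "(\<integral>p. g (rot t p) \<partial>lborel) = (\<integral>p. g p \<partial>lborel)" "integrable lborel (\<lambda>p. g (rot t p))" for t
    using integral_orthogonal[OF orthogonal_transformation_rot gm, of t] gi by auto
  have gn: "(\<integral>p. norm (g (rot t p)) \<partial>lborel) = (\<integral>p. norm (g p) \<partial>lborel)" for t
  proof -
    have "(\<integral>p. complex_of_real (norm (g (rot t p))) \<partial>lborel) = (\<integral>p. complex_of_real (norm (g p)) \<partial>lborel)"
      using gm by (intro integral_orthogonal(1)[OF orthogonal_transformation_rot]) measurable
    then show ?thesis by (simp only: integral_complex_of_real of_real_eq_iff)
  qed
  define \<Phi> where "\<Phi> = (\<lambda>(t :: real, p). indicator {0..1} t *\<^sub>R g (rot t p))"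
  have rm: "(\<lambda>q. rot (fst q) (snd q)) \<in> borel_measurable (borel :: (real \<times> 'n cspace) measure)"
    by (rule borel_measurable_continuous_onI[OF continuous_rot])
  have "\<Phi> \<in> borel_measurable (borel :: (real \<times> 'n cspace) measure)"
  proof -
    have "(\<lambda>q. g (rot (fst q) (snd q))) \<in> borel_measurable (borel :: (real \<times> 'n cspace) measure)"
      by (rule measurable_compose[OF rm gm])
    moreover have "(\<lambda>q. indicator {0..1} (fst q) :: real) \<in> borel_measurable (borel :: (real \<times> 'n cspace) measure)"
      by (rule measurable_compose[OF borel_measurable_continuous_onI[OF continuous_on_fst[OF continuous_on_id]]])
        (rule borel_measurable_indicator, simp)
    ultimately have "(\<lambda>q. indicator {0..1} (fst q) *\<^sub>R g (rot (fst q) (snd q)))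
        \<in> borel_measurable (borel :: (real \<times> 'n cspace) measure)"
      by (rule borel_measurable_scaleR[rotated])
    then show ?thesis by (simp add: \<Phi>_def case_prod_unfold)
  qed
  then have \<Phi>m: "\<Phi> \<in> borel_measurable (lborel \<Otimes>\<^sub>M lborel)" by (simp add: lborel_prod)
  have unit: "(\<integral>t. indicator {0..1::real} t *\<^sub>R (c :: 'c :: euclidean_space) \<partial>lborel) = c"
    "integrable lborel (\<lambda>t. indicator {0..1::real} t *\<^sub>R c)" for c
    by (simp_all add: integrable_scaleR_left)
  have \<Phi>i: "integrable (lborel \<Otimes>\<^sub>M lborel) \<Phi>"
  proof (rule lborel_pair.Fubini_integrable[OF \<Phi>m])
    have "(\<lambda>t. \<integral>p. norm (\<Phi> (t, p)) \<partial>lborel) = (\<lambda>t. indicator {0..1} t *\<^sub>R (\<integral>p. norm (g p) \<partial>lborel))"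
      by (auto simp: \<Phi>_def gn indicator_def)
    then show "integrable lborel (\<lambda>t. \<integral>p. norm (\<Phi> (t, p)) \<partial>lborel)"
      by (simp only: unit(2))
    show "AE t in lborel. integrable lborel (\<lambda>p. \<Phi> (t, p))"
      unfolding \<Phi>_def prod.case by (intro AE_I2 integrable_scaleR_right gr(2))
  qed
  have "(\<integral>t. (\<integral>p. \<Phi> (t, p) \<partial>lborel) \<partial>lborel) = (\<integral>t. indicator {0..1::real} t *\<^sub>R (\<integral>p. g p \<partial>lborel) \<partial>lborel)"
    unfolding \<Phi>_def prod.case integral_scaleR_right gr(1) ..
  then have total: "integral\<^sup>L (lborel \<Otimes>\<^sub>M lborel) \<Phi> = (\<integral>p. g p \<partial>lborel)"
    unfolding lborel_pair.integral_fst'[OF \<Phi>i] unit(1) .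
  have inner: "(\<integral>t. \<Phi> (t, p) \<partial>lborel) = indicator D22 p *\<^sub>R (f (0, snd p) * H (snd p))" for p
  proof (cases "p \<in> D22")
    case False
    then show ?thesis by (simp add: \<Phi>_def g_def rot_in_D22)
  next
    case True
    obtain z w1 w2 where p: "p = (z, w1, w2)" by (cases p)
    let ?\<phi> = "\<lambda>c. f ((0, w1, w2) + cscale c (z, 0, 0))"
    have hol: "?\<phi> holomorphic_on {c. (0, w1, w2) + cscale c (z, 0, 0) \<in> D22}"
      by (rule holomorphic_sv_slice[OF f])
    have sub: "cball 0 1 \<subseteq> {c. (0, w1, w2) + cscale c (z, 0, 0) \<in> D22}"
    proof
      fix c :: complex assume "c \<in> cball 0 1"
      then have le: "(cmod c * norm z)\<^sup>2 \<le> (norm z)\<^sup>2"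
        by (intro power_mono mult_left_le_one_le) auto
      have eq: "(0, w1, w2) + cscale c (z, 0, 0) = (c *s z, w1, w2)" by simp
      show "c \<in> {c. (0, w1, w2) + cscale c (z, 0, 0) \<in> D22}"
        using True le unfolding p mem_Collect_eq eq D22_iff norm_vector_scale by linarith
    qed
    have "((\<lambda>t. ?\<phi> (exp (2 * of_real pi * \<i> * of_real t))) has_integral ?\<phi> 0) {0..1}"
      by (rule circle_mean[OF hol sub])
    moreover have "?\<phi> 0 = f (0, snd p)" by (simp add: p)
    moreover have "?\<phi> (exp (2 * of_real pi * \<i> * of_real t)) = f (rot t p)" for t
      by (simp add: p rot_def)
    ultimately have hi: "((\<lambda>t. f (rot t p)) has_integral f (0, snd p)) {0..1}" by simp
    have "continuous_on {0..1} (\<lambda>t. f (rot t p))"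
    proof (rule continuous_on_compose2[OF holomorphic_sv_continuous[OF f]])
      show "continuous_on {0..1} (\<lambda>t. rot t p)"
        by (rule continuous_on_compose2[OF continuous_rot, of _ "\<lambda>t. (t, p)", simplified])
          (intro continuous_intros)
      show "(\<lambda>t. rot t p) ` {0..1} \<subseteq> D22" using True by (auto simp: rot_in_D22)
    qed
    then have si: "set_integrable lborel {0..1} (\<lambda>t. f (rot t p))"
      by (rule borel_integrable_atLeastAtMost')
    have "(\<integral>t. indicator {0..1} t *\<^sub>R f (rot t p) \<partial>lborel) = f (0, snd p)"
      using set_borel_integral_eq_integral(2)[OF si] integral_unique[OF hi]
      by (simp add: set_lebesgue_integral_def)
    moreover have "\<Phi> (t, p) = (indicator {0..1} t *\<^sub>R f (rot t p)) * H (snd p)" for t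
      using True by (simp add: \<Phi>_def g_def rot_in_D22) (simp add: rot_def)
    then have "(\<integral>t. \<Phi> (t, p) \<partial>lborel) = (\<integral>t. indicator {0..1} t *\<^sub>R f (rot t p) \<partial>lborel) * H (snd p)"
      by (simp only: integral_mult_left_zero)
    ultimately show ?thesis using True by simp
  qed
  show "set_integrable lborel (D22 :: 'n cspace set) (\<lambda>p. f (0, snd p) * H (snd p))"
    using lborel_pair.integrable_snd[of "\<lambda>t p. \<Phi> (t, p)"] \<Phi>i
    by (simp add: set_integrable_def inner)
  show "set_lebesgue_integral lborel (D22 :: 'n cspace set) (\<lambda>p. f (0, snd p) * H (snd p))
       = set_lebesgue_integral lborel D22 (\<lambda>p. f p * H (snd p))"
    using lborel_pair.integral_snd[of "\<lambda>t p. \<Phi> (t, p)"] \<Phi>i total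
    by (simp add: set_lebesgue_integral_def inner g_def)
qed

section \<open>Holomorphic functions on discs\<close>

lemma continuous_imp_lborel_measurable:
  fixes h :: "'a::euclidean_space \<Rightarrow> 'b::topological_space"
  shows "continuous_on UNIV h \<Longrightarrow> h \<in> borel_measurable lborel"
  using borel_measurable_continuous_onI by simp

lemma sums_set_integral_dominated:
  fixes h :: "'a::euclidean_space \<Rightarrow> complex" and k :: "nat \<Rightarrow> 'a \<Rightarrow> complex"
  assumes h: "set_integrable lborel S h"
    and k: "\<And>b. k b \<in> borel_measurable lborel"
    and bound: "\<And>b x. x \<in> S \<Longrightarrow> norm (k b x) \<le> B b"
    and B: "summable B"
    and sums: "\<And>x. x \<in> S \<Longrightarrow> (\<lambda>b. k b x) sums K x"
  shows "set_integrable lborel S (\<lambda>x. h x * K x)"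
    and "set_integrable lborel S (\<lambda>x. h x * k b x)"
    and "(\<lambda>b. set_lebesgue_integral lborel S (\<lambda>x. h x * k b x)) sums
          set_lebesgue_integral lborel S (\<lambda>x. h x * K x)"
proof -
  define g where "g x = indicator S x *\<^sub>R h x" for x
  define f where "f b x = g x * k b x" for b x
  have g: "integrable lborel g" using h unfolding g_def set_integrable_def .
  have f_eq: "indicator S x *\<^sub>R (h x * k b x) = f b x" for b x
    by (simp add: f_def g_def)
  have S0: "g x = 0" if "x \<notin> S" for x using that by (simp add: g_def)
  have nf: "norm (f b x) \<le> norm (g x) * B b" for b x
  proof (cases "x \<in> S")
    case True
    then show ?thesis using bound[OF True, of b] by (simp add: f_def norm_mult mult_left_mono)
  qed (simp add: f_def S0)
  have f: "integrable lborel (f b)" for b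
  proof (rule Bochner_Integration.integrable_bound)
    show "integrable lborel (\<lambda>x. norm (g x) * B b)" using g by (intro integrable_mult_left integrable_norm)
    show "f b \<in> borel_measurable lborel"
      unfolding f_def using borel_measurable_integrable[OF g] k by (intro borel_measurable_times)
    show "AE x in lborel. norm (f b x) \<le> norm (norm (g x) * B b)"
      using nf by (intro AE_I2) (smt (verit) real_norm_def)
  qed
  have sm: "AE x in lborel. summable (\<lambda>b. norm (f b x))"
  proof (intro AE_I2)
    fix x show "summable (\<lambda>b. norm (f b x))"
      by (rule summable_comparison_test'[OF summable_mult[OF B, of "norm (g x)"], of 0]) (simp add: nf)
  qed
  have si: "summable (\<lambda>b. \<integral>x. norm (f b x) \<partial>lborel)"
  proof (rule summable_comparison_test'[OF summable_mult[OF B, of "\<integral>x. norm (g x) \<partial>lborel"], of 0])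
    fix b
    have "(\<integral>x. norm (f b x) \<partial>lborel) \<le> (\<integral>x. norm (g x) * B b \<partial>lborel)"
      by (intro integral_mono integrable_norm f integrable_mult_left g nf)
    then show "norm (\<integral>x. norm (f b x) \<partial>lborel) \<le> (\<integral>x. norm (g x) \<partial>lborel) * B b"
      by simp
  qed
  have lim: "(\<Sum>b. f b x) = indicator S x *\<^sub>R (h x * K x)" for x
  proof (cases "x \<in> S")
    case True
    have "(\<lambda>b. f b x) sums (g x * K x)" unfolding f_def by (rule sums_mult[OF sums[OF True]])
    then show ?thesis using True by (simp add: sums_iff g_def)
  qed (simp add: f_def S0)
  show "set_integrable lborel S (\<lambda>x. h x * K x)"
    using integrable_suminf[OF f sm si] unfolding set_integrable_def lim .
  show "set_integrable lborel S (\<lambda>x. h x * k b x)"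
    using f unfolding set_integrable_def f_eq .
  show "(\<lambda>b. set_lebesgue_integral lborel S (\<lambda>x. h x * k b x)) sums
          set_lebesgue_integral lborel S (\<lambda>x. h x * K x)"
    using sums_integral[OF f sm si] unfolding set_lebesgue_integral_def lim f_eq .
qed

text \<open>
  Monomials of different degree are orthogonal: under the rotation by \<open>\<pi> / (b - a)\<close> the integrand changes its
  sign.
\<close>

lemma disc_moment:
  assumes r: "r > 0"
  shows "set_lebesgue_integral lborel (ball 0 r) (\<lambda>w :: complex. cnj w ^ a * w ^ b)
       = (if a = b then of_real (pi * r ^ (2 * a + 2) / real (a + 1)) else 0)"
proof (cases "a = b")
  case True
  have "set_lebesgue_integral lborel (ball 0 r) (\<lambda>w :: complex. cnj w ^ a * w ^ b)
      = (\<integral>w. of_real (indicator (ball (0::complex) r) w * ((norm w)\<^sup>2) ^ a) \<partial>lborel)"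
    unfolding set_lebesgue_integral_def
  proof (intro Bochner_Integration.integral_cong refl)
    fix w :: complex
    have "(of_real ((norm w)\<^sup>2) :: complex) = cnj w * w"
      using complex_norm_square[of w] by (simp only: mult.commute)
    then have "of_real (((norm w)\<^sup>2) ^ a) = (cnj w * w) ^ a"
      by (subst of_real_power) (simp only:)
    then have "cnj w ^ a * w ^ b = of_real (((norm w)\<^sup>2) ^ a)"
      by (simp only: power_mult_distrib True)
    then show "indicator (ball 0 r) w *\<^sub>R (cnj w ^ a * w ^ b) = of_real (indicator (ball (0::complex) r) w * ((norm w)\<^sup>2) ^ a)"
      by (simp add: scaleR_conv_of_real)
  qed
  also have "\<dots> = of_real (\<integral>w. indicator (ball (0::complex) r) w * ((norm w)\<^sup>2) ^ a \<partial>lborel)"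
    by (rule integral_complex_of_real)
  also have "(\<integral>w. indicator (ball (0::complex) r) w * ((norm w)\<^sup>2) ^ a \<partial>lborel)
      = (\<integral>t. indicator {0..r\<^sup>2} t * (pi ^ Suc 0 / fact 0 * t ^ 0) * t ^ a \<partial>lborel)"
    by (rule integral_norm_square_ball[OF _ r]) (simp_all add: DIM_complex)
  also have "\<dots> = (\<integral>t. (pi * t ^ a) * indicator {0..r\<^sup>2} t \<partial>lborel)"
    by (intro Bochner_Integration.integral_cong refl) simp
  also have "\<dots> = pi / real (a + 1) * (r\<^sup>2) ^ (a + 1) - pi / real (a + 1) * 0 ^ (a + 1)"
  proof (rule integral_FTC_Icc_nonneg[where F = "\<lambda>t. pi / real (a + 1) * t ^ (a + 1)"])
    fix t :: real
    have "((\<lambda>t. pi / real (a + 1) * t ^ (a + 1)) has_real_derivative pi / real (a + 1) * (real (a + 1) * t ^ a)) (at t)"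
      by (rule DERIV_cmult, rule DERIV_cong[OF DERIV_pow]) simp
    then show "((\<lambda>t. pi / real (a + 1) * t ^ (a + 1)) has_real_derivative pi * t ^ a) (at t)"
      by (rule DERIV_cong) (simp del: of_nat_Suc)
  next
    fix t :: real assume "t \<in> {0..r\<^sup>2}" then show "0 \<le> pi * t ^ a" by simp
  qed simp_all
  also have "\<dots> = pi * r ^ (2 * a + 2) / real (a + 1)"
  proof -
    have "(r\<^sup>2) ^ (a + 1) = r ^ (2 * a + 2)" by (simp only: power_mult[symmetric]) simp
    then show ?thesis by simp
  qed
  finally show ?thesis using True by (simp only: refl if_True)
next
  case False
  define \<theta> where "\<theta> = pi / (real b - real a)"
  define c where "c = cis \<theta>"
  define g where "g w = indicator (ball 0 r) w *\<^sub>R (cnj w ^ a * w ^ b)" for w :: complex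
  have nc: "norm c = 1" by (simp add: c_def)
  have c: "cnj c ^ a * c ^ b = -1"
  proof -
    have "cnj c ^ a * c ^ b = cis (real a * - \<theta> + real b * \<theta>)"
      by (simp only: c_def cis_cnj Complex.DeMoivre cis_mult)
    also have "real a * - \<theta> + real b * \<theta> = (real b - real a) * \<theta>" by (simp add: algebra_simps)
    also have "\<dots> = pi" using False by (simp add: \<theta>_def)
    finally show ?thesis by simp
  qed
  have orth: "orthogonal_transformation (\<lambda>w. c * w)"
    unfolding orthogonal_transformation
    by (auto intro!: linearI simp: algebra_simps norm_mult nc)
  have meas: "g \<in> borel_measurable borel"
    unfolding g_def by (intro borel_measurable_continuous_on_indicator continuous_intros) simp
  have rotate: "g (c * w) = - g w" for w
  proof -
    have "cnj (c * w) ^ a * (c * w) ^ b = (cnj c ^ a * c ^ b) * (cnj w ^ a * w ^ b)"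
      by (simp only: complex_cnj_mult power_mult_distrib mult_ac)
    moreover have "indicator (ball 0 r) (c * w) = (indicator (ball 0 r) w :: real)"
      by (simp add: indicator_def norm_mult nc)
    ultimately show ?thesis unfolding g_def c by simp
  qed
  have "(\<integral>w. g w \<partial>lborel) = (\<integral>w. g (c * w) \<partial>lborel)"
    using integral_orthogonal(1)[OF orth meas] by simp
  also have "\<dots> = - (\<integral>w. g w \<partial>lborel)" by (simp only: rotate integral_minus)
  finally have "(\<integral>w. g w \<partial>lborel) = 0" by simp
  then show ?thesis using False by (simp add: set_lebesgue_integral_def g_def)
qed

lemma set_integrable_ball:
  fixes h :: "complex \<Rightarrow> complex"
  assumes "continuous_on (cball 0 r) h"
  shows "set_integrable lborel (ball 0 r) h"
proof (rule set_integrable_subset)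
  show "set_integrable lborel (cball 0 r) h"
    unfolding set_integrable_def using assms by (intro borel_integrable_compact compact_cball)
qed auto

lemma taylor_coefficients:
  assumes G: "G holomorphic_on ball 0 R"
  obtains g :: "nat \<Rightarrow> complex" where "\<And>w. norm w < R \<Longrightarrow> (\<lambda>b. g b * w ^ b) sums G w"
    and "\<And>r. 0 \<le> r \<Longrightarrow> r < R \<Longrightarrow> summable (\<lambda>b. norm (g b) * r ^ b)"
proof
  let ?g = "\<lambda>b. (deriv ^^ b) G 0 / fact b"
  show s: "(\<lambda>b. ?g b * w ^ b) sums G w" if "norm w < R" for w
    using holomorphic_power_series[OF G, of w] that by simp
  show "summable (\<lambda>b. norm (?g b) * r ^ b)" if r0: "0 \<le> r" and r1: "r < R" for r
  proof -
    obtain x where x: "r < x" "x < R" using dense[OF r1] by blast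
    have "summable (\<lambda>b. ?g b * of_real x ^ b)"
      using s[of "of_real x"] x r0 by (auto intro: sums_summable)
    from powser_insidea[OF this, of "of_real r"]
    have "summable (\<lambda>b. norm (?g b * of_real r ^ b))" using x r0 by simp
    then show ?thesis using r0 by (simp add: norm_mult norm_divide norm_power)
  qed
qed

text \<open>
  The function \<open>1 / (\<pi> (1 - w \<eta>\<^sup>*)\<^sup>2)\<close> is the Bergman kernel of the unit disc. On the disc of radius \<open>r\<close> its
  coefficients are off by powers of \<open>r\<^sup>2\<close>, hence the scaled argument.
\<close>

theorem disc_reproducing:
  assumes G: "G holomorphic_on ball 0 1" and r: "0 < r" "r < 1" and \<eta>: "norm \<eta> < 1"
  shows "set_lebesgue_integral lborel (ball 0 r) (\<lambda>w. G w * (1 / (1 - cnj w * \<eta>)\<^sup>2))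
       = of_real (pi * r\<^sup>2) * G (of_real (r\<^sup>2) * \<eta>)"
proof -
  obtain g where g: "\<And>w. norm w < 1 \<Longrightarrow> (\<lambda>b. g b * w ^ b) sums G w"
    and gs: "\<And>r. 0 \<le> r \<Longrightarrow> r < 1 \<Longrightarrow> summable (\<lambda>b. norm (g b) * r ^ b)"
    using taylor_coefficients[OF G] by blast
  have coeff: "set_lebesgue_integral lborel (ball 0 r) (\<lambda>w. cnj w ^ a * G w)
      = g a * of_real (pi * r ^ (2 * a + 2) / real (a + 1))" for a
  proof -
    have "(\<lambda>b. set_lebesgue_integral lborel (ball 0 r) (\<lambda>w. cnj w ^ a * (g b * w ^ b))) sums
        set_lebesgue_integral lborel (ball 0 r) (\<lambda>w. cnj w ^ a * G w)"
    proof (rule sums_set_integral_dominated(3))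
      show "set_integrable lborel (ball 0 r) (\<lambda>w. cnj w ^ a)"
        by (intro set_integrable_ball continuous_intros)
      show "(\<lambda>w. g b * w ^ b) \<in> borel_measurable lborel" for b
        by (intro continuous_imp_lborel_measurable continuous_intros)
      show "norm (g b * w ^ b) \<le> norm (g b) * r ^ b" if "w \<in> ball 0 r" for b w
        using that by (auto simp: norm_mult norm_power intro!: mult_left_mono power_mono)
      show "summable (\<lambda>b. norm (g b) * r ^ b)" using gs r by simp
      show "(\<lambda>b. g b * w ^ b) sums G w" if "w \<in> ball 0 r" for w
        using that r by (intro g) simp
    qed
    moreover have "set_lebesgue_integral lborel (ball 0 r) (\<lambda>w. cnj w ^ a * (g b * w ^ b))
        = (if b = a then g a * of_real (pi * r ^ (2 * a + 2) / real (a + 1)) else 0)" for b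
    proof -
      have "set_lebesgue_integral lborel (ball 0 r) (\<lambda>w. cnj w ^ a * (g b * w ^ b))
          = g b * set_lebesgue_integral lborel (ball 0 r) (\<lambda>w :: complex. cnj w ^ a * w ^ b)"
        by (subst set_integral_mult_right[symmetric]) (simp only: mult.left_commute)
      then show ?thesis unfolding disc_moment[OF r(1)] by auto
    qed
    ultimately show ?thesis
      using sums_single[of a "\<lambda>_. g a * of_real (pi * r ^ (2 * a + 2) / real (a + 1))"]
      by (simp only:) (blast intro: sums_unique2)
  qed
  have "(\<lambda>a. set_lebesgue_integral lborel (ball 0 r) (\<lambda>w. G w * (of_nat (a + 1) * (cnj w * \<eta>) ^ a))) sums
      set_lebesgue_integral lborel (ball 0 r) (\<lambda>w. G w * (1 / (1 - cnj w * \<eta>)\<^sup>2))"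
  proof (rule sums_set_integral_dominated(3))
    have "cball 0 r \<subseteq> ball (0::complex) 1" using r by auto
    then show "set_integrable lborel (ball 0 r) G"
      using G by (intro set_integrable_ball) (blast intro: holomorphic_on_imp_continuous_on continuous_on_subset)
    show "(\<lambda>w. of_nat (a + 1) * (cnj w * \<eta>) ^ a) \<in> borel_measurable lborel" for a
      by (intro continuous_imp_lborel_measurable continuous_intros)
    have le: "norm (cnj w * \<eta>) \<le> norm \<eta>" if "w \<in> ball 0 r" for w
      using that r by (simp add: norm_mult mult_left_le_one_le)
    show "norm (of_nat (a + 1) * (cnj w * \<eta>) ^ a) \<le> real (a + 1) * norm \<eta> ^ a" if "w \<in> ball 0 r" for a w
      using le[OF that] by (auto simp: norm_mult norm_power simp del: of_nat_Suc complex_mod_cnj intro!: mult_left_mono power_mono)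
    show "summable (\<lambda>a. real (a + 1) * norm \<eta> ^ a)"
      using inverse_power_sums(2)[OF \<eta>, of 1]
      by (simp only: choose_one norm_mult norm_power norm_of_nat)
    show "(\<lambda>a. of_nat (a + 1) * (cnj w * \<eta>) ^ a) sums (1 / (1 - cnj w * \<eta>)\<^sup>2)" if "w \<in> ball 0 r" for w
      using inverse_power_sums(1)[of "cnj w * \<eta>" 1] le[OF that] \<eta> by (simp add: power2_eq_square)
  qed
  moreover have "set_lebesgue_integral lborel (ball 0 r) (\<lambda>w. G w * (of_nat (a + 1) * (cnj w * \<eta>) ^ a))
      = of_real (pi * r\<^sup>2) * (g a * (of_real (r\<^sup>2) * \<eta>) ^ a)" for a
  proof -
    have "set_lebesgue_integral lborel (ball 0 r) (\<lambda>w. G w * (of_nat (a + 1) * (cnj w * \<eta>) ^ a))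
        = of_nat (a + 1) * \<eta> ^ a * set_lebesgue_integral lborel (ball 0 r) (\<lambda>w. cnj w ^ a * G w)"
      by (subst set_integral_mult_right[symmetric]) (simp only: power_mult_distrib mult_ac)
    also have "\<dots> = of_real (pi * r ^ (2 * a + 2)) * (g a * \<eta> ^ a)"
      unfolding coeff by (simp add: field_simps del: of_nat_Suc of_nat_add)
    also have "r ^ (2 * a + 2) = r\<^sup>2 * (r\<^sup>2) ^ a" by (simp only: power_mult[symmetric] power_add[symmetric] add.commute)
    finally show ?thesis by (simp add: power_mult_distrib mult_ac)
  qed
  moreover have "(\<lambda>a. of_real (pi * r\<^sup>2) * (g a * (of_real (r\<^sup>2) * \<eta>) ^ a)) sums (of_real (pi * r\<^sup>2) * G (of_real (r\<^sup>2) * \<eta>))"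
  proof (intro sums_mult g)
    have "r\<^sup>2 * norm \<eta> \<le> norm \<eta>" using r by (simp add: mult_left_le_one_le power_le_one)
    then show "norm (of_real (r\<^sup>2) * \<eta>) < 1" using \<eta> by (simp add: norm_mult norm_power)
  qed
  ultimately show ?thesis by (simp only:) (blast intro: sums_unique2)
qed

section \<open>Holomorphic functions on bidiscs\<close>

lemma norm_mult_less_one:
  fixes a b :: complex
  assumes "norm a < 1" "norm b < 1"
  shows "norm (a * b) < 1" "1 - a * b \<noteq> 0"
proof -
  show "norm (a * b) < 1" using mult_strict_mono'[OF assms] by (simp add: norm_mult)
  then show "1 - a * b \<noteq> 0" by auto
qed

text \<open>
  Otherwise the power series with coefficients \<open>a n - b n\<close> would have an isolated zero at \<open>0\<close> while summing to
  zero everywhere.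
\<close>

lemma power_series_coefficients_unique:
  fixes a b :: "nat \<Rightarrow> complex"
  assumes a: "\<And>x. norm x < 1 \<Longrightarrow> (\<lambda>n. a n * x ^ n) sums f x"
    and b: "\<And>x. norm x < 1 \<Longrightarrow> (\<lambda>n. b n * x ^ n) sums f x"
  shows "a m = b m"
proof (rule ccontr)
  assume ne: "a m \<noteq> b m"
  have d: "(\<lambda>n. (a n - b n) * x ^ n) sums 0" if "norm x < 1" for x
    using sums_diff[OF a[OF that] b[OF that]] by (simp add: left_diff_distrib)
  show False
  proof (cases "m = 0")
    case True
    then show False using d[of 0] ne by (simp add: powser_sums_zero_iff)
  next
    case False
    then obtain s where s: "0 < s" "\<And>z :: complex. z \<in> cball 0 s - {0} \<Longrightarrow> (0::complex) \<noteq> 0"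
      using powser_0_nonzero[of 1 0 "\<lambda>n. a n - b n" "\<lambda>_. 0" m] d ne by auto
    have "of_real s \<in> cball (0::complex) s - {0}" using s(1) by simp
    then show False using s(2) by blast
  qed
qed

lemma hom_part_scale: "hom_part N (c * u) (c * v) = c ^ N * hom_part N u v"
  unfolding hom_part_def sum_distrib_left
proof (intro sum.cong refl)
  fix a assume "a \<in> {..N}"
  then have "c ^ N = c ^ a * c ^ (N - a)" by (simp add: power_add[symmetric])
  then show "of_nat (a + 1) * (c * u) ^ a * (of_nat (N - a + 1) * (c * v) ^ (N - a)) =
      c ^ N * (of_nat (a + 1) * u ^ a * (of_nat (N - a + 1) * v ^ (N - a)))"
    by (simp only: power_mult_distrib mult_ac)
qed

lemma hom_part_one: "hom_part N 1 1 = of_real (norm (hom_part N 1 1))"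
proof -
  have "hom_part N 1 1 = of_nat (\<Sum>a\<le>N. (a + 1) * (N - a + 1))"
    by (simp only: hom_part_def power_one mult_1_right of_nat_sum of_nat_mult)
  then show ?thesis by (simp only: norm_of_nat of_real_of_nat_eq)
qed

lemma hom_part_bound:
  assumes "norm u \<le> \<rho>" "norm v \<le> \<rho>"
  shows "norm (hom_part N u v) \<le> \<rho> ^ N * norm (hom_part N 1 1)"
proof -
  have "norm (hom_part N u v) \<le> (\<Sum>a\<le>N. \<rho> ^ N * real ((a + 1) * (N - a + 1)))"
    unfolding hom_part_def
  proof (rule sum_norm_le)
    fix a assume a: "a \<in> {..N}"
    have "norm u ^ a * norm v ^ (N - a) \<le> \<rho> ^ a * \<rho> ^ (N - a)"
      using assms by (intro mult_mono power_mono zero_le_power norm_ge_zero) (auto intro: order_trans[OF norm_ge_zero])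
    also have "\<dots> = \<rho> ^ N" using a by (simp add: power_add[symmetric])
    finally have "norm u ^ a * norm v ^ (N - a) * real ((a + 1) * (N - a + 1)) \<le> \<rho> ^ N * real ((a + 1) * (N - a + 1))"
      by (rule mult_right_mono) simp
    then show "norm (of_nat (a + 1) * u ^ a * (of_nat (N - a + 1) * v ^ (N - a))) \<le> \<rho> ^ N * real ((a + 1) * (N - a + 1))"
      by (simp only: norm_mult norm_power norm_of_nat of_nat_mult mult_ac)
  qed
  also have "\<dots> = \<rho> ^ N * real (\<Sum>a\<le>N. (a + 1) * (N - a + 1))"
    by (simp only: sum_distrib_left[symmetric] of_nat_sum)
  also have "real (\<Sum>a\<le>N. (a + 1) * (N - a + 1)) = norm (hom_part N 1 1)"
  proof -
    have "hom_part N 1 1 = of_nat (\<Sum>a\<le>N. (a + 1) * (N - a + 1))"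
      by (simp only: hom_part_def power_one mult_1_right of_nat_sum of_nat_mult)
    then show ?thesis by (simp only: norm_of_nat)
  qed
  finally show ?thesis .
qed

lemma summable_hom_part_bound:
  assumes \<rho>: "0 \<le> \<rho>" "\<rho> < 1"
  shows "summable (\<lambda>N. \<rho> ^ N * norm (hom_part N 1 1))"
    and "n \<ge> 1 \<Longrightarrow> summable (\<lambda>N. pochhammer (real (N + 3)) n * (\<rho> ^ N * norm (hom_part N 1 1)))"
proof -
  have nr: "norm (complex_of_real \<rho>) < 1" using \<rho> by simp
  have h: "hom_part N (of_real \<rho>) (of_real \<rho>) = of_real (\<rho> ^ N * norm (hom_part N 1 1))" for N
    using hom_part_scale[of N "of_real \<rho>" 1 1] hom_part_one[of N] by simp
  have p: "pochhammer (of_nat (N + 3)) n = complex_of_real (pochhammer (real (N + 3)) n)" for N n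
    by (simp only: pochhammer_of_real[symmetric] of_real_of_nat_eq)
  show "summable (\<lambda>N. \<rho> ^ N * norm (hom_part N 1 1))"
    using summable_Re[OF sums_summable[OF gegen_sums[OF nr nr, of 0]]] unfolding h by simp
  show "summable (\<lambda>N. pochhammer (real (N + 3)) n * (\<rho> ^ N * norm (hom_part N 1 1)))" if "n \<ge> 1"
    using summable_Re[OF sums_summable[OF gegen_diff_sums[OF nr nr that]]]
    unfolding h p of_real_mult[symmetric] Re_complex_of_real .
qed

text \<open>
  Since \<open>hom_part\<close> has nonnegative coefficients, the series is dominated by its value at \<open>u = v = \<rho>\<close>.
\<close>

lemma kernel_series_majorant:
  assumes "0 \<le> \<rho>" "\<rho> < 1" "n \<ge> 1"
  obtains B where "summable B" and "\<And>N u v. norm u \<le> \<rho> \<Longrightarrow> norm v \<le> \<rho> \<Longrightarrow>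
     norm (of_real (pochhammer (real (N + 3)) n / pi ^ (n + 2)) * hom_part N u v) \<le> B N"
proof
  let ?B = "\<lambda>N. pochhammer (real (N + 3)) n / pi ^ (n + 2) * (\<rho> ^ N * norm (hom_part N 1 1))"
  show "summable ?B"
    using summable_mult[OF summable_hom_part_bound(2)[OF assms], of "1 / pi ^ (n + 2)"] by simp
  fix N and u v :: complex assume "norm u \<le> \<rho>" "norm v \<le> \<rho>"
  moreover have "0 \<le> pochhammer (real (N + 3)) n / pi ^ (n + 2)" by (simp add: pochhammer_nonneg)
  ultimately show "norm (of_real (pochhammer (real (N + 3)) n / pi ^ (n + 2)) * hom_part N u v) \<le> ?B N"
    unfolding norm_mult norm_of_real by (simp only: abs_of_nonneg) (intro mult_left_mono hom_part_bound)
qed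

lemma hom_part_sums:
  assumes "norm u < 1" "norm v < 1"
  shows "(\<lambda>N. hom_part N u v) sums (1 / (1 - u)\<^sup>2 * (1 / (1 - v)\<^sup>2))"
  using gegen_sums[OF assms, of 0] by (simp add: gegen_def power2_eq_square)

lemma hom_part_measurable:
  "(\<lambda>w :: complex \<times> complex. hom_part N (cnj (fst w) * \<xi>1) (cnj (snd w) * \<xi>2)) \<in> borel_measurable lborel"
  unfolding hom_part_def by (intro continuous_imp_lborel_measurable continuous_intros)

text \<open>
  Joint continuity is what iterated integration over bidiscs asks for, holomorphy in each variable what the
  one-variable formulas ask for.
\<close>

locale bidisc_holomorphic =
  fixes F :: "complex \<times> complex \<Rightarrow> complex"
  assumes cont: "continuous_on (ball 0 1 \<times> ball 0 1) F"
    and hol1: "\<And>y. norm y < 1 \<Longrightarrow> (\<lambda>x. F (x, y)) holomorphic_on ball 0 1"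
    and hol2: "\<And>x. norm x < 1 \<Longrightarrow> (\<lambda>y. F (x, y)) holomorphic_on ball 0 1"
begin

lemma integrable_small_bidisc:
  assumes r: "0 < r" "r < 1" and h: "continuous_on (ball 0 1 \<times> ball 0 1) h"
  shows "set_integrable lborel (ball 0 r \<times> ball 0 r) (\<lambda>w. F w * h w :: complex)"
proof (rule set_integrable_subset)
  have "cball 0 r \<times> cball 0 r \<subseteq> ball (0::complex) 1 \<times> ball (0::complex) 1" using r by auto
  then have "continuous_on (cball 0 r \<times> cball 0 r) (\<lambda>w. F w * h w)"
    by (rule continuous_on_subset[OF continuous_on_mult[OF cont h]])
  then show "set_integrable lborel (cball 0 r \<times> cball 0 r) (\<lambda>w. F w * h w)"
    unfolding set_integrable_def by (intro borel_integrable_compact compact_Times compact_cball)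
  show "ball 0 r \<times> ball 0 r \<subseteq> cball (0::complex) r \<times> cball (0::complex) r" by auto
  have "open (ball (0::complex) r \<times> ball (0::complex) r)" by (intro open_Times open_ball)
  then show "ball (0::complex) r \<times> ball (0::complex) r \<in> sets lborel" by simp
qed

lemma bidisc_reproducing:
  assumes r: "0 < r" "r < 1" and \<eta>: "norm \<eta>1 < 1" "norm \<eta>2 < 1"
  shows "set_lebesgue_integral lborel (ball 0 r \<times> ball 0 r)
       (\<lambda>w. F w * (1 / (1 - cnj (fst w) * \<eta>1)\<^sup>2 * (1 / (1 - cnj (snd w) * \<eta>2)\<^sup>2)))
     = of_real ((pi * r\<^sup>2)\<^sup>2) * F (of_real (r\<^sup>2) * \<eta>1, of_real (r\<^sup>2) * \<eta>2)"
proof -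
  define h1 where "h1 x = 1 / (1 - cnj x * \<eta>1)\<^sup>2" for x
  define h2 where "h2 y = 1 / (1 - cnj y * \<eta>2)\<^sup>2" for y
  let ?S = "ball (0::complex) r \<times> ball (0::complex) r"
  have ch: "continuous_on (ball 0 1 \<times> ball 0 1) (\<lambda>w. h1 (fst w) * h2 (snd w))"
    unfolding h1_def h2_def using norm_mult_less_one(2)[OF _ \<eta>(1)] norm_mult_less_one(2)[OF _ \<eta>(2)]
    by (intro continuous_intros ballI) auto
  have int: "integrable (lborel \<Otimes>\<^sub>M lborel) (\<lambda>w. indicator ?S w *\<^sub>R (F w * (h1 (fst w) * h2 (snd w))))"
    using integrable_small_bidisc[OF r ch] unfolding set_integrable_def lborel_prod .
  have inner: "(\<integral>y. indicator ?S (x, y) *\<^sub>R (F (x, y) * (h1 (fst (x, y)) * h2 (snd (x, y)))) \<partial>lborel)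
      = of_real (pi * r\<^sup>2) * (indicator (ball 0 r) x *\<^sub>R (F (x, of_real (r\<^sup>2) * \<eta>2) * h1 x))" for x
  proof (cases "x \<in> ball 0 r")
    case True
    then have x1: "norm x < 1" using r by simp
    have "(\<integral>y. indicator ?S (x, y) *\<^sub>R (F (x, y) * (h1 (fst (x, y)) * h2 (snd (x, y)))) \<partial>lborel)
        = (\<integral>y. h1 x * (indicator (ball 0 r) y *\<^sub>R (F (x, y) * h2 y)) \<partial>lborel)"
      using True by (intro Bochner_Integration.integral_cong refl) (simp add: indicator_times)
    also have "\<dots> = h1 x * set_lebesgue_integral lborel (ball 0 r) (\<lambda>y. F (x, y) * h2 y)"
      unfolding set_lebesgue_integral_def by (rule integral_mult_right_zero)
    also have "\<dots> = h1 x * (of_real (pi * r\<^sup>2) * F (x, of_real (r\<^sup>2) * \<eta>2))"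
      unfolding h2_def by (subst disc_reproducing[OF hol2[OF x1] r \<eta>(2)]) (rule refl)
    finally show ?thesis using True by (simp add: mult_ac)
  qed (simp add: indicator_times)
  have "norm (of_real (r\<^sup>2) * \<eta>2) < 1"
  proof -
    have "r\<^sup>2 * norm \<eta>2 \<le> norm \<eta>2" using r by (simp add: mult_left_le_one_le power_le_one)
    then show ?thesis using \<eta>(2) by (simp add: norm_mult norm_power)
  qed
  note hol = hol1[OF this]
  have "set_lebesgue_integral lborel ?S (\<lambda>w. F w * (h1 (fst w) * h2 (snd w)))
      = (\<integral>w. indicator ?S w *\<^sub>R (F w * (h1 (fst w) * h2 (snd w))) \<partial>(lborel \<Otimes>\<^sub>M lborel))"
    unfolding set_lebesgue_integral_def lborel_prod ..
  also have "\<dots> = (\<integral>x. of_real (pi * r\<^sup>2) * (indicator (ball 0 r) x *\<^sub>R (F (x, of_real (r\<^sup>2) * \<eta>2) * h1 x)) \<partial>lborel)"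
    unfolding lborel_pair.integral_fst'[OF int, symmetric] inner ..
  also have "\<dots> = of_real (pi * r\<^sup>2) * set_lebesgue_integral lborel (ball 0 r) (\<lambda>x. F (x, of_real (r\<^sup>2) * \<eta>2) * h1 x)"
    unfolding set_lebesgue_integral_def by (rule integral_mult_right_zero)
  also have "\<dots> = of_real (pi * r\<^sup>2) * (of_real (pi * r\<^sup>2) * F (of_real (r\<^sup>2) * \<eta>1, of_real (r\<^sup>2) * \<eta>2))"
    unfolding h1_def by (subst disc_reproducing[OF hol r \<eta>(1)]) (rule refl)
  finally show ?thesis unfolding h1_def h2_def by (simp add: power2_eq_square mult_ac)
qed

text \<open>
  Replacing \<open>\<eta>\<close> by \<open>x \<xi>\<close> in \<open>bidisc_reproducing\<close> makes both sides power series in one complex variable \<open>x\<close>, and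
  their coefficients are compared. In this way only Taylor series on complex lines are needed.
\<close>

lemma bidisc_coefficient:
  assumes r: "0 < r" "r < 1" and \<xi>: "norm \<xi>1 < 1" "norm \<xi>2 < 1"
    and c: "\<And>x. norm x < 1 \<Longrightarrow> (\<lambda>N. c N * x ^ N) sums F (x * \<xi>1, x * \<xi>2)"
  shows "set_lebesgue_integral lborel (ball 0 r \<times> ball 0 r)
       (\<lambda>w. F w * hom_part N (cnj (fst w) * \<xi>1) (cnj (snd w) * \<xi>2))
     = of_real (pi\<^sup>2 * (r\<^sup>2) ^ (N + 2)) * c N"
proof -
  let ?S = "ball (0::complex) r \<times> ball (0::complex) r"
  let ?h = "\<lambda>N w. hom_part N (cnj (fst w) * \<xi>1) (cnj (snd w) * \<xi>2)"
  have small: "norm (cnj x * \<xi>) \<le> 1" if "norm x < r" "norm \<xi> < 1" for x \<xi>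
    using that r mult_mono'[of "norm x" 1 "norm \<xi>" 1] by (simp add: norm_mult)
  have "(\<lambda>N. set_lebesgue_integral lborel ?S (\<lambda>w. F w * ?h N w) * x ^ N)
      sums (of_real ((pi * r\<^sup>2)\<^sup>2) * F (of_real (r\<^sup>2) * (x * \<xi>1), of_real (r\<^sup>2) * (x * \<xi>2)))"
    if x: "norm x < 1" for x
  proof -
    note xi = norm_mult_less_one(1)[OF x \<xi>(1)] norm_mult_less_one(1)[OF x \<xi>(2)]
    have "(\<lambda>N. set_lebesgue_integral lborel ?S (\<lambda>w. F w * (x ^ N * ?h N w)))
        sums set_lebesgue_integral lborel ?S
          (\<lambda>w. F w * (1 / (1 - cnj (fst w) * (x * \<xi>1))\<^sup>2 * (1 / (1 - cnj (snd w) * (x * \<xi>2))\<^sup>2)))"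
    proof (rule sums_set_integral_dominated(3))
      show "set_integrable lborel ?S F"
        using integrable_small_bidisc[OF r, of "\<lambda>_. 1"] by (simp add: continuous_on_const)
      show "(\<lambda>w. x ^ N * ?h N w) \<in> borel_measurable lborel" for N
        by (intro borel_measurable_times borel_measurable_const hom_part_measurable)
      show "summable (\<lambda>N. norm x ^ N * norm (hom_part N 1 1))"
        using x by (intro summable_hom_part_bound(1)) auto
      fix w assume w: "w \<in> ?S"
      then have w': "norm (fst w) < r" "norm (snd w) < r" by auto
      show "norm (x ^ N * ?h N w) \<le> norm x ^ N * norm (hom_part N 1 1)" for N
        unfolding norm_mult norm_power
        using hom_part_bound[OF small[OF w'(1) \<xi>(1)] small[OF w'(2) \<xi>(2)], of N]
        by (intro mult_left_mono) auto
      have e: "x ^ N * ?h N w = hom_part N (cnj (fst w) * (x * \<xi>1)) (cnj (snd w) * (x * \<xi>2))" for N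
        unfolding hom_part_scale[symmetric] by (simp only: mult_ac)
      have lt: "norm (cnj y * (x * \<xi>)) < 1" if "norm y < r" "norm (x * \<xi>) < 1" for y \<xi>
        using norm_mult_less_one(1)[of "cnj y" "x * \<xi>"] that r by simp
      show "(\<lambda>N. x ^ N * ?h N w) sums (1 / (1 - cnj (fst w) * (x * \<xi>1))\<^sup>2 * (1 / (1 - cnj (snd w) * (x * \<xi>2))\<^sup>2))"
        unfolding e by (intro hom_part_sums lt w' xi)
    qed
    moreover have "set_lebesgue_integral lborel ?S (\<lambda>w. F w * (x ^ N * ?h N w))
        = set_lebesgue_integral lborel ?S (\<lambda>w. F w * ?h N w) * x ^ N" for N
      by (subst set_integral_mult_left[symmetric]) (simp only: mult_ac)
    ultimately show ?thesis
      unfolding bidisc_reproducing[OF r xi] by (simp only:)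
  qed
  moreover have "(\<lambda>N. of_real (pi\<^sup>2 * (r\<^sup>2) ^ (N + 2)) * c N * x ^ N)
      sums (of_real ((pi * r\<^sup>2)\<^sup>2) * F (of_real (r\<^sup>2) * (x * \<xi>1), of_real (r\<^sup>2) * (x * \<xi>2)))"
    if x: "norm x < 1" for x
  proof -
    have "r\<^sup>2 * norm x \<le> norm x" using r by (simp add: mult_left_le_one_le power_le_one)
    then have "norm (of_real (r\<^sup>2) * x) < 1" using x by (simp add: norm_mult norm_power)
    from sums_mult[OF c[OF this], of "of_real ((pi * r\<^sup>2)\<^sup>2)"]
    have "(\<lambda>N. of_real ((pi * r\<^sup>2)\<^sup>2) * (c N * (of_real (r\<^sup>2) * x) ^ N))
      sums (of_real ((pi * r\<^sup>2)\<^sup>2) * F (of_real (r\<^sup>2) * (x * \<xi>1), of_real (r\<^sup>2) * (x * \<xi>2)))"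
      by (simp only: mult.assoc)
    moreover have "of_real ((pi * r\<^sup>2)\<^sup>2) * (c N * (of_real (r\<^sup>2) * x) ^ N)
        = of_real (pi\<^sup>2 * (r\<^sup>2) ^ (N + 2)) * c N * x ^ N" for N
      by (simp add: power_mult_distrib power_add mult_ac)
    ultimately show ?thesis by (simp only:)
  qed
  ultimately show ?thesis by (rule power_series_coefficients_unique)
qed

end

section \<open>Integration over the ball\<close>

lemma beta_integral:
  "(\<integral>t. indicator {0..1::real} t * t ^ a * (1 - t) ^ b \<partial>lborel) = fact a * fact b / fact (a + b + 1)"
proof -
  let ?f = "\<lambda>t::real. t ^ a * (1 - t) ^ b"
  have si: "set_integrable lborel {0..1} ?f"
    by (intro borel_integrable_atLeastAtMost' continuous_intros)
  have "((\<lambda>t. t powr (real (a + 1) - 1) * (1 - t) powr (real (b + 1) - 1)) has_integral Beta (real (a + 1)) (real (b + 1))) {0..1}"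
    by (rule has_integral_Beta_real) simp_all
  then have "(?f has_integral Beta (real (a + 1)) (real (b + 1))) {0..1}"
  proof (rule has_integral_spike_finite[of "{0, 1}", rotated 2])
    fix t :: real assume "t \<in> {0..1} - {0, 1}"
    then have "0 < t" "0 < 1 - t" by auto
    then show "?f t = t powr (real (a + 1) - 1) * (1 - t) powr (real (b + 1) - 1)"
      by (simp add: powr_realpow)
  qed simp
  then have "integral {0..1} ?f = Beta (real (a + 1)) (real (b + 1))" by (rule integral_unique)
  moreover have "Beta (real (a + 1)) (real (b + 1)) = fact a * fact b / fact (a + b + 1)"
    using Gamma_fact[of a, where 'a = real] Gamma_fact[of b, where 'a = real]
      Gamma_fact[of "a + b + 1", where 'a = real]
    by (simp add: Beta_def add_ac del: fact_Suc)
  moreover have "(\<integral>t. indicator {0..1::real} t * t ^ a * (1 - t) ^ b \<partial>lborel) = set_lebesgue_integral lborel {0..1} ?f"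
    unfolding set_lebesgue_integral_def by (simp add: mult.assoc)
  ultimately show ?thesis using set_borel_integral_eq_integral(2)[OF si] by simp
qed

lemma pochhammer_eq_fact_quotient: "pochhammer (real (N + 3)) n = fact (N + 2 + n) / fact (N + 2)"
proof -
  have "fact (N + 2) * pochhammer (real (N + 3)) n = fact (N + 2 + n)"
    using pochhammer_fact[of "N + 2 + n", where 'a = real] pochhammer_fact[of "N + 2", where 'a = real]
      pochhammer_product'[of "1 :: real" "N + 2" n] by (simp add: add_ac)
  then show ?thesis by (metis fact_nonzero nonzero_mult_div_cancel_left)
qed

lemma unit_ball_integral:
  "set_lebesgue_integral lborel (ball (0 :: complex ^ 'n::finite) 1) (\<lambda>z. (1 - (norm z)\<^sup>2) ^ (N + 2))
     = pi ^ CARD('n) / pochhammer (real (N + 3)) (CARD('n))"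
proof -
  obtain n where n: "CARD('n) = Suc n" using not0_implies_Suc[of "CARD('n)"] by auto
  have "set_lebesgue_integral lborel (ball (0 :: complex ^ 'n) 1) (\<lambda>z. (1 - (norm z)\<^sup>2) ^ (N + 2))
      = (\<integral>z. indicator (ball (0 :: complex ^ 'n) 1) z * (1 - (norm z)\<^sup>2) ^ (N + 2) \<partial>lborel)"
    by (simp add: set_lebesgue_integral_def)
  also have "\<dots> = (\<integral>t. indicator {0..1\<^sup>2} t * (pi ^ Suc n / fact n * t ^ n) * (1 - t) ^ (N + 2) \<partial>lborel)"
    by (rule integral_norm_square_ball) (simp_all add: n DIM_complex)
  also have "\<dots> = (\<integral>t. pi ^ Suc n / fact n * (indicator {0..1::real} t * t ^ n * (1 - t) ^ (N + 2)) \<partial>lborel)"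
    by (intro Bochner_Integration.integral_cong refl) (simp only: power_one mult_ac)
  also have "\<dots> = pi ^ Suc n / fact n * (fact n * fact (N + 2) / fact (n + (N + 2) + 1))"
    by (simp only: integral_mult_right_zero beta_integral)
  also have "n + (N + 2) + 1 = N + 2 + Suc n" by simp
  finally show ?thesis unfolding n pochhammer_eq_fact_quotient by (simp del: fact_Suc power_Suc)
qed

text \<open>
  The fibre of the domain over \<open>z\<close> is a bidisc of radius \<open>sqrt (1 - \<bar>z\<bar>\<^sup>2)\<close>. For \<open>z \<noteq> 0\<close> the radius is less than
  \<open>1\<close>, so that \<open>bidisc_coefficient\<close> applies; the fibre over \<open>0\<close> is a null set.
\<close>

lemma (in bidisc_holomorphic) D22_coefficient:
  assumes \<xi>: "norm \<xi>1 < 1" "norm \<xi>2 < 1"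
    and c: "\<And>x. norm x < 1 \<Longrightarrow> (\<lambda>N. c N * x ^ N) sums F (x * \<xi>1, x * \<xi>2)"
    and int: "set_integrable lborel (D22 :: 'n::finite cspace set)
         (\<lambda>p. F (snd p) * hom_part N (cnj (fst (snd p)) * \<xi>1) (cnj (snd (snd p)) * \<xi>2))"
  shows "set_lebesgue_integral lborel (D22 :: 'n cspace set)
         (\<lambda>p. F (snd p) * hom_part N (cnj (fst (snd p)) * \<xi>1) (cnj (snd (snd p)) * \<xi>2))
       = of_real (pi ^ (CARD('n) + 2) / pochhammer (real (N + 3)) (CARD('n))) * c N"
proof -
  define h where "h w = F w * hom_part N (cnj (fst w) * \<xi>1) (cnj (snd w) * \<xi>2)" for w
  let ?B = "ball (0 :: complex ^ 'n) 1"
  have q: "integrable (lborel \<Otimes>\<^sub>M lborel) (\<lambda>p :: 'n cspace. indicator D22 p *\<^sub>R h (snd p))"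
    using int unfolding set_integrable_def h_def lborel_prod .
  have inner: "(\<integral>w. indicator D22 (z, w) *\<^sub>R h (snd (z, w)) \<partial>lborel)
      = of_real (indicator ?B z * (1 - (norm z)\<^sup>2) ^ (N + 2)) * (of_real (pi\<^sup>2) * c N)"
    if z: "z \<noteq> 0" for z :: "complex ^ 'n"
  proof (cases "norm z < 1")
    case True
    define r where "r = sqrt (1 - (norm z)\<^sup>2)"
    have z2: "0 < (norm z)\<^sup>2" "(norm z)\<^sup>2 < 1"
      using z True by (simp_all add: power_less_one_iff)
    have r2: "r\<^sup>2 = 1 - (norm z)\<^sup>2" using z2 by (simp add: r_def)
    have r: "0 < r" "r < 1" using z2 unfolding r_def by simp_all
    have lt: "(norm z)\<^sup>2 + (cmod a)\<^sup>2 < 1 \<longleftrightarrow> cmod a < r" for a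
    proof -
      have "(norm z)\<^sup>2 + (cmod a)\<^sup>2 < 1 \<longleftrightarrow> (cmod a)\<^sup>2 < r\<^sup>2" unfolding r2 by linarith
      also have "\<dots> \<longleftrightarrow> cmod a < r" using r(1) by (metis norm_ge_zero power2_less_imp_less power_strict_mono less_imp_le zero_less_numeral)
      finally show ?thesis .
    qed
    have "(z, w) \<in> D22 \<longleftrightarrow> w \<in> ball 0 r \<times> ball 0 r" for w
      by (cases w) (simp add: D22_iff lt)
    then have "indicator D22 (z, w) = (indicator (ball 0 r \<times> ball 0 r) w :: real)" for w
      by (simp only: indicator_def)
    then have "(\<integral>w. indicator D22 (z, w) *\<^sub>R h (snd (z, w)) \<partial>lborel)
        = set_lebesgue_integral lborel (ball 0 r \<times> ball 0 r) h"
      by (simp only: set_lebesgue_integral_def snd_conv)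
    also have "\<dots> = of_real (pi\<^sup>2 * (r\<^sup>2) ^ (N + 2)) * c N"
      unfolding h_def by (rule bidisc_coefficient[OF r \<xi> c])
    finally show ?thesis using True unfolding r2 by (simp add: mult_ac)
  next
    case False
    then have "(z, w) \<notin> D22" for w using D22_bounds(1)[of z] by (cases w) auto
    then show ?thesis using False by simp
  qed
  have "set_lebesgue_integral lborel (D22 :: 'n cspace set) (\<lambda>p. h (snd p))
      = (\<integral>p. indicator D22 p *\<^sub>R h (snd p) \<partial>((lborel :: (complex ^ 'n) measure) \<Otimes>\<^sub>M lborel))"
    unfolding set_lebesgue_integral_def lborel_prod ..
  also have "\<dots> = (\<integral>z. (\<integral>w. indicator D22 (z, w) *\<^sub>R h (snd (z, w)) \<partial>lborel) \<partial>(lborel :: (complex ^ 'n) measure))"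
    using lborel_pair.integral_fst'[OF q] by simp
  also have "\<dots> = (\<integral>z. of_real (indicator ?B z * (1 - (norm z)\<^sup>2) ^ (N + 2)) * (of_real (pi\<^sup>2) * c N) \<partial>lborel)"
  proof (rule integral_cong_AE)
    show "(\<lambda>z. \<integral>w. indicator D22 (z, w) *\<^sub>R h (snd (z, w)) \<partial>lborel) \<in> borel_measurable (lborel :: (complex ^ 'n) measure)"
      using borel_measurable_integrable[OF lborel_pair.integrable_fst'[OF q]] .
    have "(\<lambda>z :: complex ^ 'n. indicator ?B z *\<^sub>R (1 - (norm z)\<^sup>2) ^ (N + 2)) \<in> borel_measurable borel"
      by (intro borel_measurable_continuous_on_indicator continuous_intros) simp
    then have meas: "(\<lambda>z :: complex ^ 'n. indicator ?B z * (1 - (norm z)\<^sup>2) ^ (N + 2)) \<in> borel_measurable lborel"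
      by (simp only: real_scaleR_def measurable_lborel2)
    show "(\<lambda>z. of_real (indicator ?B z * (1 - (norm z)\<^sup>2) ^ (N + 2)) * (of_real (pi\<^sup>2) * c N)) \<in> borel_measurable lborel"
      by (rule borel_measurable_times[OF measurable_compose[OF meas borel_measurable_of_real] borel_measurable_const])
    show "AE z in (lborel :: (complex ^ 'n) measure). (\<integral>w. indicator D22 (z, w) *\<^sub>R h (snd (z, w)) \<partial>lborel)
        = of_real (indicator ?B z * (1 - (norm z)\<^sup>2) ^ (N + 2)) * (of_real (pi\<^sup>2) * c N)"
      using AE_lborel_singleton[of "0 :: complex ^ 'n"] by eventually_elim (rule inner)
  qed
  also have "\<dots> = of_real (set_lebesgue_integral lborel ?B (\<lambda>z. (1 - (norm z)\<^sup>2) ^ (N + 2))) * (of_real (pi\<^sup>2) * c N)"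
    unfolding set_lebesgue_integral_def real_scaleR_def integral_complex_of_real[symmetric]
    by (rule integral_mult_left_zero)
  also have "\<dots> = of_real (pi ^ (CARD('n) + 2) / pochhammer (real (N + 3)) (CARD('n))) * c N"
    unfolding unit_ball_integral by (simp add: power_add power2_eq_square mult_ac)
  finally show ?thesis unfolding h_def .
qed

section \<open>The reproducing kernel\<close>

text \<open>
  The closed form of \<open>\<pi>\<^bsup>-(n+2)\<^esup> \<Sum>\<^sub>N (N + 3)\<^sub>n h\<^sub>N\<close> with \<open>n = CARD('n)\<close>, as a function of the first argument of the
  kernel.
\<close>

definition kernel_section :: "complex \<Rightarrow> complex \<Rightarrow> 'n::finite cspace \<Rightarrow> complex" where
  "kernel_section \<xi>1 \<xi>2 p = fact (CARD('n)) / of_real pi ^ (CARD('n) + 2) *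
     (gegen (CARD('n)) (1 - fst (snd p) * cnj \<xi>1) (1 - snd (snd p) * cnj \<xi>2)
      - gegen (CARD('n) - 1) (1 - fst (snd p) * cnj \<xi>1) (1 - snd (snd p) * cnj \<xi>2))"

lemma kernel_section_sums:
  fixes p :: "'n::finite cspace"
  assumes p: "p \<in> D22" and \<xi>: "norm \<xi>1 < 1" "norm \<xi>2 < 1"
  shows "(\<lambda>N. of_real (pochhammer (real (N + 3)) (CARD('n)) / pi ^ (CARD('n) + 2)) *
      hom_part N (fst (snd p) * cnj \<xi>1) (snd (snd p) * cnj \<xi>2)) sums kernel_section \<xi>1 \<xi>2 p"
proof -
  have lt: "norm (fst (snd p) * cnj \<xi>1) < 1" "norm (snd (snd p) * cnj \<xi>2) < 1"
    using D22_coordinates[OF p] \<xi> by (simp_all add: norm_mult_less_one)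
  have "CARD('n) \<ge> 1" using zero_less_card_finite[where 'a = 'n] by linarith
  note sums_mult[OF gegen_diff_sums[OF lt this], of "1 / of_real pi ^ (CARD('n) + 2)"]
  moreover have "complex_of_real (pochhammer (real (N + 3)) (CARD('n))) = pochhammer (of_nat (N + 3)) (CARD('n))" for N
    by (simp only: pochhammer_of_real[symmetric] of_real_of_nat_eq)
  ultimately show ?thesis by (simp add: kernel_section_def)
qed

lemma holomorphic_sv_gegen:
  assumes "holomorphic_sv u D" "\<And>p. p \<in> D \<Longrightarrow> u p \<noteq> 0"
    and "holomorphic_sv v D" "\<And>p. p \<in> D \<Longrightarrow> v p \<noteq> 0"
  shows "holomorphic_sv (\<lambda>p. gegen n (u p) (v p)) D"
  unfolding gegen_def divide_inverse
  by (intro holomorphic_sv_sum holomorphic_sv_mult holomorphic_sv_const holomorphic_sv_inverse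
      holomorphic_sv_power assms) (simp_all add: assms)

lemma holomorphic_sv_diff:
  assumes "holomorphic_sv f D" "holomorphic_sv g D"
  shows "holomorphic_sv (\<lambda>p. f p - g p) D"
  using holomorphic_sv_add[OF assms(1) holomorphic_sv_mult[OF holomorphic_sv_const assms(2)], of "-1"]
  by simp

text \<open>
  Boundedness comes from the majorant of the power series, with \<open>\<rho> = max \<bar>\<xi>1\<bar> \<bar>\<xi>2\<bar>\<close>.
\<close>

lemma kernel_section_L2a:
  assumes \<xi>: "norm \<xi>1 < 1" "norm \<xi>2 < 1"
  shows "kernel_section \<xi>1 \<xi>2 \<in> L2a (D22 :: 'n::finite cspace set)"
proof -
  define \<rho> where "\<rho> = max (norm \<xi>1) (norm \<xi>2)"
  have \<rho>: "0 \<le> \<rho>" "\<rho> < 1" using \<xi> by (auto simp: \<rho>_def le_max_iff_disj)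
  have "CARD('n) \<ge> 1" using zero_less_card_finite[where 'a = 'n] by linarith
  then obtain B where B: "summable B" "\<And>N u v. norm u \<le> \<rho> \<Longrightarrow> norm v \<le> \<rho> \<Longrightarrow>
     norm (of_real (pochhammer (real (N + 3)) (CARD('n)) / pi ^ (CARD('n) + 2)) * hom_part N u v) \<le> B N"
    using kernel_series_majorant[OF \<rho>] by blast
  show ?thesis
  proof (rule L2a_bounded[OF open_D22 emeasure_D22_finite])
    have nz: "1 - fst (snd p) * cnj \<xi>1 \<noteq> 0" "1 - snd (snd p) * cnj \<xi>2 \<noteq> 0" if "p \<in> D22" for p :: "'n cspace"
      using D22_coordinates[OF that] \<xi> by (simp_all add: norm_mult_less_one(2) del: right_minus_eq)
    show "holomorphic_sv (kernel_section \<xi>1 \<xi>2) (D22 :: 'n cspace set)"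
      unfolding kernel_section_def[abs_def]
      by (intro holomorphic_sv_mult holomorphic_sv_const holomorphic_sv_diff holomorphic_sv_gegen
          holomorphic_sv_w1 holomorphic_sv_w2 nz)
    fix p :: "'n cspace" assume p: "p \<in> D22"
    have le: "norm (fst (snd p) * cnj \<xi>1) \<le> \<rho>" "norm (snd (snd p) * cnj \<xi>2) \<le> \<rho>"
      using mult_left_le_one_le[of "norm \<xi>1" "norm (fst (snd p))"]
        mult_left_le_one_le[of "norm \<xi>2" "norm (snd (snd p))"] D22_coordinates[OF p]
      by (simp_all add: norm_mult \<rho>_def le_max_iff_disj)
    show "norm (kernel_section \<xi>1 \<xi>2 p) \<le> suminf B"
      unfolding sums_unique[OF kernel_section_sums[OF p \<xi>]]
      by (rule norm_suminf_le[OF B(2)[OF le] B(1)])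
  qed
qed

text \<open>
  After averaging, the conjugate of the kernel series is integrated termwise against \<open>F\<close>. The term of degree
  \<open>N\<close> gives exactly the Taylor coefficient \<open>c N\<close> of \<open>F\<close> on the line through \<open>(\<xi>1, \<xi>2)\<close>, and the sum of these is
  \<open>F (\<xi>1, \<xi>2)\<close>.
\<close>

theorem kernel_section_reproducing:
  fixes f :: "'n::finite cspace \<Rightarrow> complex"
  assumes f: "f \<in> L2a D22" and \<xi>: "norm \<xi>1 < 1" "norm \<xi>2 < 1"
  shows "L2_inner D22 f (kernel_section \<xi>1 \<xi>2) = f (0, \<xi>1, \<xi>2)"
proof -
  have hol: "holomorphic_sv f D22" using f by (simp add: L2a_def)
  define F where "F w = f (0, w)" for w
  have bidisc: "(0, w) \<in> (D22 :: 'n cspace set) \<longleftrightarrow> w \<in> ball 0 1 \<times> ball 0 1" for w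
    by (cases w) (simp add: D22_zero_section)
  interpret bidisc_holomorphic F
  proof
    show "continuous_on (ball 0 1 \<times> ball 0 1) F"
      unfolding F_def
    proof (rule continuous_on_compose2[OF holomorphic_sv_continuous[OF hol]])
      show "continuous_on (ball 0 1 \<times> ball 0 1) (\<lambda>w. (0 :: complex ^ 'n, w :: complex \<times> complex))"
        by (intro continuous_intros)
    qed (auto simp: D22_zero_section)
    show "(\<lambda>x. F (x, y)) holomorphic_on ball 0 1" if "norm y < 1" for y
      using holomorphic_on_subset[OF holomorphic_sv_slice[OF hol, of "(0, 0, y)" "(0, 1, 0)"], of "ball 0 1"] that
      by (simp add: F_def D22_zero_section subset_iff)
    show "(\<lambda>y. F (x, y)) holomorphic_on ball 0 1" if "norm x < 1" for x
      using holomorphic_on_subset[OF holomorphic_sv_slice[OF hol, of "(0, x, 0)" "(0, 0, 1)"], of "ball 0 1"] that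
      by (simp add: F_def D22_zero_section subset_iff)
  qed
  define \<rho> where "\<rho> = max (norm \<xi>1) (norm \<xi>2)"
  have \<rho>: "0 \<le> \<rho>" "\<rho> < 1" "norm \<xi>1 \<le> \<rho>" "norm \<xi>2 \<le> \<rho>" using \<xi> by (auto simp: \<rho>_def le_max_iff_disj)
  \<comment> \<open>The line through \<open>(\<xi>1, \<xi>2)\<close> stays in the bidisc up to a radius \<open>R > 1\<close>, so the Taylor series along it
      may be evaluated at \<open>1\<close>.\<close>
  define R where "R = 2 / (1 + \<rho>)"
  have R: "1 < R" "R * \<rho> < 1" using \<rho>(1,2) by (simp_all add: R_def field_simps)
  have "(\<lambda>x. F (x * \<xi>1, x * \<xi>2)) holomorphic_on ball 0 R"
  proof -
    have "ball 0 R \<subseteq> {c. (0, 0, 0) + cscale c (0, \<xi>1, \<xi>2) \<in> (D22 :: 'n cspace set)}"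
    proof
      fix c :: complex assume "c \<in> ball 0 R"
      then have c: "norm c \<le> R" by simp
      have "norm c * norm \<xi>1 \<le> R * \<rho>" "norm c * norm \<xi>2 \<le> R * \<rho>"
        using c \<rho> R by (intro mult_mono; simp)+
      then show "c \<in> {c. (0, 0, 0) + cscale c (0, \<xi>1, \<xi>2) \<in> (D22 :: 'n cspace set)}"
        using R(2) by (simp add: D22_zero_section norm_mult)
    qed
    from holomorphic_on_subset[OF holomorphic_sv_slice[OF hol, of "(0, 0, 0)" "(0, \<xi>1, \<xi>2)"] this]
    show ?thesis by (simp add: F_def)
  qed
  then obtain c where c: "\<And>x. norm x < R \<Longrightarrow> (\<lambda>N. c N * x ^ N) sums F (x * \<xi>1, x * \<xi>2)"
    using taylor_coefficients by blast
  have k: "kernel_section \<xi>1 \<xi>2 \<in> L2a (D22 :: 'n cspace set)" by (rule kernel_section_L2a[OF \<xi>])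
  have k_snd: "kernel_section \<xi>1 \<xi>2 (p :: 'n cspace) = kernel_section \<xi>1 \<xi>2 (0 :: complex ^ 'n, snd p)" for p
    by (simp add: kernel_section_def)
  have kc: "continuous_on (D22 :: 'n cspace set) (kernel_section \<xi>1 \<xi>2)"
    using k by (auto simp: L2a_def intro: holomorphic_sv_continuous)
  have fk: "set_integrable lborel D22 (\<lambda>p. f p * cnj (kernel_section \<xi>1 \<xi>2 p))"
    by (rule L2a_product_integrable[OF open_D22 f k])
  have mean: "L2_inner D22 f (kernel_section \<xi>1 \<xi>2)
      = set_lebesgue_integral lborel (D22 :: 'n cspace set) (\<lambda>p. F (snd p) * cnj (kernel_section \<xi>1 \<xi>2 p))"
  proof -
    have "continuous_on (D22 :: 'n cspace set) (\<lambda>p. cnj (kernel_section \<xi>1 \<xi>2 (0 :: complex ^ 'n, snd p)))"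
      using continuous_on_cnj[OF kc] unfolding k_snd[symmetric] .
    from D22_integral_mean(2)[OF hol this] fk
    show ?thesis unfolding L2_inner_def F_def k_snd[symmetric] by simp
  qed
  have one: "(\<lambda>_. 1) \<in> L2a (D22 :: 'n cspace set)"
    by (rule L2a_bounded[OF open_D22 emeasure_D22_finite holomorphic_sv_const, of _ 1]) simp
  have Fint: "set_integrable lborel (D22 :: 'n cspace set) (\<lambda>p. F (snd p))"
    using D22_integral_mean(1)[OF hol, of "\<lambda>_. 1"] L2a_product_integrable[OF open_D22 f one]
    by (simp add: F_def continuous_on_const)
  let ?C = "\<lambda>N. of_real (pochhammer (real (N + 3)) (CARD('n)) / pi ^ (CARD('n) + 2)) :: complex"
  let ?h = "\<lambda>N p. hom_part N (cnj (fst (snd p)) * \<xi>1) (cnj (snd (snd p)) * \<xi>2)"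
  have "CARD('n) \<ge> 1" using zero_less_card_finite[where 'a = 'n] by linarith
  then obtain B where B: "summable B" "\<And>N u v. norm u \<le> \<rho> \<Longrightarrow> norm v \<le> \<rho> \<Longrightarrow> norm (?C N * hom_part N u v) \<le> B N"
    using kernel_series_majorant[OF \<rho>(1,2)] by blast
  have hm: "?h N \<in> borel_measurable (lborel :: 'n cspace measure)" for N
    unfolding hom_part_def by (intro continuous_imp_lborel_measurable continuous_intros)
  have bound: "norm (?C N * ?h N p) \<le> B N" if "p \<in> D22" for N and p :: "'n cspace"
  proof (rule B(2))
    show "norm (cnj (fst (snd p)) * \<xi>1) \<le> \<rho>" "norm (cnj (snd (snd p)) * \<xi>2) \<le> \<rho>"
      using mult_left_le_one_le[of "norm \<xi>1" "norm (fst (snd p))"]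
        mult_left_le_one_le[of "norm \<xi>2" "norm (snd (snd p))"] D22_coordinates[OF that]
      by (simp_all add: norm_mult \<rho>_def le_max_iff_disj)
  qed
  have ksum: "(\<lambda>N. ?C N * ?h N p) sums cnj (kernel_section \<xi>1 \<xi>2 p)" if p: "p \<in> D22" for p :: "'n cspace"
  proof -
    have "cnj (hom_part N u v) = hom_part N (cnj u) (cnj v)" for N u v
      by (simp add: hom_part_def)
    then show ?thesis
      using sums_cnj[THEN iffD2, OF kernel_section_sums[OF p \<xi>]] by simp
  qed
  note dom = sums_set_integral_dominated[of D22 "\<lambda>p :: 'n cspace. F (snd p)" "\<lambda>N p. ?C N * ?h N p" B
      "\<lambda>p. cnj (kernel_section \<xi>1 \<xi>2 p)", OF Fint borel_measurable_times[OF borel_measurable_const hm] bound B(1) ksum]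
  have "set_lebesgue_integral lborel (D22 :: 'n cspace set) (\<lambda>p. F (snd p) * (?C N * ?h N p)) = c N" for N
  proof -
    have pos: "pochhammer (real (N + 3)) (CARD('n)) > 0" by (intro pochhammer_pos) simp
    have eq: "F (snd p) * (?C N * ?h N p) = ?C N * (F (snd p) * ?h N p)" for p :: "'n cspace"
      by (simp only: mult.left_commute)
    have "set_integrable lborel (D22 :: 'n cspace set) (\<lambda>p. ?C N * (F (snd p) * ?h N p))"
      using dom(2)[of N] unfolding eq .
    then have "set_integrable lborel (D22 :: 'n cspace set) (\<lambda>p. F (snd p) * ?h N p)"
      using pos by (subst (asm) set_integrable_mult_right_iff) auto
    then have "set_lebesgue_integral lborel (D22 :: 'n cspace set) (\<lambda>p. F (snd p) * ?h N p)
        = of_real (pi ^ (CARD('n) + 2) / pochhammer (real (N + 3)) (CARD('n))) * c N"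
      using R(1) by (intro D22_coefficient[OF \<xi>] c) auto
    then have "set_lebesgue_integral lborel (D22 :: 'n cspace set) (\<lambda>p. F (snd p) * (?C N * ?h N p))
        = ?C N * (of_real (pi ^ (CARD('n) + 2) / pochhammer (real (N + 3)) (CARD('n))) * c N)"
      unfolding eq by (simp only: set_integral_mult_right)
    also have "\<dots> = of_real (pochhammer (real (N + 3)) (CARD('n)) / pi ^ (CARD('n) + 2) *
        (pi ^ (CARD('n) + 2) / pochhammer (real (N + 3)) (CARD('n)))) * c N"
      by (simp only: of_real_mult mult.assoc)
    also have "\<dots> = c N" using pos by simp
    finally show ?thesis .
  qed
  then have "c sums L2_inner D22 f (kernel_section \<xi>1 \<xi>2)"
    using dom(3) unfolding mean by simp
  moreover have "c sums F (\<xi>1, \<xi>2)" using c[of 1] R(1) by simp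
  ultimately show ?thesis unfolding F_def by (rule sums_unique2)
qed

section \<open>Evaluation of the Bergman kernel\<close>

lemma L2a_w1_power: "(\<lambda>p. fst (snd p) ^ k) \<in> L2a (D22 :: 'n::finite cspace set)"
proof (rule L2a_bounded[OF open_D22 emeasure_D22_finite holomorphic_sv_power[OF holomorphic_sv_w1]])
  fix p :: "'n cspace" assume "p \<in> D22"
  then have "norm (fst (snd p)) \<le> 1" using D22_coordinates(1) by fastforce
  then show "norm (fst (snd p) ^ k) \<le> 1" by (simp add: norm_power power_le_one)
qed

text \<open>
  As for \<open>disc_moment\<close>, a rotation of \<open>w1\<close> changes the sign of the integrand.
\<close>

lemma L2_inner_w1_power_orthogonal:
  assumes "i \<noteq> j"
  shows "L2_inner (D22 :: 'n::finite cspace set) (\<lambda>p. fst (snd p) ^ i) (\<lambda>p. fst (snd p) ^ j) = 0"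
proof -
  define \<theta> where "\<theta> = pi / (real i - real j)"
  define c where "c = cis \<theta>"
  define T where "T p = (fst p, c * fst (snd p), snd (snd p))" for p :: "'n cspace"
  define g where "g p = indicator D22 p *\<^sub>R (fst (snd p) ^ i * cnj (fst (snd p) ^ j))" for p :: "'n cspace"
  have nc: "norm c = 1" by (simp add: c_def)
  have c: "c ^ i * cnj c ^ j = -1"
  proof -
    have "c ^ i * cnj c ^ j = cis (real i * \<theta> + real j * - \<theta>)"
      by (simp only: c_def cis_cnj Complex.DeMoivre cis_mult)
    also have "real i * \<theta> + real j * - \<theta> = (real i - real j) * \<theta>" by (simp add: algebra_simps)
    also have "\<dots> = pi" using assms by (simp add: \<theta>_def)
    finally show ?thesis by simp
  qed
  have orth: "orthogonal_transformation T"
    unfolding orthogonal_transformation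
  proof
    show "linear T" by (rule linearI) (simp_all add: T_def algebra_simps)
    show "\<forall>v. norm (T v) = norm v" by (simp add: T_def norm_prod_def norm_mult nc)
  qed
  have meas: "g \<in> borel_measurable borel"
    unfolding g_def
    by (intro borel_measurable_continuous_on_indicator continuous_intros) (simp add: open_D22 borel_open)
  have "g (T p) = - g p" for p
  proof -
    have "T p \<in> D22 \<longleftrightarrow> p \<in> D22" by (cases p) (simp add: T_def D22_iff norm_mult nc)
    moreover have "(c * w) ^ i * cnj ((c * w) ^ j) = (c ^ i * cnj c ^ j) * (w ^ i * cnj (w ^ j))" for w
      by (simp only: complex_cnj_mult complex_cnj_power power_mult_distrib mult_ac)
    ultimately show ?thesis by (simp add: g_def indicator_def T_def c)
  qed
  then have "(\<integral>p. g p \<partial>lborel) = - (\<integral>p. g p \<partial>lborel)"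
    using integral_orthogonal(1)[OF orth meas] by (simp only: integral_minus)
  then have "(\<integral>p. g p \<partial>lborel) = 0" by simp
  then show ?thesis by (simp add: L2_inner_def set_lebesgue_integral_def g_def)
qed

text \<open>
  Infinite dimension is witnessed by the powers of \<open>w1\<close>. They have positive norm by the Cauchy--Schwarz
  inequality against a reproducing function at a point where they do not vanish.
\<close>

theorem bergman_kernel_D22:
  assumes w: "norm w1 < 1" "norm w2 < 1" and \<xi>: "norm \<xi>1 < 1" "norm \<xi>2 < 1"
  shows "bergman_kernel (D22 :: 'n::finite cspace set) (0, w1, w2) (0, \<xi>1, \<xi>2)
       = kernel_section \<xi>1 \<xi>2 ((0, w1, w2) :: 'n cspace)"
proof -
  let ?D = "D22 :: 'n cspace set"
  interpret semi_inner_space "L2a ?D" "L2_inner ?D" by (rule L2a_semi_inner_space[OF open_D22])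
  have kw: "kernel_section w1 w2 \<in> L2a ?D" and k\<xi>: "kernel_section \<xi>1 \<xi>2 \<in> L2a ?D"
    using w \<xi> by (simp_all add: kernel_section_L2a)
  have sums: "(\<lambda>j. \<Phi> j (0, w1, w2) * cnj (\<Phi> j (0, \<xi>1, \<xi>2))) sums kernel_section \<xi>1 \<xi>2 ((0, w1, w2) :: 'n cspace)"
    if \<Phi>: "complete_orthonormal_basis ?D \<Phi>" for \<Phi>
  proof -
    have on: "orthonormal \<Phi> UNIV" and co: "complete_seq \<Phi>"
      using \<Phi> unfolding complete_orthonormal_basis_iff[OF open_D22] by auto
    have mem: "\<Phi> j \<in> L2a ?D" for j using on by (simp add: orthonormal_def)
    have "(\<lambda>j. L2_inner ?D (kernel_section \<xi>1 \<xi>2) (\<Phi> j) * L2_inner ?D (\<Phi> j) (kernel_section w1 w2))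
        sums L2_inner ?D (kernel_section \<xi>1 \<xi>2) (kernel_section w1 w2)"
      by (rule parseval_sums[OF on co k\<xi> kw])
    moreover have "L2_inner ?D (kernel_section \<xi>1 \<xi>2) (\<Phi> j) = cnj (\<Phi> j (0, \<xi>1, \<xi>2))" for j
      using ip_cnj[OF mem[of j] k\<xi>] kernel_section_reproducing[OF mem[of j] \<xi>] by simp
    ultimately show ?thesis
      unfolding kernel_section_reproducing[OF mem w] kernel_section_reproducing[OF k\<xi> w]
      by (simp add: mult.commute)
  qed
  have "\<exists>\<Phi>. complete_orthonormal_basis ?D \<Phi>"
  proof (rule complete_orthonormal_basis_exists[OF open_D22 emeasure_D22_finite L2a_w1_power])
    fix k :: nat
    let ?u = "\<lambda>p :: 'n cspace. fst (snd p) ^ k"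
    have kh: "kernel_section (1/2) 0 \<in> L2a ?D" by (rule kernel_section_L2a) simp_all
    have "(1 / 2 :: complex) ^ k = L2_inner ?D ?u (kernel_section (1/2) 0)"
      by (subst kernel_section_reproducing[OF L2a_w1_power]) simp_all
    then have "0 < norm (L2_inner ?D ?u (kernel_section (1/2) 0))"
      by (metis norm_divide norm_one norm_power zero_less_norm_iff power_not_zero zero_neq_numeral divide_eq_0_iff zero_neq_one)
    also have "\<dots> \<le> nrm ?u * nrm (kernel_section (1/2) 0)"
      by (rule cauchy_schwarz[OF L2a_w1_power kh])
    finally have "nrm ?u \<noteq> 0" by auto
    then show "L2_inner ?D ?u ?u \<noteq> 0" by (auto simp: nrm_def)
  qed (rule L2_inner_w1_power_orthogonal)
  then obtain \<Phi>0 where \<Phi>0: "complete_orthonormal_basis ?D \<Phi>0" ..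
  show ?thesis
    unfolding bergman_kernel_def
  proof (rule the_equality)
    show "\<forall>\<Phi>. complete_orthonormal_basis ?D \<Phi> \<longrightarrow>
        (\<lambda>j. \<Phi> j (0, w1, w2) * cnj (\<Phi> j (0, \<xi>1, \<xi>2))) sums kernel_section \<xi>1 \<xi>2 ((0, w1, w2) :: 'n cspace)"
      using sums by blast
    fix k assume "\<forall>\<Phi>. complete_orthonormal_basis ?D \<Phi> \<longrightarrow>
        (\<lambda>j. \<Phi> j (0, w1, w2) * cnj (\<Phi> j (0, \<xi>1, \<xi>2))) sums k"
    then show "k = kernel_section \<xi>1 \<xi>2 ((0, w1, w2) :: 'n cspace)"
      using sums[OF \<Phi>0] \<Phi>0 sums_unique2 by blast
  qed
qed

text \<open>
  Clearing denominators uses \<open>(2 - \<nu>1 - \<nu>2)\<^sup>2 - (\<nu>1 - \<nu>2)\<^sup>2 = 4 (1 - \<nu>1) (1 - \<nu>2)\<close>.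
\<close>

lemma jacobi_argument:
  fixes \<nu>1 \<nu>2 :: complex
  assumes \<nu>: "norm \<nu>1 < 1" "norm \<nu>2 < 1" and x': "x' = ((\<nu>1 - \<nu>2) / (2 - \<nu>1 - \<nu>2))\<^sup>2"
  shows "(1 - (x' + 1) / (1 - x')) / 2 = - (((1 - \<nu>1) - (1 - \<nu>2)) / 2)\<^sup>2 / ((1 - \<nu>1) * (1 - \<nu>2))"
proof -
  define S where "S = 2 - \<nu>1 - \<nu>2"
  define P where "P = (1 - \<nu>1) * (1 - \<nu>2)"
  define d where "d = (\<nu>1 - \<nu>2)\<^sup>2"
  have Re: "Re \<nu>1 < 1" "Re \<nu>2 < 1"
    using \<nu> complex_Re_le_cmod[of \<nu>1] complex_Re_le_cmod[of \<nu>2] by linarith+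
  have "Re S > 0" using Re by (simp add: S_def)
  then have S: "S\<^sup>2 \<noteq> 0" by auto
  have P: "P \<noteq> 0" using \<nu> by (auto simp: P_def)
  have SP: "S\<^sup>2 - d = 4 * P" by (simp add: S_def P_def d_def power2_eq_square algebra_simps)
  have xd: "x' = d / S\<^sup>2" by (simp add: x' S_def d_def power_divide)
  have x1: "1 - x' = 4 * P / S\<^sup>2" unfolding xd SP[symmetric] using S by (simp add: diff_divide_distrib)
  have x1n: "1 - x' \<noteq> 0" unfolding x1 using S P by simp
  have "(1 - (x' + 1) / (1 - x')) / 2 = - (x' / (1 - x'))" using x1n by (simp add: field_simps)
  also have "x' / (1 - x') = (d / S\<^sup>2) / (4 * P / S\<^sup>2)" unfolding x1 by (subst xd) (rule refl)
  also have "\<dots> = d / (4 * P)" using S by simp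
  also have "d / (4 * P) = (((1 - \<nu>1) - (1 - \<nu>2)) / 2)\<^sup>2 / P"
    by (simp add: d_def power_divide power2_commute)
  finally show ?thesis by (simp add: P_def)
qed

lemma Gamma_nat_offset:
  "Gamma (3 + of_nat n :: complex) = fact (n + 2)"
  "Gamma (4 + 2 * of_nat m :: complex) = fact (2 * m + 3)"
  "Gamma (3 + 2 * of_nat m :: complex) = fact (2 * m + 2)"
  using Gamma_fact[of "n + 2", where 'a = complex] Gamma_fact[of "2 * m + 3", where 'a = complex]
    Gamma_fact[of "2 * m + 2", where 'a = complex] by (simp_all add: add_ac del: fact_Suc)

theorem theorem3p1:
  fixes w1 w2 \<xi>1 \<xi>2 \<nu>1 \<nu>2 x' K :: complex and n :: nat
  assumes "cmod w1 < 1" and "cmod w2 < 1" and "cmod \<xi>1 < 1" and "cmod \<xi>2 < 1"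
    and "\<nu>1 = w1 * cnj \<xi>1" and "\<nu>2 = w2 * cnj \<xi>2"
    and "x' = ((\<nu>1 - \<nu>2) / (2 - \<nu>1 - \<nu>2))\<^sup>2"
    and "n = CARD('n::finite)"
    and "K = bergman_kernel (D22 :: 'n cspace set) (0, w1, w2) (0, \<xi>1, \<xi>2)"
  shows
    "K = Gamma (3 + of_nat n) / (2 * of_real pi ^ (n + 2)) *
         (\<Sum>i=0..n. \<Sum>k=0..n-i. of_nat (n choose i) * of_nat ((n - i) choose k) *
            (pochhammer 2 i * pochhammer 2 k * \<nu>1 ^ i * \<nu>2 ^ k /
             (pochhammer 3 (i + k) * (1 - \<nu>1) ^ (2 + i) * (1 - \<nu>2) ^ (2 + k))))
     \<and>
     (\<forall>m::nat. n = 2 * m + 1 \<longrightarrow>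
       (let C = Gamma (4 + 2 * of_nat m) * fact m / (6 * pochhammer (5/2) m) in
        K = C * (2 + of_nat m) * (2 - \<nu>1 - \<nu>2) * jacobi_P m (3/2) (1/2) ((x' + 1) / (1 - x')) /
              (of_real pi ^ (2 * m + 3) * (1 - \<nu>1 - \<nu>2 + \<nu>1 * \<nu>2) ^ (m + 3))
          - C * (2 * of_nat m + 1) * jacobi_P m (3/2) (-1/2) ((x' + 1) / (1 - x')) /
              (of_real pi ^ (2 * m + 3) * (1 - \<nu>1 - \<nu>2 + \<nu>1 * \<nu>2) ^ (m + 2))))
     \<and>
     (\<forall>m::nat. m \<ge> 1 \<and> n = 2 * m \<longrightarrow>
        K = Gamma (3 + 2 * of_nat m) * fact m *
            ((2 * jacobi_P m (3/2) (-1/2) ((x' + 1) / (1 - x'))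
              - (2 - \<nu>1 - \<nu>2) * jacobi_P (m - 1) (3/2) (1/2) ((x' + 1) / (1 - x'))) /
             (6 * of_real pi ^ (2 * m + 2) * pochhammer (5/2) (m - 1) *
              (1 - \<nu>1 - \<nu>2 + \<nu>1 * \<nu>2) ^ (m + 2))))
     \<and>
     (w1 * cnj \<xi>1 = w2 * cnj \<xi>2 \<longrightarrow>
        K = Gamma (3 + of_nat n) * (3 + of_nat n * (w1 * cnj \<xi>1)) /
            (6 * of_real pi ^ (n + 2) * (1 - w1 * cnj \<xi>1) ^ (4 + n)))"
proof -
  have n1: "n \<ge> 1" using zero_less_card_finite[where 'a = 'n] assms(8) by linarith
  have \<nu>: "norm \<nu>1 < 1" "norm \<nu>2 < 1"
    using assms(1-6) by (simp_all add: norm_mult_less_one)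
  define x where "x = 1 - \<nu>1"
  define y where "y = 1 - \<nu>2"
  have nz: "x \<noteq> 0" "y \<noteq> 0" using \<nu> by (auto simp: x_def y_def)
  have S: "2 - \<nu>1 - \<nu>2 = x + y" and P: "1 - \<nu>1 - \<nu>2 + \<nu>1 * \<nu>2 = x * y"
    by (simp_all add: x_def y_def algebra_simps)
  have K: "K = fact n / of_real pi ^ (n + 2) * (gegen n x y - gegen (n - 1) x y)"
    unfolding assms(9) bergman_kernel_D22[OF assms(1-4)] kernel_section_def x_def y_def assms(5,6,8) by simp
  define t where "t = ((x - y) / 2)\<^sup>2 / (x * y)"
  have z: "(1 - (x' + 1) / (1 - x')) / 2 = - t"
    using jacobi_argument[OF \<nu> assms(7)] by (simp add: t_def x_def y_def)
  note even = gegen_quadratic(1)[OF nz, folded t_def] and odd = gegen_quadratic(2)[OF nz, folded t_def]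
  note JE = jacobi_P_even[OF z] and JO = jacobi_P_odd[OF z]
  have "K = Gamma (3 + of_nat n) / (2 * of_real pi ^ (n + 2)) *
         (\<Sum>i=0..n. \<Sum>k=0..n-i. of_nat (n choose i) * of_nat ((n - i) choose k) *
            (pochhammer 2 i * pochhammer 2 k * \<nu>1 ^ i * \<nu>2 ^ k /
             (pochhammer 3 (i + k) * (1 - \<nu>1) ^ (2 + i) * (1 - \<nu>2) ^ (2 + k))))"
    (is "K = _ * ?sum")
  proof -
    have "fact (n + 2) / 2 * ?sum = fact n * (gegen n x y - gegen (n - 1) x y)"
      unfolding x_def y_def by (rule double_sum_eq_gegen[OF \<nu> n1])
    moreover have "Gamma (3 + of_nat n) / (2 * of_real pi ^ (n + 2)) * ?sum
        = (fact (n + 2) / 2 * ?sum) / of_real pi ^ (n + 2)"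
      unfolding Gamma_nat_offset(1) by (simp only: times_divide_eq_left times_divide_eq_right divide_divide_eq_left)
    ultimately show ?thesis unfolding K by (simp only: times_divide_eq_left)
  qed
  moreover have "let C = Gamma (4 + 2 * of_nat m) * fact m / (6 * pochhammer (5/2) m) in
        K = C * (2 + of_nat m) * (2 - \<nu>1 - \<nu>2) * jacobi_P m (3/2) (1/2) ((x' + 1) / (1 - x')) /
              (of_real pi ^ (2 * m + 3) * (1 - \<nu>1 - \<nu>2 + \<nu>1 * \<nu>2) ^ (m + 3))
          - C * (2 * of_nat m + 1) * jacobi_P m (3/2) (-1/2) ((x' + 1) / (1 - x')) /
              (of_real pi ^ (2 * m + 3) * (1 - \<nu>1 - \<nu>2 + \<nu>1 * \<nu>2) ^ (m + 2))"
    if m: "n = 2 * m + 1" for m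
  proof -
    define C :: complex where "C = fact (2 * m + 3) * fact m / (6 * pochhammer (5/2) m)"
    have Cp: "C * (pochhammer (5/2) m / fact m) = fact (2 * m + 3) / 6"
      unfolding C_def using pochhammer_five_halves_nonzero[of m] by simp
    have f: "fact (2 * m + 3) = (of_nat ((2 * m + 3) * (2 * m + 2)) * fact (2 * m + 1) :: complex)"
      by (simp add: numeral_eq_Suc algebra_simps)
    have c1: "fact (2 * m + 1) * (of_nat ((2 * m + 4) * (2 * m + 3) * (2 * m + 2)) / 12 :: complex)
        = fact (2 * m + 3) / 6 * (2 + of_nat m)"
      unfolding f by (simp add: field_simps del: fact_Suc)
    have c2: "fact (2 * m + 1) * (of_nat ((2 * m + 3) * (2 * m + 2) * (2 * m + 1)) / 6 :: complex)
        = fact (2 * m + 3) / 6 * (2 * of_nat m + 1)"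
      unfolding f by (simp add: field_simps del: fact_Suc)
    have "K = (fact (2 * m + 1) * (of_nat ((2 * m + 4) * (2 * m + 3) * (2 * m + 2)) / 12)) * (x + y) * jacobi_odd m t
            / (of_real pi ^ (2 * m + 3) * (x * y) ^ (m + 3))
          - (fact (2 * m + 1) * (of_nat ((2 * m + 3) * (2 * m + 2) * (2 * m + 1)) / 6)) * jacobi_even m t
            / (of_real pi ^ (2 * m + 3) * (x * y) ^ (m + 2))"
    proof -
      have e: "2 * m + 1 + 2 = 2 * m + 3" "2 * m + 1 - 1 = 2 * m" by simp_all
      show ?thesis
        unfolding K m e even odd
        by (simp only: right_diff_distrib times_divide_eq_left times_divide_eq_right divide_divide_eq_left mult_ac)
    qed
    also have "\<dots> = C * (2 + of_nat m) * (x + y) * (pochhammer (5/2) m / fact m * jacobi_odd m t)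
            / (of_real pi ^ (2 * m + 3) * (x * y) ^ (m + 3))
          - C * (2 * of_nat m + 1) * (pochhammer (5/2) m / fact m * jacobi_even m t)
            / (of_real pi ^ (2 * m + 3) * (x * y) ^ (m + 2))"
      unfolding c1 c2 Cp[symmetric] by (simp only: mult_ac)
    finally show ?thesis unfolding Let_def Gamma_nat_offset(2) JE JO S P C_def .
  qed
  moreover have "K = Gamma (3 + 2 * of_nat m) * fact m *
            ((2 * jacobi_P m (3/2) (-1/2) ((x' + 1) / (1 - x'))
              - (2 - \<nu>1 - \<nu>2) * jacobi_P (m - 1) (3/2) (1/2) ((x' + 1) / (1 - x'))) /
             (6 * of_real pi ^ (2 * m + 2) * pochhammer (5/2) (m - 1) *
              (1 - \<nu>1 - \<nu>2 + \<nu>1 * \<nu>2) ^ (m + 2)))"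
    if m: "m \<ge> 1" "n = 2 * m" for m
  proof -
    obtain l where l: "m = Suc l" using m(1) by (cases m) auto
    define p where "p = (pochhammer (5/2) l :: complex)"
    have p: "p \<noteq> 0" unfolding p_def by (rule pochhammer_five_halves_nonzero)
    have pm: "pochhammer (5/2 :: complex) (Suc l) = p * (of_nat l + 5/2)"
      by (simp add: p_def pochhammer_Suc add_ac)
    define E where "E = jacobi_even (Suc l) t"
    define O' where "O' = jacobi_odd l t"
    define Q where "Q = of_real pi ^ (2 * Suc l + 2) * (x * y) ^ (Suc l + 2)"
    have Q: "Q \<noteq> 0" using nz by (simp add: Q_def)
    have f: "fact (2 * Suc l + 2) = (of_nat ((2 * l + 4) * (2 * l + 3)) * fact (2 * Suc l) :: complex)"
      by (simp add: numeral_eq_Suc algebra_simps)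
    have "K = fact (2 * Suc l) * (of_nat ((2 * Suc l + 3) * (2 * Suc l + 2) * (2 * Suc l + 1)) / 6 * E
          - of_nat ((2 * l + 4) * (2 * l + 3) * (2 * l + 2)) / 12 * (x + y) * O') / Q"
    proof -
      have "gegen (2 * Suc l - 1) x y = of_nat ((2 * l + 4) * (2 * l + 3) * (2 * l + 2)) / 12 * (x + y) * O' / (x * y) ^ (Suc l + 2)"
        using odd[of l] by (simp add: O'_def numeral_eq_Suc)
      then show ?thesis
        unfolding K m(2) l even Q_def E_def
        by (simp only: right_diff_distrib diff_divide_distrib times_divide_eq_left times_divide_eq_right divide_divide_eq_left mult_ac)
    qed
    also have "\<dots> = fact (2 * Suc l + 2) * fact (Suc l) *
        ((2 * (pochhammer (5/2) (Suc l) / fact (Suc l) * E) - (x + y) * (p / fact l * O')) / (6 * p * Q))"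
    proof -
      have a: "fact (2 * Suc l) * (of_nat ((2 * Suc l + 3) * (2 * Suc l + 2) * (2 * Suc l + 1)) / 6)
          = fact (2 * Suc l + 2) * (2 * (of_nat l + 5/2)) / (6 :: complex)"
        unfolding f by (simp add: field_simps del: fact_Suc)
      have b: "fact (2 * Suc l) * (of_nat ((2 * l + 4) * (2 * l + 3) * (2 * l + 2)) / 12)
          = fact (2 * Suc l + 2) * of_nat (Suc l) / (6 :: complex)"
        unfolding f by (simp add: field_simps del: fact_Suc)
      have cancel: "F * (k * f) * ((2 * (p * c / (k * f) * E) - s * (p / f * O')) / (6 * p * Q))
          = (F * (2 * c) / 6 * E - F * k / 6 * (s * O')) / Q" if "f \<noteq> 0" "k \<noteq> 0" for F f k c s :: complex
        using that p Q by (simp add: field_simps)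
      have fl: "fact (Suc l) = (of_nat (Suc l) * fact l :: complex)" by simp
      have "fact (2 * Suc l + 2) * fact (Suc l) *
        ((2 * (pochhammer (5/2) (Suc l) / fact (Suc l) * E) - (x + y) * (p / fact l * O')) / (6 * p * Q))
        = (fact (2 * Suc l + 2) * (2 * (of_nat l + 5/2)) / 6 * E
          - fact (2 * Suc l + 2) * of_nat (Suc l) / 6 * ((x + y) * O')) / Q"
        unfolding pm fl by (rule cancel) (simp_all del: of_nat_Suc)
      then show ?thesis unfolding a[symmetric] b[symmetric]
        by (simp only: right_diff_distrib mult_ac)
    qed
    finally show ?thesis
      unfolding Gamma_nat_offset(3) JE JO S P l Q_def E_def O'_def p_def diff_Suc_1
      by (simp only: mult_ac)
  qed
  moreover have "K = Gamma (3 + of_nat n) * (3 + of_nat n * (w1 * cnj \<xi>1)) /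
            (6 * of_real pi ^ (n + 2) * (1 - w1 * cnj \<xi>1) ^ (4 + n))"
    if eq: "w1 * cnj \<xi>1 = w2 * cnj \<xi>2"
  proof -
    obtain l where l: "n = Suc l" using n1 by (cases n) auto
    have xy: "y = x" using eq by (simp add: x_def y_def assms(5,6))
    have ch: "of_nat ((k + 3) choose 3) = (of_nat ((k + 3) * (k + 2) * (k + 1)) / 6 :: complex)" for k
    proof -
      have "of_nat ((k + 3) choose 3) = (of_nat (k + 3) gchoose 3 :: complex)"
        by (simp only: binomial_gbinomial)
      then show ?thesis by (simp add: gbinomial_prod_rev numeral_3_eq_3 fact_numeral algebra_simps)
    qed
    have "K = fact n / of_real pi ^ (n + 2) * (of_nat ((n + 3) * (n + 2) * (n + 1)) / 6 / x ^ (n + 4)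
        - of_nat ((l + 3) * (l + 2) * (l + 1)) / 6 / x ^ (l + 4))"
      unfolding K xy gegen_diagonal[OF nz(1)] ch by (simp add: l)
    also have "of_nat ((l + 3) * (l + 2) * (l + 1)) / 6 / x ^ (l + 4)
        = of_nat ((n + 2) * (n + 1) * n) / 6 * x / x ^ (n + 4)"
    proof -
      have index: "n + 4 = Suc (l + 4)" "l + 3 = n + 2" "l + 2 = n + 1" "l + 1 = n"
        by (simp_all add: l)
      have "x ^ (n + 4) = x * x ^ (l + 4)" by (simp only: index(1) power_Suc)
      then show ?thesis using nz(1) by (simp only: index(2-4)) simp
    qed
    also have "of_nat ((n + 3) * (n + 2) * (n + 1)) / 6 / x ^ (n + 4) - of_nat ((n + 2) * (n + 1) * n) / 6 * x / x ^ (n + 4)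
        = of_nat ((n + 2) * (n + 1)) * (3 + of_nat n * \<nu>1) / (6 * x ^ (n + 4))"
      by (simp add: diff_divide_distrib[symmetric] x_def) (simp add: algebra_simps)
    also have "fact n / of_real pi ^ (n + 2) * (of_nat ((n + 2) * (n + 1)) * (3 + of_nat n * \<nu>1) / (6 * x ^ (n + 4)))
        = fact (n + 2) * (3 + of_nat n * \<nu>1) / (6 * of_real pi ^ (n + 2) * x ^ (4 + n))"
    proof -
      have "fact (n + 2) = (of_nat ((n + 2) * (n + 1)) * fact n :: complex)" by (simp add: algebra_simps)
      then show ?thesis by (simp only: times_divide_times_eq add.commute mult_ac)
    qed
    finally show ?thesis unfolding Gamma_nat_offset(1) x_def assms(5) .
  qed
  ultimately show ?thesis by blast
qed

end
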